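(* Let $f\in\mathbb{Z}[t_1,t_2,t_3]$ be a nondegenerate ternary quadratic form that is anisotropic (over $\mathbb{Q}$). Then $\delta(f)<1$.
   Context: $D_f\coloneqq f(\mathbb{Z}^3)\setminus\{0\}$. For $S\subset\mathbb{Z}$: $S$ is positive if it contains no negative integers, negative if it contains no positive integers, indefinite otherwise. The density of $S$ is $\lim_{N\to\infty}\#(S\cap[1,N])/N$ if $S$ is positive, $\lim_{N\to\infty}\#(S\cap[-N,-1])/N$ if $S$ is negative, and $\lim_{N\to\infty}\#(S\cap[-N,N])/(2N)$ if $S$ is indefinite (the limit being required to exist). $\delta(f)$ denotes the density of $D_f$. *)

theory Defs
  imports "HOL-Analysis.Analysis"
begin

text \<open>
  A value of the following type is a homogeneous quadratic polynomial in
  \<open>\<int>[t\<^sub>1, t\<^sub>2, t\<^sub>3]\<close>; the field \<open>cij\<close> is the coefficient of \<open>t\<^sub>i t\<^sub>j\<close>,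
  so the mixed coefficients need not be even.
\<close>

datatype ternary_form =
  Ternary_Form (c11: int) (c22: int) (c33: int) (c12: int) (c13: int) (c23: int)

definition form_eval :: "ternary_form \<Rightarrow> 'a::comm_ring_1 \<Rightarrow> 'a \<Rightarrow> 'a \<Rightarrow> 'a" where
  "form_eval f x y z =
     of_int (c11 f) * x\<^sup>2 + of_int (c22 f) * y\<^sup>2 + of_int (c33 f) * z\<^sup>2
     + of_int (c12 f) * x * y + of_int (c13 f) * x * z + of_int (c23 f) * y * z"

definition gram_matrix :: "ternary_form \<Rightarrow> rat^3^3" where
  "gram_matrix f = vector
     [vector [of_int (c11 f), of_int (c12 f) / 2, of_int (c13 f) / 2],
      vector [of_int (c12 f) / 2, of_int (c22 f), of_int (c23 f) / 2],
      vector [of_int (c13 f) / 2, of_int (c23 f) / 2, of_int (c33 f)]]"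

definition nondegenerate :: "ternary_form \<Rightarrow> bool" where
  "nondegenerate f \<longleftrightarrow> det (gram_matrix f) \<noteq> 0"

definition anisotropic :: "ternary_form \<Rightarrow> bool" where
  "anisotropic f \<longleftrightarrow>
     (\<forall>x y z :: rat. form_eval f x y z = 0 \<longrightarrow> x = 0 \<and> y = 0 \<and> z = 0)"

definition nonzero_values :: "ternary_form \<Rightarrow> int set" where
  "nonzero_values f = {form_eval f x y z | x y z :: int. True} - {0}"

definition positive_set :: "int set \<Rightarrow> bool" where
  "positive_set S \<longleftrightarrow> (\<forall>n\<in>S. \<not> n < 0)"

definition negative_set :: "int set \<Rightarrow> bool" where
  "negative_set S \<longleftrightarrow> (\<forall>n\<in>S. \<not> n > 0)"

text \<open>
  A set that is both positive and negative is contained in \<open>{0}\<close>, and then the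
  first two branches agree.
\<close>

definition density_seq :: "int set \<Rightarrow> nat \<Rightarrow> real" where
  "density_seq S N =
     (if positive_set S then real (card (S \<inter> {1..int N})) / real N
      else if negative_set S then real (card (S \<inter> {- int N..-1})) / real N
      else real (card (S \<inter> {- int N..int N})) / (2 * real N))"

definition has_density :: "int set \<Rightarrow> bool" where
  "has_density S \<longleftrightarrow> convergent (density_seq S)"

text \<open>Meaningful only if \<open>has_density S\<close> holds.\<close>

definition density :: "int set \<Rightarrow> real" where
  "density S = lim (density_seq S)"

definition form_density :: "ternary_form \<Rightarrow> real" where
  "form_density f = density (nonzero_values f)"

end

theory Submission
  imports
    Defs
    "HOL-Computational_Algebra.Squarefree"
    "HOL-Number_Theory.Cong"
    "HOL-Real_Asymp.Real_Asymp"
begin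

text \<open>
  Over an orthogonal basis of a sublattice, the values of \<open>f\<close> on a coset of a multiple of that
  sublattice are \<open>r + M F(u)\<close> with \<open>F(u) = \<Sum> l\<^sub>i u\<^sub>i + q \<Sum> a\<^sub>i u\<^sub>i\<^sup>2\<close>, where all primes up to a bound \<open>P\<close>
  divide \<open>q\<close> but none of them divides all \<open>l\<^sub>i\<close>. The second moment of the number of representations
  \<open>F(u) = k\<close> is elementary: with \<open>s = u - v\<close> and \<open>t = u + v\<close> the equation \<open>F(u) = F(v)\<close> becomes
  \<open>\<Sum> s\<^sub>i (l\<^sub>i + q a\<^sub>i t\<^sub>i) = 0\<close>, a lattice-point count in the plane for each fixed \<open>t\<close>. As no small
  prime divides all three coefficients, the second moment exceeds the square of the first by a factor
  \<open>1 + O(1/P)\<close> only, and by Cauchy-Schwarz \<open>F\<close> represents all positive integers outside a set of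
  density \<open>O(1/P)\<close>. So, up to small density, membership in the set of values is decided by the
  residue modulo a highly divisible integer, and the density exists.

  Legendre's descent on \<open>z\<^sup>2 = a x\<^sup>2 + b y\<^sup>2\<close>, run with the local conditions at all finite primes and
  none at infinity, ends at \<open>(\<plusminus>1, \<plusminus>1)\<close>; the only insoluble case \<open>(-1, -1)\<close> is excluded at \<open>2\<close>. Hence a
  form that is anisotropic over the rationals, definite or not, is anisotropic at some prime \<open>p\<close>.
  There it does not represent minus its discriminant, so a whole residue class modulo a power of \<open>p\<close>
  is missed and the density is less than one.
\<close>


section \<open>Linear congruences in boxes\<close>

definition has_short_solution :: "int \<Rightarrow> int \<Rightarrow> int \<Rightarrow> int \<Rightarrow> bool" where
  "has_short_solution c \<alpha> \<beta> K \<longleftrightarrow>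
     (\<exists>x y. (x, y) \<noteq> (0, 0) \<and> \<bar>x\<bar> \<le> K \<and> \<bar>y\<bar> \<le> K \<and> c dvd \<alpha> * x + \<beta> * y)"

lemma pigeonhole_congruence_solution:
  fixes c \<alpha> \<beta> m n :: int
  assumes "c > 0" "m > 0" "n > 0" "c < m * n"
  obtains x y where "(x, y) \<noteq> (0, 0)" "\<bar>x\<bar> < m" "\<bar>y\<bar> < n" "c dvd \<alpha> * x + \<beta> * y"
proof -
  let ?box = "{0..<m} \<times> {0..<n}"
  let ?residue = "\<lambda>(x, y). (\<alpha> * x + \<beta> * y) mod c"
  have "?residue ` ?box \<subseteq> {0..<c}" using assms by auto
  then have "card (?residue ` ?box) \<le> card {0..<c}" by (intro card_mono) auto
  also have "\<dots> < card ?box"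
    using assms by (simp add: card_cartesian_product flip: nat_mult_distrib)
  finally have "\<not> inj_on ?residue ?box" by (rule pigeonhole)
  then obtain x y x' y' where in_box: "(x, y) \<in> ?box" "(x', y') \<in> ?box"
    and distinct: "(x, y) \<noteq> (x', y')"
    and same_residue: "(\<alpha> * x + \<beta> * y) mod c = (\<alpha> * x' + \<beta> * y') mod c"
    by (auto simp: inj_on_def)
  have "c dvd (\<alpha> * x + \<beta> * y) - (\<alpha> * x' + \<beta> * y')"
    using same_residue by (simp add: mod_eq_dvd_iff)
  then have "c dvd \<alpha> * (x - x') + \<beta> * (y - y')" by (simp add: algebra_simps)
  moreover have "\<bar>x - x'\<bar> < m" "\<bar>y - y'\<bar> < n" "(x - x', y - y') \<noteq> (0, 0)"
    using in_box distinct by auto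
  ultimately show ?thesis using that by blast
qed

lemma shortest_congruence_solution:
  fixes c \<alpha> \<beta> x0 y0 :: int
  assumes "(x0, y0) \<noteq> (0, 0)" "c dvd \<alpha> * x0 + \<beta> * y0"
  obtains x1 y1 where "(x1, y1) \<noteq> (0, 0)" "c dvd \<alpha> * x1 + \<beta> * y1"
    "\<And>x y. (x, y) \<noteq> (0, 0) \<Longrightarrow> c dvd \<alpha> * x + \<beta> * y \<Longrightarrow> max \<bar>x1\<bar> \<bar>y1\<bar> \<le> max \<bar>x\<bar> \<bar>y\<bar>"
proof -
  let ?solution = "\<lambda>(x, y). (x, y) \<noteq> (0, 0) \<and> c dvd \<alpha> * x + \<beta> * y"
  let ?size = "\<lambda>(x :: int, y :: int). nat (max \<bar>x\<bar> \<bar>y\<bar>)"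
  have "?solution (x0, y0)" using assms by simp
  then have "\<exists>v. ?solution v \<and> (\<forall>w. ?solution w \<longrightarrow> ?size v \<le> ?size w)" by (rule ex_has_least_nat)
  then obtain v where v: "?solution v" "\<And>w. ?solution w \<Longrightarrow> ?size v \<le> ?size w" by blast
  obtain x1 y1 where v_eq: "v = (x1, y1)" by (cases v)
  show ?thesis
  proof
    show "(x1, y1) \<noteq> (0, 0)" "c dvd \<alpha> * x1 + \<beta> * y1" using v(1) by (auto simp: v_eq)
    fix x y assume "(x, y) \<noteq> (0, 0)" "c dvd \<alpha> * x + \<beta> * y"
    then have "nat (max \<bar>x1\<bar> \<bar>y1\<bar>) \<le> nat (max \<bar>x\<bar> \<bar>y\<bar>)" using v(2)[of "(x, y)"] by (simp add: v_eq)
    then show "max \<bar>x1\<bar> \<bar>y1\<bar> \<le> max \<bar>x\<bar> \<bar>y\<bar>"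
      by (simp only: nat_le_eq_zle le_max_iff_disj abs_ge_zero simp_thms)
  qed
qed

lemma independent_short_solution:
  fixes c \<alpha> \<beta> h x1 y1 :: int
  assumes c: "c > 0" "c < \<bar>x1\<bar> * (h + 1)" and h: "0 \<le> h" and dominant: "\<bar>y1\<bar> \<le> \<bar>x1\<bar>"
    and shortest: "\<And>x y. (x, y) \<noteq> (0, 0) \<Longrightarrow> c dvd \<alpha> * x + \<beta> * y \<Longrightarrow> \<bar>x1\<bar> \<le> max \<bar>x\<bar> \<bar>y\<bar>"
  obtains x2 y2 where "c dvd \<alpha> * x2 + \<beta> * y2" "\<bar>x2\<bar> < \<bar>x1\<bar>" "\<bar>y2\<bar> \<le> h" "x1 * y2 \<noteq> x2 * y1"
proof -
  have x1: "0 < \<bar>x1\<bar>" using c by auto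
  moreover have "0 < h + 1" using h by simp
  ultimately obtain x2 y2 where solution: "(x2, y2) \<noteq> (0, 0)" "c dvd \<alpha> * x2 + \<beta> * y2"
    and small: "\<bar>x2\<bar> < \<bar>x1\<bar>" "\<bar>y2\<bar> < h + 1"
    by (rule pigeonhole_congruence_solution[OF c(1) _ _ c(2)])
  then have "\<bar>x1\<bar> \<le> \<bar>y2\<bar>" using shortest[OF solution] by simp
  then have "\<bar>x1\<bar> * \<bar>x1\<bar> \<le> \<bar>x1\<bar> * \<bar>y2\<bar>" using x1 by (intro mult_left_mono) auto
  moreover have "\<bar>x2\<bar> * \<bar>y1\<bar> \<le> \<bar>x2\<bar> * \<bar>x1\<bar>" using dominant by (intro mult_left_mono) auto
  moreover have "\<bar>x2\<bar> * \<bar>x1\<bar> < \<bar>x1\<bar> * \<bar>x1\<bar>" using small x1 by (intro mult_strict_right_mono) auto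
  ultimately have "\<bar>x1 * y2\<bar> \<noteq> \<bar>x2 * y1\<bar>" unfolding abs_mult by linarith
  then have "x1 * y2 \<noteq> x2 * y1" by auto
  then show ?thesis using that[of x2 y2] solution small by simp
qed

lemma independent_short_solutions:
  fixes c \<alpha> \<beta> h K :: int
  assumes c: "c > 0" "c < (K + 1) * (h + 1)" and K: "0 \<le> K" "K \<le> h"
    and no_short: "\<not> has_short_solution c \<alpha> \<beta> K"
  obtains x1 y1 x2 y2 where "c dvd \<alpha> * x1 + \<beta> * y1" "c dvd \<alpha> * x2 + \<beta> * y2"
    "\<bar>x1\<bar> \<le> h" "\<bar>y1\<bar> \<le> h" "\<bar>x2\<bar> \<le> h" "\<bar>y2\<bar> \<le> h" "x1 * y2 \<noteq> x2 * y1"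
proof -
  have "(K + 1) * (h + 1) \<le> (h + 1) * (h + 1)" using K by (intro mult_right_mono) auto
  then have "c < (h + 1) * (h + 1)" using c by linarith
  moreover have "0 < h + 1" using K by simp
  ultimately obtain x0 y0 where start: "(x0, y0) \<noteq> (0, 0)" "\<bar>x0\<bar> < h + 1" "\<bar>y0\<bar> < h + 1"
      "c dvd \<alpha> * x0 + \<beta> * y0"
    using pigeonhole_congruence_solution[OF c(1)] by metis
  obtain x1 y1 where v1: "(x1, y1) \<noteq> (0, 0)" "c dvd \<alpha> * x1 + \<beta> * y1"
    and shortest: "\<And>x y. (x, y) \<noteq> (0, 0) \<Longrightarrow> c dvd \<alpha> * x + \<beta> * y \<Longrightarrow> max \<bar>x1\<bar> \<bar>y1\<bar> \<le> max \<bar>x\<bar> \<bar>y\<bar>"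
    using shortest_congruence_solution[OF start(1,4)] by blast
  let ?size = "max \<bar>x1\<bar> \<bar>y1\<bar>"
  have size: "?size \<le> h" using shortest[OF start(1,4)] start(2,3) by linarith
  have "\<not> (\<bar>x1\<bar> \<le> K \<and> \<bar>y1\<bar> \<le> K)" using no_short v1 unfolding has_short_solution_def by blast
  then have "K < ?size" by linarith
  then have "(K + 1) * (h + 1) \<le> ?size * (h + 1)" using K by (intro mult_right_mono) auto
  then have c_less: "c < ?size * (h + 1)" using c by linarith
  show ?thesis
  proof (cases "\<bar>y1\<bar> \<le> \<bar>x1\<bar>")
    case True
    then have "?size = \<bar>x1\<bar>" by simp
    then obtain x2 y2 where "c dvd \<alpha> * x2 + \<beta> * y2" "\<bar>x2\<bar> < \<bar>x1\<bar>" "\<bar>y2\<bar> \<le> h" "x1 * y2 \<noteq> x2 * y1"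
      using independent_short_solution[of c x1 h y1 \<alpha> \<beta>] c c_less K True shortest by auto
    then show ?thesis using that[of x1 y1 x2 y2] v1 size by simp
  next
    case False
    then have size_eq: "?size = \<bar>y1\<bar>" by simp
    have swapped: "c < \<bar>y1\<bar> * (h + 1)" "0 \<le> h" "\<bar>x1\<bar> \<le> \<bar>y1\<bar>" using c_less K False size_eq by auto
    have "\<bar>y1\<bar> \<le> max \<bar>y\<bar> \<bar>x\<bar>" if "(y, x) \<noteq> (0, 0)" "c dvd \<beta> * y + \<alpha> * x" for x y
      using shortest[of x y] that size_eq by (auto simp: add.commute max.commute)
    then obtain x2 y2 where "c dvd \<beta> * y2 + \<alpha> * x2" "\<bar>y2\<bar> < \<bar>y1\<bar>" "\<bar>x2\<bar> \<le> h" "y1 * x2 \<noteq> y2 * x1"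
      by (rule independent_short_solution[OF c(1) swapped])
    then show ?thesis using that[of x1 y1 x2 y2] v1 size by (simp add: ac_simps)
  qed
qed

lemma linear_system_solvable:
  fixes x1 y1 x2 y2 :: "'a::field"
  assumes "x1 * y2 \<noteq> x2 * y1"
  obtains u v where "x = u * x1 + v * x2" "y = u * y1 + v * y2"
proof
  let ?D = "x1 * y2 - x2 * y1"
  have "?D \<noteq> 0" using assms by simp
  then show "x = (x * y2 - y * x2) / ?D * x1 + (x1 * y - y1 * x) / ?D * x2"
    "y = (x * y2 - y * x2) / ?D * y1 + (x1 * y - y1 * x) / ?D * y2"
    by (simp_all add: divide_simps) (simp_all add: algebra_simps)
qed

lemma reduction_modulo_independent_pair:
  fixes x1 y1 x2 y2 x y h :: int
  assumes "\<bar>x1\<bar> \<le> h" "\<bar>y1\<bar> \<le> h" "\<bar>x2\<bar> \<le> h" "\<bar>y2\<bar> \<le> h" "x1 * y2 \<noteq> x2 * y1"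
  obtains i j where "\<bar>x - i * x1 - j * x2\<bar> \<le> 2 * h" "\<bar>y - i * y1 - j * y2\<bar> \<le> 2 * h"
proof -
  have "real_of_int x1 * y2 \<noteq> real_of_int x2 * y1" using assms(5) by (simp flip: of_int_mult)
  then obtain u v :: real where coords: "real_of_int x = u * x1 + v * x2"
    "real_of_int y = u * y1 + v * y2"
    by (rule linear_system_solvable)
  have "\<bar>z - \<lfloor>u\<rfloor> * z1 - \<lfloor>v\<rfloor> * z2\<bar> \<le> 2 * h"
    if "\<bar>z1\<bar> \<le> h" "\<bar>z2\<bar> \<le> h" "real_of_int z = u * z1 + v * z2" for z z1 z2
  proof -
    have "real_of_int (z - \<lfloor>u\<rfloor> * z1 - \<lfloor>v\<rfloor> * z2) = frac u * z1 + frac v * z2"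
      using that by (simp add: frac_def algebra_simps)
    moreover have "\<bar>frac w * z'\<bar> \<le> 1 * real_of_int h" if "\<bar>z'\<bar> \<le> h" for w and z' :: int
      unfolding abs_mult using that frac_ge_0[of w] frac_lt_1[of w] by (intro mult_mono) auto
    from this[OF that(1), of u] this[OF that(2), of v]
    have "\<bar>frac u * z1 + frac v * z2\<bar> \<le> 2 * real_of_int h" by linarith
    ultimately show ?thesis by linarith
  qed
  then show ?thesis using that coords assms by blast
qed

lemma card_linear_residues:
  fixes c \<alpha> \<beta> :: int
  assumes "c > 0"
  shows "c \<le> gcd c (gcd \<alpha> \<beta>) * int (card (range (\<lambda>(x, y). (\<alpha> * x + \<beta> * y) mod c)))"
proof -
  let ?g = "gcd c (gcd \<alpha> \<beta>)" and ?R = "range (\<lambda>(x, y). (\<alpha> * x + \<beta> * y) mod c)"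
  have g: "?g > 0" "?g dvd c" using assms by (auto simp: gcd_pos_int)
  then obtain k where k: "c = ?g * k" by blast
  obtain u v where uv: "u * c + v * gcd \<alpha> \<beta> = ?g" using bezout_int by metis
  obtain u' v' where uv': "u' * \<alpha> + v' * \<beta> = gcd \<alpha> \<beta>" using bezout_int by metis
  have "(*) ?g ` {0..<k} \<subseteq> ?R"
  proof (rule image_subsetI)
    fix i assume i: "i \<in> {0..<k}"
    then have range: "0 \<le> ?g * i" "?g * i < c" using g mult_strict_left_mono[of i k ?g] k by auto
    have "?g * i = (v * (u' * \<alpha> + v' * \<beta>) + u * c) * i" using uv uv' by (simp add: algebra_simps)
    also have "\<dots> = \<alpha> * (i * v * u') + \<beta> * (i * v * v') + c * (u * i)" by (simp add: algebra_simps)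
    finally have "?g * i = (\<alpha> * (i * v * u') + \<beta> * (i * v * v')) mod c"
      using range by (metis mod_mult_self2 mod_pos_pos_trivial)
    then show "?g * i \<in> ?R" by (auto simp: image_iff)
  qed
  moreover have "finite ?R" by (rule finite_subset[of _ "{0..<c}"]) (use assms in auto)
  ultimately have "card ((*) ?g ` {0..<k}) \<le> card ?R" by (intro card_mono)
  moreover have "card ((*) ?g ` {0..<k}) = nat k"
    using g by (subst card_image) (auto simp: inj_on_def)
  ultimately have "k \<le> int (card ?R)" by linarith
  then show ?thesis using k g by (metis mult_left_mono less_imp_le)
qed

lemma linear_residue_transversal:
  fixes c \<alpha> \<beta> h K :: int
  assumes "c > 0" "c < (K + 1) * (h + 1)" "0 \<le> K" "K \<le> h" "\<not> has_short_solution c \<alpha> \<beta> K"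
  obtains S where "S \<subseteq> {-2 * h..2 * h} \<times> {-2 * h..2 * h}"
    "inj_on (\<lambda>(x, y). (\<alpha> * x + \<beta> * y) mod c) S"
    "(\<lambda>(x, y). (\<alpha> * x + \<beta> * y) mod c) ` S = range (\<lambda>(x, y). (\<alpha> * x + \<beta> * y) mod c)"
proof -
  let ?residue = "\<lambda>(x, y). (\<alpha> * x + \<beta> * y) mod c"
  obtain x1 y1 x2 y2 where v: "c dvd \<alpha> * x1 + \<beta> * y1" "c dvd \<alpha> * x2 + \<beta> * y2"
    and short: "\<bar>x1\<bar> \<le> h" "\<bar>y1\<bar> \<le> h" "\<bar>x2\<bar> \<le> h" "\<bar>y2\<bar> \<le> h" "x1 * y2 \<noteq> x2 * y1"
    using independent_short_solutions[OF assms] by blast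
  have "?residue (x, y) \<in> ?residue ` ({-2 * h..2 * h} \<times> {-2 * h..2 * h})" for x y
  proof -
    obtain i j where ij: "\<bar>x - i * x1 - j * x2\<bar> \<le> 2 * h" "\<bar>y - i * y1 - j * y2\<bar> \<le> 2 * h"
      using reduction_modulo_independent_pair[OF short] by blast
    let ?x = "x - i * x1 - j * x2" and ?y = "y - i * y1 - j * y2"
    have "\<alpha> * x + \<beta> * y - (\<alpha> * ?x + \<beta> * ?y) = i * (\<alpha> * x1 + \<beta> * y1) + j * (\<alpha> * x2 + \<beta> * y2)"
      by (simp add: algebra_simps)
    then have "(\<alpha> * x + \<beta> * y) mod c = (\<alpha> * ?x + \<beta> * ?y) mod c" using v by (simp add: mod_eq_dvd_iff)
    moreover have "(?x, ?y) \<in> {-2 * h..2 * h} \<times> {-2 * h..2 * h}" using ij by auto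
    ultimately show ?thesis by force
  qed
  then have "range ?residue \<subseteq> ?residue ` ({-2 * h..2 * h} \<times> {-2 * h..2 * h})"
    by (intro image_subsetI) (simp only: split_paired_all)
  then show ?thesis using that unfolding subset_image_inj by metis
qed

lemma inj_on_plus_residue_transversal:
  fixes c \<alpha> \<beta> \<gamma> :: int
  assumes S: "inj_on (\<lambda>(x, y). (\<alpha> * x + \<beta> * y) mod c) S"
    and solutions: "\<And>x y. (x, y) \<in> N \<Longrightarrow> c dvd \<alpha> * x + \<beta> * y - \<gamma>"
  shows "inj_on (\<lambda>(p, s). p + s) (N \<times> S)"
proof (rule inj_onI)
  fix z z' assume z: "z \<in> N \<times> S" "z' \<in> N \<times> S" "(\<lambda>(p, s). p + s) z = (\<lambda>(p, s). p + s) z'"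
  obtain x y u v x' y' u' v' where z_eq: "z = ((x, y), (u, v))" "z' = ((x', y'), (u', v'))"
    by (metis surj_pair)
  have dvd: "c dvd \<alpha> * x + \<beta> * y - \<gamma>" "c dvd \<alpha> * x' + \<beta> * y' - \<gamma>"
    using z(1,2) solutions by (simp_all add: z_eq)
  have S_mem: "(u, v) \<in> S" "(u', v') \<in> S" and diff: "u - u' = x' - x" "v - v' = y' - y"
    using z by (auto simp: z_eq)
  have "\<alpha> * u + \<beta> * v - (\<alpha> * u' + \<beta> * v') = \<alpha> * (u - u') + \<beta> * (v - v')"
    by (simp add: algebra_simps)
  also have "\<dots> = (\<alpha> * x' + \<beta> * y' - \<gamma>) - (\<alpha> * x + \<beta> * y - \<gamma>)"
    unfolding diff by (simp add: algebra_simps)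
  finally have "c dvd \<alpha> * u + \<beta> * v - (\<alpha> * u' + \<beta> * v')" using dvd by (metis dvd_diff)
  then have "(\<lambda>(x, y). (\<alpha> * x + \<beta> * y) mod c) (u, v) = (\<lambda>(x, y). (\<alpha> * x + \<beta> * y) mod c) (u', v')"
    by (simp only: prod.case mod_eq_dvd_iff)
  then have "(u, v) = (u', v')" using S S_mem by (meson inj_onD)
  then show "z = z'" using diff by (simp add: z_eq)
qed

lemma card_congruence_solutions_le:
  fixes c \<alpha> \<beta> \<gamma> h K A B A' B' :: int
  assumes c: "c > 0" "c < (K + 1) * (h + 1)" and K: "0 \<le> K" "K \<le> h"
    and no_short: "\<not> has_short_solution c \<alpha> \<beta> K"
  shows "int (card {(x, y) \<in> {A..A'} \<times> {B..B'}. c dvd \<alpha> * x + \<beta> * y - \<gamma>}) * c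
    \<le> gcd c (gcd \<alpha> \<beta>) * ((int (card {A..A'}) + 4 * h) * (int (card {B..B'}) + 4 * h))"
    (is "int (card ?N) * c \<le> ?g * ?area")
proof -
  let ?residue = "\<lambda>(x, y). (\<alpha> * x + \<beta> * y) mod c"
  let ?T = "{A - 2 * h..A' + 2 * h} \<times> {B - 2 * h..B' + 2 * h}"
  obtain S where S: "S \<subseteq> {-2 * h..2 * h} \<times> {-2 * h..2 * h}" "inj_on ?residue S"
      "?residue ` S = range ?residue"
    using linear_residue_transversal[OF c K no_short] .
  have "inj_on (\<lambda>(p, s). p + s) (?N \<times> S)"
    by (rule inj_on_plus_residue_transversal[OF S(2), of _ \<gamma>]) simp
  moreover have "(\<lambda>(p, s). p + s) ` (?N \<times> S) \<subseteq> ?T" using S(1) by force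
  ultimately have "card (?N \<times> S) \<le> card ?T" by (rule card_inj_on_le) simp
  then have "int (card ?N * card S) \<le> int (card ?T)"
    by (simp only: card_cartesian_product of_nat_le_iff)
  also have "card S = card (range ?residue)" using S(2,3) by (metis card_image)
  also have "int (card ?T) \<le> ?area"
    unfolding card_cartesian_product of_nat_mult using K by (intro mult_mono) auto
  finally have packing: "int (card ?N) * int (card (range ?residue)) \<le> ?area" by simp
  have "int (card ?N) * c \<le> int (card ?N) * (?g * int (card (range ?residue)))"
    using card_linear_residues[OF c(1), of \<alpha> \<beta>] by (intro mult_left_mono) auto
  also have "\<dots> = ?g * (int (card ?N) * int (card (range ?residue)))" by simp
  also have "\<dots> \<le> ?g * ?area" using packing by (intro mult_left_mono) auto
  finally show ?thesis .
qed

section \<open>Counting in intervals and the second moment inequality\<close>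

lemma card_separated_le:
  fixes S :: "int set" and e A B :: int
  assumes S: "S \<subseteq> {A..B}" and e: "e > 0" and AB: "A \<le> B + 1"
    and separated: "\<And>x y. x \<in> S \<Longrightarrow> y \<in> S \<Longrightarrow> x < y \<Longrightarrow> x + e \<le> y"
  shows "int (card S) * e \<le> B - A + e"
proof -
  have "inj_on (\<lambda>x. (x - A) div e) S"
  proof (rule linorder_inj_onI)
    fix x y assume "x < y" "x \<in> S" "y \<in> S"
    then have "(x - A) + e \<le> y - A" using separated by force
    then have "((x - A) + e) div e \<le> (y - A) div e" using e by (intro zdiv_mono1) auto
    then show "(x - A) div e \<noteq> (y - A) div e" using e by simp
  qed auto
  moreover have "(\<lambda>x. (x - A) div e) ` S \<subseteq> {0..(B - A) div e}"
    using S e by (force intro!: zdiv_mono1 simp: pos_imp_zdiv_nonneg_iff)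
  ultimately have "card S \<le> card {0..(B - A) div e}" by (rule card_inj_on_le) auto
  moreover have "- 1 div e \<le> (B - A) div e" using AB e by (intro zdiv_mono1) auto
  then have "(B - A) div e + 1 \<ge> 0" using e by (simp add: div_eq_minus1)
  ultimately have "int (card S) \<le> (B - A) div e + 1" by simp
  then have "int (card S) * e \<le> ((B - A) div e + 1) * e" using e by (intro mult_right_mono) auto
  also have "\<dots> = B - A - (B - A) mod e + e"
    by (simp add: distrib_right minus_mod_eq_div_mult)
  also have "\<dots> \<le> B - A + e" using e by simp
  finally show ?thesis .
qed

lemma card_progression_multiples_le:
  fixes e l k A B :: int
  assumes "coprime e k" "e > 0" "A \<le> B + 1"
  shows "int (card {t \<in> {A..B}. e dvd l + k * t}) * e \<le> B - A + e"
proof (rule card_separated_le)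
  fix x y assume "x \<in> {t \<in> {A..B}. e dvd l + k * t}" "y \<in> {t \<in> {A..B}. e dvd l + k * t}" "x < y"
  then have "e dvd (l + k * y) - (l + k * x)" by (blast intro: dvd_diff)
  then have "e dvd k * (y - x)" by (simp add: algebra_simps)
  then have "e dvd y - x" using assms(1) by (simp add: coprime_dvd_mult_right_iff)
  then show "x + e \<le> y" using \<open>x < y\<close> zdvd_imp_le[of e "y - x"] by simp
qed (use assms in auto)

lemma card_linear_congruence_le:
  fixes T b c r B B' :: int
  assumes "\<not> (\<exists>i\<in>{1..<T}. c dvd b * i)" "T > 0" "B \<le> B' + 1"
  shows "int (card {y \<in> {B..B'}. c dvd b * y - r}) * T \<le> B' - B + T"
proof (rule card_separated_le)
  fix x y assume "x \<in> {y \<in> {B..B'}. c dvd b * y - r}" "y \<in> {y \<in> {B..B'}. c dvd b * y - r}" "x < y"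
  then have "c dvd (b * y - r) - (b * x - r)" by (blast intro: dvd_diff)
  then have "c dvd b * (y - x)" by (simp add: algebra_simps)
  then have "y - x \<notin> {1..<T}" using assms(1) by blast
  then show "x + T \<le> y" using \<open>x < y\<close> by auto
qed (use assms in auto)

lemma card_linear_congruence_rectangle_le:
  fixes T a b c r B B' :: int
  assumes "\<not> (\<exists>i\<in>{1..<T}. c dvd b * i)" "T > 0" "B \<le> B' + 1" and A: "finite A"
  shows "int (card {(x, y) \<in> A \<times> {B..B'}. c dvd a * x + b * y - r}) * T \<le> int (card A) * (B' - B + T)"
proof -
  have finite_column: "finite {y \<in> {B..B'}. Q y}" for Q by (rule finite_subset[of _ "{B..B'}"]) auto
  have "{(x, y) \<in> A \<times> {B..B'}. c dvd a * x + b * y - r}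
    = Sigma A (\<lambda>x. {y \<in> {B..B'}. c dvd b * y - (r - a * x)})" (is "?N = _")
    by (auto simp: algebra_simps)
  then have "card ?N = (\<Sum>x\<in>A. card {y \<in> {B..B'}. c dvd b * y - (r - a * x)})"
    by (simp only:) (intro card_SigmaI ballI A finite_column)
  then have "int (card ?N) * T = (\<Sum>x\<in>A. int (card {y \<in> {B..B'}. c dvd b * y - (r - a * x)}) * T)"
    by (simp only: of_nat_sum sum_distrib_right)
  also have "\<dots> \<le> int (card A) * (B' - B + T)"
    by (intro sum_bounded_above card_linear_congruence_le assms)
  finally show ?thesis .
qed

lemma card_UN_le_mult:
  assumes "finite I" "\<And>i. i \<in> I \<Longrightarrow> int (card (A i)) \<le> b"
  shows "int (card (\<Union>i\<in>I. A i)) \<le> int (card I) * b"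
proof -
  have "int (card (\<Union>i\<in>I. A i)) \<le> int (\<Sum>i\<in>I. card (A i))"
    using card_UN_le[OF assms(1)] by (simp only: of_nat_le_iff)
  also have "\<dots> \<le> int (card I) * b"
    unfolding of_nat_sum using assms(2) by (rule sum_bounded_above)
  finally show ?thesis .
qed

lemma parity_class_eq_image:
  fixes e x m :: int
  assumes "e \<in> {0, 1}"
  shows "{t \<in> {x + 1..x + 2 * m}. t mod 2 = e} = (\<lambda>j. x + 2 * j - (x + e) mod 2) ` {1..m}"
proof (intro equalityI subsetI)
  fix t assume "t \<in> {t \<in> {x + 1..x + 2 * m}. t mod 2 = e}"
  then have "t = x + 2 * ((t - x + (x + e) mod 2) div 2) - (x + e) mod 2"
    "(t - x + (x + e) mod 2) div 2 \<in> {1..m}"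
    by (auto; presburger)+
  then show "t \<in> (\<lambda>j. x + 2 * j - (x + e) mod 2) ` {1..m}" by (rule image_eqI)
next
  fix t assume "t \<in> (\<lambda>j. x + 2 * j - (x + e) mod 2) ` {1..m}"
  then show "t \<in> {t \<in> {x + 1..x + 2 * m}. t mod 2 = e}" using assms by (auto; presburger)
qed

lemma card_parity_class:
  fixes e x m :: int
  assumes "e \<in> {0, 1}" "m \<ge> 0"
  shows "int (card {t \<in> {x + 1..x + 2 * m}. t mod 2 = e}) = m"
  unfolding parity_class_eq_image[OF assms(1)]
  using assms(2) by (subst card_image) (auto simp: inj_on_def)

lemma sum_parity_class_le:
  fixes e X :: int
  assumes "e \<in> {0, 1}" "X \<ge> 0"
  shows "(\<Sum>t\<in>{t \<in> {1..2 * X}. t mod 2 = e}. t) \<le> X * (X + 1)"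
proof -
  have class_eq: "{t \<in> {1..2 * X}. t mod 2 = e} = (\<lambda>j. 2 * j - e) ` {1..X}"
    using parity_class_eq_image[OF assms(1), of 0 X] assms(1) by auto
  have "(\<Sum>t\<in>{t \<in> {1..2 * X}. t mod 2 = e}. t) = (\<Sum>j\<in>{1..X}. 2 * j - e)"
    unfolding class_eq by (subst sum.reindex) (auto simp: inj_on_def)
  also have "\<dots> \<le> (\<Sum>j\<in>{1..X}. 2 * j)" using assms by (intro sum_mono) auto
  also have "\<dots> = X * (X + 1)"
    using assms(2)
  proof (induction X rule: int_ge_induct)
    case (step i)
    have "{1..i + 1} = insert (i + 1) {1..i}" using step by auto
    then show ?case using step by (simp add: algebra_simps)
  qed auto
  finally show ?thesis .
qed

definition summands :: "int \<Rightarrow> int \<Rightarrow> int set" where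
  "summands Y t = {x \<in> {1..Y}. t - x \<in> {1..Y}}"

lemma summands_eq_atLeastAtMost: "summands Y t = {max 1 (t - Y)..min Y (t - 1)}"
  by (auto simp: summands_def)

lemma finite_summands [simp]: "finite (summands Y t)"
  by (simp add: summands_eq_atLeastAtMost)

lemma card_summands_le: "Y \<ge> 0 \<Longrightarrow> int (card (summands Y t)) \<le> Y"
  by (auto simp: summands_eq_atLeastAtMost)

lemma sum_card_summands_parity_class:
  fixes e Y :: int
  assumes e: "e \<in> {0, 1}" and Y: "even Y" "Y \<ge> 0"
  shows "2 * (\<Sum>t\<in>{t \<in> {2..2 * Y}. t mod 2 = e}. int (card (summands Y t))) = Y^2"
proof -
  let ?T = "{t \<in> {2..2 * Y}. t mod 2 = e}"
  obtain m where m: "Y = 2 * m" using Y(1) by blast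
  have "(\<Sum>t\<in>?T. int (card (summands Y t))) = (\<Sum>t\<in>?T. \<Sum>x\<in>{x \<in> {1..Y}. t - x \<in> {1..Y}}. 1)"
    by (simp add: summands_def)
  also have "\<dots> = (\<Sum>x\<in>{1..Y}. \<Sum>t\<in>{t \<in> ?T. t - x \<in> {1..Y}}. 1)"
    by (rule sum.swap_restrict) (auto intro: finite_subset[of _ "{2..2 * Y}"])
  also have "\<dots> = (\<Sum>x\<in>{1..Y}. m)"
  proof (rule sum.cong)
    fix x assume "x \<in> {1..Y}"
    then have "{t \<in> ?T. t - x \<in> {1..Y}} = {t \<in> {x + 1..x + 2 * m}. t mod 2 = e}"
      using m by auto
    then show "(\<Sum>t\<in>{t \<in> ?T. t - x \<in> {1..Y}}. 1) = m"
      using card_parity_class[OF e, of m x] Y(2) m by simp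
  qed simp
  finally show ?thesis using Y(2) m by (simp add: power2_eq_square)
qed

definition parity_bounded :: "int set \<Rightarrow> (int \<Rightarrow> int) \<Rightarrow> int \<Rightarrow> bool" where
  "parity_bounded A W b \<longleftrightarrow> finite A \<and> (\<forall>t\<in>A. 0 \<le> W t) \<and>
     (\<forall>e\<in>{0, 1}. 2 * (\<Sum>t\<in>{t \<in> A. t mod 2 = e}. W t) \<le> b)"

lemma parity_bounded_sum:
  assumes "parity_bounded A W b"
  shows "0 \<le> sum W A" "sum W A \<le> b" "0 \<le> b"
proof -
  have A: "finite A" "\<forall>t\<in>A. 0 \<le> W t" "\<forall>e\<in>{0, 1}. 2 * (\<Sum>t\<in>{t \<in> A. t mod 2 = e}. W t) \<le> b"
    using assms unfolding parity_bounded_def by blast+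
  show "0 \<le> sum W A" using A(2) by (simp add: sum_nonneg)
  moreover have "sum W A = (\<Sum>e\<in>{0, 1}. \<Sum>t\<in>{t \<in> A. t mod 2 = e}. W t)"
    using A(1) by (intro sum.group[symmetric]) auto
  then show "sum W A \<le> b" using A(3) by auto
  ultimately show "0 \<le> b" by simp
qed

lemma sum_even_values_le:
  fixes g :: "'a \<Rightarrow> int"
  assumes W: "parity_bounded A W b" and B: "finite B" "\<And>s. s \<in> B \<Longrightarrow> 0 \<le> w s" "sum w B \<le> b'"
    and l: "odd l"
  shows "2 * (\<Sum>(t, s)\<in>A \<times> B. if even (l * t + g s) then W t * w s else 0) \<le> b * b'"
proof -
  have "2 * (\<Sum>t\<in>A. if even (l * t + g s) then W t * w s else 0) \<le> b * w s" if "s \<in> B" for s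
  proof -
    have "g s mod 2 \<in> {0, 1}" by auto
    then have class_bound: "2 * (\<Sum>t\<in>{t \<in> A. t mod 2 = g s mod 2}. W t) \<le> b"
      using W unfolding parity_bounded_def by (elim conjE) (rule bspec)
    have "even (l * t + g s) \<longleftrightarrow> t mod 2 = g s mod 2" for t using l by (simp; presburger)
    then have "2 * (\<Sum>t\<in>A. if even (l * t + g s) then W t * w s else 0)
      = 2 * (\<Sum>t\<in>{t \<in> A. t mod 2 = g s mod 2}. W t) * w s"
      using W by (simp add: sum.inter_filter[symmetric] sum_distrib_right parity_bounded_def)
    also have "\<dots> \<le> b * w s" using class_bound B(2)[OF that] by (intro mult_right_mono)
    finally show ?thesis .
  qed
  then have "(\<Sum>s\<in>B. 2 * (\<Sum>t\<in>A. if even (l * t + g s) then W t * w s else 0)) \<le> (\<Sum>s\<in>B. b * w s)"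
    by (rule sum_mono)
  also have "\<dots> \<le> b * b'"
    using B(3) parity_bounded_sum[OF W] by (simp add: mult_left_mono flip: sum_distrib_left)
  finally show ?thesis
    by (simp only: sum.cartesian_product[symmetric] sum.swap[of _ A B] sum_distrib_left)
qed

lemma sum_even_combinations_le_if_odd:
  fixes l l' l'' :: int
  assumes W: "parity_bounded A W b" and W': "parity_bounded A' W' b'"
    and W'': "parity_bounded A'' W'' b''"
    and odd: "odd l"
  shows "2 * (\<Sum>(t, s, r)\<in>A \<times> A' \<times> A''.
    if even (l * t + (l' * s + l'' * r)) then W t * (W' s * W'' r) else 0) \<le> b * (b' * b'')"
    (is "2 * ?S \<le> _")
proof -
  let ?g = "\<lambda>(s, r). l' * s + l'' * r" and ?w = "\<lambda>(s, r). W' s * W'' r"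
  have "sum ?w (A' \<times> A'') = sum W' A' * sum W'' A''"
    by (simp add: sum_product sum.cartesian_product)
  also have "\<dots> \<le> b' * b''"
    using parity_bounded_sum[OF W'] parity_bounded_sum[OF W''] by (intro mult_mono) auto
  finally have "2 * (\<Sum>(t, s)\<in>A \<times> (A' \<times> A''). if even (l * t + ?g s) then W t * ?w s else 0)
    \<le> b * (b' * b'')"
    using W' W'' by (intro sum_even_values_le W odd) (auto simp: parity_bounded_def)
  moreover have "?S = (\<Sum>(t, s)\<in>A \<times> (A' \<times> A''). if even (l * t + ?g s) then W t * ?w s else 0)"
    by (intro sum.cong) auto
  ultimately show ?thesis by simp
qed

lemma sum_even_combinations_le:
  fixes l1 l2 l3 :: int
  assumes W1: "parity_bounded A1 W1 b1" and W2: "parity_bounded A2 W2 b2"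
    and W3: "parity_bounded A3 W3 b3"
    and odd: "odd l1 \<or> odd l2 \<or> odd l3"
  shows "2 * (\<Sum>(t1, t2, t3)\<in>A1 \<times> A2 \<times> A3.
    if even (l1 * t1 + l2 * t2 + l3 * t3) then W1 t1 * (W2 t2 * W3 t3) else 0) \<le> b1 * (b2 * b3)"
    (is "2 * ?S \<le> _")
proof -
  consider "odd l1" | "odd l2" | "odd l3" using odd by blast
  then show ?thesis
  proof cases
    case 1
    from sum_even_combinations_le_if_odd[OF W1 W2 W3 this, of l2 l3] show ?thesis
      by (simp only: add.assoc)
  next
    case 2
    have "?S = (\<Sum>(t2, t1, t3)\<in>A2 \<times> A1 \<times> A3.
        if even (l2 * t2 + (l1 * t1 + l3 * t3)) then W2 t2 * (W1 t1 * W3 t3) else 0)"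
      by (rule sum.reindex_bij_witness[of _ "\<lambda>(y, x, z). (x, y, z)" "\<lambda>(x, y, z). (y, x, z)"])
        (auto simp: ac_simps)
    then show ?thesis
      using sum_even_combinations_le_if_odd[OF W2 W1 W3 2, of l1 l3] by (simp only: mult.left_commute)
  next
    case 3
    have "?S = (\<Sum>(t3, t1, t2)\<in>A3 \<times> A1 \<times> A2.
        if even (l3 * t3 + (l1 * t1 + l2 * t2)) then W3 t3 * (W1 t1 * W2 t2) else 0)"
      by (rule sum.reindex_bij_witness[of _ "\<lambda>(z, x, y). (x, y, z)" "\<lambda>(x, y, z). (z, x, y)"])
        (auto simp: ac_simps)
    then show ?thesis
      using sum_even_combinations_le_if_odd[OF W3 W1 W2 3, of l1 l2] by (simp only: mult_ac)
  qed
qed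

lemma weighted_second_moment:
  fixes g :: "'a \<Rightarrow> 'b" and \<phi> :: "'a \<Rightarrow> real"
  assumes B: "finite B"
  shows "(sum \<phi> B)^2 \<le> real (card (g ` B)) * (\<Sum>(u, v)\<in>{(u, v) \<in> B \<times> B. g u = g v}. \<phi> u * \<phi> v)"
proof -
  define r where "r k = (\<Sum>v\<in>{v \<in> B. g v = k}. \<phi> v)" for k
  have "(\<Sum>k\<in>g ` B. (r k)^2) = (\<Sum>k\<in>g ` B. \<Sum>u\<in>{u \<in> B. g u = k}. \<phi> u * r (g u))"
    by (simp add: r_def power2_eq_square sum_distrib_right)
  also have "\<dots> = (\<Sum>u\<in>B. \<phi> u * r (g u))" using B by (rule sum.image_gen[symmetric])
  also have "\<dots> = (\<Sum>u\<in>B. \<Sum>v\<in>{v \<in> B. g v = g u}. \<phi> u * \<phi> v)"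
    by (simp add: r_def sum_distrib_left)
  also have "\<dots> = (\<Sum>(u, v)\<in>(SIGMA u:B. {v \<in> B. g v = g u}). \<phi> u * \<phi> v)"
    using B by (intro sum.Sigma) auto
  also have "(SIGMA u:B. {v \<in> B. g v = g u}) = {(u, v) \<in> B \<times> B. g u = g v}" by auto
  finally have pairs: "(\<Sum>k\<in>g ` B. (r k)^2) = (\<Sum>(u, v)\<in>{(u, v) \<in> B \<times> B. g u = g v}. \<phi> u * \<phi> v)" .
  have "(sum \<phi> B)^2 = (\<Sum>k\<in>g ` B. r k)^2"
    unfolding r_def using B by (simp add: sum.image_gen[where g = g])
  also have "\<dots> \<le> real (card (g ` B)) * (\<Sum>k\<in>g ` B. (r k)^2)"
    using sum_squared_le_sum_of_squares[of r "g ` B"] B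
    by (cases "B = {}") (auto simp: mult.commute)
  finally show ?thesis unfolding pairs .
qed

section \<open>The second moment of the representation numbers\<close>

lemma sum_inverse_squares_le:
  fixes P n :: nat
  assumes "P \<ge> 1"
  shows "(\<Sum>e\<in>{P<..n}. 1 / real e ^ 2) \<le> 1 / real P"
proof (cases "n \<ge> P")
  case True
  then have "(\<Sum>e\<in>{P<..n}. 1 / real e ^ 2) \<le> 1 / real P - 1 / real n"
  proof (induction n rule: dec_induct)
    case (step n)
    have n: "real n > 0" using step assms by simp
    have "{P<..Suc n} = insert (Suc n) {P<..n}" using step by auto
    then have "(\<Sum>e\<in>{P<..Suc n}. 1 / real e ^ 2) \<le> 1 / real (Suc n) ^ 2 + (1 / real P - 1 / real n)"
      using step by simp
    also have "1 / real (Suc n) ^ 2 \<le> 1 / (real n * real (Suc n))"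
      using n by (intro divide_left_mono) (auto simp: power2_eq_square)
    also have "1 / (real n * real (Suc n)) = 1 / real n - 1 / real (Suc n)"
      using n by (simp add: field_simps)
    finally show ?case by simp
  qed simp
  also have "\<dots> \<le> 1 / real P" by simp
  finally show ?thesis .
qed simp

lemma cubic_count_le:
  fixes n e x y C :: real
  assumes count: "n * e^3 \<le> (2 * x + e) * (2 * y + e)^2" and e: "0 < e" "e \<le> C" and xy: "0 \<le> y" "y \<le> x"
  shows "e * n \<le> 64 * x * y^2 / e^2 + 4 * (2 * x + C)"
proof (cases "e \<le> 2 * y")
  case True
  have "(2 * x + e) * (2 * y + e)^2 \<le> (4 * x) * (4 * y)^2"
    using True e xy by (intro mult_mono power_mono) auto
  then have "e * n * e^2 \<le> 64 * x * y^2"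
    using count by (simp add: power2_eq_square power3_eq_cube algebra_simps)
  then have "e * n \<le> 64 * x * y^2 / e^2" using e by (simp add: le_divide_eq)
  then show ?thesis using e xy by simp
next
  case False
  have "(2 * x + e) * (2 * y + e)^2 \<le> (2 * x + e) * (2 * e)^2"
    using False e xy by (intro mult_left_mono power_mono) auto
  then have "(e * n) * e^2 \<le> (4 * (2 * x + e)) * e^2"
    using count by (simp add: power2_eq_square power3_eq_cube algebra_simps)
  then have "e * n \<le> 4 * (2 * x + e)" using e by simp
  also have "\<dots> \<le> 4 * (2 * x + C)" using e by simp
  finally show ?thesis using xy by (simp add: add_increasing)
qed

lemma int_dvd_fact:
  fixes e :: int
  assumes "1 \<le> e" "e \<le> int P"
  shows "e dvd fact P"
proof -
  have "nat e dvd fact P" using assms by (intro dvd_fact) auto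
  then have "int (nat e) dvd int (fact P)" by (simp only: of_nat_dvd_iff)
  then show ?thesis using assms by simp
qed

locale quadratic_progression =
  fixes l1 l2 l3 a1 a2 a3 q :: int and P :: nat
  assumes q_pos: "q > 0" and a1_pos: "a1 > 0" and a2_nonzero: "a2 \<noteq> 0" and a3_nonzero: "a3 \<noteq> 0"
    and P_ge_2: "P \<ge> 2" and fact_dvd_q: "fact P dvd q" and coefficients_dvd_q: "a1 * a2 * a3 dvd q"
    and coprime_linear: "coprime q (gcd l1 (gcd l2 l3))"
begin

definition F :: "int \<times> int \<times> int \<Rightarrow> int" where
  "F = (\<lambda>(u1, u2, u3). l1 * u1 + l2 * u2 + l3 * u3 + q * (a1 * u1^2 + a2 * u2^2 + a3 * u3^2))"

definition slope1 :: "int \<Rightarrow> int" where "slope1 t = l1 + q * a1 * t"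
definition slope2 :: "int \<Rightarrow> int" where "slope2 t = l2 + q * a2 * t"
definition slope3 :: "int \<Rightarrow> int" where "slope3 t = l3 + q * a3 * t"

lemma F_diff:
  "F (u1, u2, u3) - F (v1, v2, v3)
    = (u1 - v1) * slope1 (u1 + v1) + (u2 - v2) * slope2 (u2 + v2) + (u3 - v3) * slope3 (u3 + v3)"
  by (simp add: F_def slope1_def slope2_def slope3_def algebra_simps power2_eq_square)

lemma qa1_pos: "q * a1 > 0" using q_pos a1_pos by simp

lemma even_q: "even q"
  using dvd_trans[OF int_dvd_fact fact_dvd_q, of 2] P_ge_2 by simp

lemma some_linear_odd: "odd l1 \<or> odd l2 \<or> odd l3"
  using coprime_linear even_q by (meson coprime_common_divisor gcd_greatest odd_one)

lemma slope_inject: "slope2 t = slope2 t' \<longleftrightarrow> t = t'" "slope3 t = slope3 t' \<longleftrightarrow> t = t'"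
  using a2_nonzero a3_nonzero q_pos by (auto simp: slope2_def slope3_def)

lemma common_divisor_coprime:
  assumes "e dvd slope1 t1" "e dvd slope2 t2" "e dvd slope3 t3"
  shows "coprime e q"
proof (rule coprimeI)
  fix d assume d: "d dvd e" "d dvd q"
  have "d dvd l + q * a * t \<longleftrightarrow> d dvd l" for l a t
    using d(2) by (simp add: dvd_add_left_iff)
  then have "d dvd gcd l1 (gcd l2 l3)"
    using assms d(1) by (metis slope1_def slope2_def slope3_def dvd_trans gcd_greatest)
  with d(2) show "is_unit d" by (rule coprime_common_divisor[OF coprime_linear])
qed

lemma coprime_leading_coefficient:
  assumes "coprime e q" "a dvd a1 * a2 * a3"
  shows "coprime e (q * a)"
proof -
  have "a dvd q" using assms(2) coefficients_dvd_q by (rule dvd_trans)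
  then have "coprime e a" using assms(1) by (rule coprime_divisors[OF dvd_refl])
  then show ?thesis using assms(1) by simp
qed

lemma common_divisor_large:
  assumes "e > 1" "e dvd slope1 t1" "e dvd slope2 t2" "e dvd slope3 t3"
  shows "e > int P"
proof (rule ccontr)
  assume "\<not> e > int P"
  then have "e dvd fact P" using assms(1) by (intro int_dvd_fact) auto
  then have "e dvd q" using fact_dvd_q by (rule dvd_trans)
  then have "is_unit e"
    by (rule coprime_common_divisor[OF common_divisor_coprime[OF assms(2-4)] dvd_refl])
  then show False using assms(1) by simp
qed

end

definition relation_count :: "int \<Rightarrow> int \<Rightarrow> int" where
  "relation_count K J = (2 * K + 1)^2 * (4 * K * J + 1)"

definition degenerate_count :: "int \<Rightarrow> int \<Rightarrow> int" where
  "degenerate_count T J = (T * (2 * T * J + 1))^2"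

locale second_moment = quadratic_progression +
  fixes X0 X Y h K T J C :: int
  assumes X0_nonneg: "0 \<le> X0" and X0_less: "X0 < X"
    and even_Y: "even Y" and Y_pos: "0 < Y" and Y_le_X: "Y \<le> X" and qa1_le_Y: "q * a1 \<le> Y"
    and slope1_lower: "Y \<le> slope1 (2 * X0)" and slope1_upper: "slope1 (2 * X) \<le> C"
    and J_nonneg: "0 \<le> J"
    and slope2_le: "\<And>t. t \<in> {2..2 * Y} \<Longrightarrow> \<bar>slope2 t\<bar> \<le> J * Y"
    and slope3_le: "\<And>t. t \<in> {2..2 * Y} \<Longrightarrow> \<bar>slope3 t\<bar> \<le> J * Y"
    and K_nonneg: "0 \<le> K" and K_le_h: "K \<le> h" and C_less: "C < (K + 1) * (h + 1)"
    and h_le: "4 * h \<le> Y" and T_pos: "T > 0"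
begin

definition Box :: "(int \<times> int \<times> int) set" where "Box = {X0 + 1..X} \<times> {1..Y} \<times> {1..Y}"

definition Sums1 :: "int set" where "Sums1 = {2 * X0 + 2..2 * X}"
definition Sums2 :: "int set" where "Sums2 = {2..2 * Y}"
definition Sums :: "(int \<times> int \<times> int) set" where "Sums = Sums1 \<times> Sums2 \<times> Sums2"

text \<open>
  The weight of \<open>u\<close> is the increment of \<open>l\<^sub>1 u\<^sub>1 + q a\<^sub>1 u\<^sub>1\<^sup>2\<close>, which makes the expected weighted
  number of representations constant.
\<close>

definition weight :: "int \<times> int \<times> int \<Rightarrow> int" where
  "weight = (\<lambda>(u1, _, _). l1 + q * a1 * (2 * u1 - 1))"

definition even_sum :: "int \<times> int \<times> int \<Rightarrow> bool" where
  "even_sum = (\<lambda>(t1, t2, t3). even (l1 * t1 + l2 * t2 + l3 * t3))"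

text \<open>
  If \<open>F u = F v\<close> and \<open>t = u + v\<close>, then \<open>\<Sum> t\<^sub>i slope\<^sub>i(t\<^sub>i) = 2 \<Sum> v\<^sub>i slope\<^sub>i(t\<^sub>i)\<close>; the fibre over \<open>t\<close>
  consists of the pairs \<open>(v\<^sub>2, v\<^sub>3)\<close> that are compatible with this equation.
\<close>

definition fibre :: "int \<times> int \<times> int \<Rightarrow> (int \<times> int) set" where
  "fibre = (\<lambda>(t1, t2, t3). {(x, y) \<in> summands Y t2 \<times> summands Y t3.
     slope1 t1 dvd slope2 t2 * x + slope3 t3 * y
       - (slope1 t1 * t1 + slope2 t2 * t2 + slope3 t3 * t3) div 2})"

definition slope_gcd :: "int \<times> int \<times> int \<Rightarrow> int" where
  "slope_gcd = (\<lambda>(t1, t2, t3). gcd (slope1 t1) (gcd (slope2 t2) (slope3 t3)))"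

definition window :: "int \<times> int \<times> int \<Rightarrow> int" where
  "window = (\<lambda>(t1, t2, t3).
     (int (card (summands Y t2)) + 4 * h) * (int (card (summands Y t3)) + 4 * h))"

definition exceptional :: "int \<times> int \<times> int \<Rightarrow> bool" where
  "exceptional = (\<lambda>(t1, t2, t3). has_short_solution (slope1 t1) (slope2 t2) (slope3 t3) K)"

definition degenerate :: "int \<times> int \<times> int \<Rightarrow> bool" where
  "degenerate = (\<lambda>(t1, t2, t3). (\<exists>i\<in>{1..<T}. slope1 t1 dvd slope2 t2 * i) \<and>
     (\<exists>i\<in>{1..<T}. slope1 t1 dvd slope3 t3 * i))"

lemma finite_sets [simp]: "finite Sums1" "finite Sums2" "finite Box" "finite Sums" "finite (fibre t)"
proof -
  show "finite (fibre t)"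
    unfolding fibre_def case_prod_unfold
    by (rule finite_subset[of _ "summands Y (fst (snd t)) \<times> summands Y (snd (snd t))"]) auto
qed (auto simp: Sums1_def Sums2_def Box_def Sums_def)

lemma slope1_bounds:
  assumes "t \<in> Sums1"
  shows "Y \<le> slope1 t" "slope1 t \<le> C" "0 < slope1 t" "q * a1 \<le> slope1 t"
proof -
  have "q * a1 * (2 * X0) \<le> q * a1 * t" "q * a1 * t \<le> q * a1 * (2 * X)"
    using assms qa1_pos unfolding Sums1_def by (auto intro!: mult_left_mono)
  then show "Y \<le> slope1 t" "slope1 t \<le> C" using slope1_lower slope1_upper by (auto simp: slope1_def)
  then show "0 < slope1 t" "q * a1 \<le> slope1 t" using Y_pos qa1_le_Y by auto
qed

lemma C_pos: "C > 0"
  using slope1_bounds(2,3)[of "2 * X"] X0_less by (auto simp: Sums1_def)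

lemma equal_values_relation:
  assumes "F (u1, u2, u3) = F (v1, v2, v3)"
  shows "slope1 (u1 + v1) * (u1 + v1) + slope2 (u2 + v2) * (u2 + v2) + slope3 (u3 + v3) * (u3 + v3)
    = 2 * (slope1 (u1 + v1) * v1 + slope2 (u2 + v2) * v2 + slope3 (u3 + v3) * v3)"
  using F_diff[of u1 u2 u3 v1 v2 v3] assms by (simp add: algebra_simps)

lemma equal_values_imp_fibre:
  assumes "u \<in> Box" "v \<in> Box" "F u = F v"
  shows "u + v \<in> Sums" "even_sum (u + v)" "snd v \<in> fibre (u + v)"
proof -
  obtain u1 u2 u3 v1 v2 v3 where uv: "u = (u1, u2, u3)" "v = (v1, v2, v3)" by (metis surj_pair)
  let ?t1 = "u1 + v1" and ?t2 = "u2 + v2" and ?t3 = "u3 + v3"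
  have range: "u1 \<in> {X0 + 1..X}" "v1 \<in> {X0 + 1..X}"
    "u2 \<in> {1..Y}" "v2 \<in> {1..Y}" "u3 \<in> {1..Y}" "v3 \<in> {1..Y}"
    using assms(1,2) by (auto simp: uv Box_def)
  then show "u + v \<in> Sums" by (auto simp: uv Sums_def Sums1_def Sums2_def)
  have relation: "slope1 ?t1 * ?t1 + slope2 ?t2 * ?t2 + slope3 ?t3 * ?t3
    = 2 * (slope1 ?t1 * v1 + slope2 ?t2 * v2 + slope3 ?t3 * v3)"
    using assms(3) unfolding uv by (rule equal_values_relation)
  have "slope1 ?t1 * ?t1 + slope2 ?t2 * ?t2 + slope3 ?t3 * ?t3
    = (l1 * ?t1 + l2 * ?t2 + l3 * ?t3) + q * (a1 * ?t1^2 + a2 * ?t2^2 + a3 * ?t3^2)"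
    by (simp add: slope1_def slope2_def slope3_def algebra_simps power2_eq_square)
  then have "even ((l1 * ?t1 + l2 * ?t2 + l3 * ?t3) + q * (a1 * ?t1^2 + a2 * ?t2^2 + a3 * ?t3^2))"
    using relation by (metis dvd_triv_left)
  then have "even (l1 * ?t1 + l2 * ?t2 + l3 * ?t3)"
    using even_q by (simp only: dvd_add_left_iff dvd_mult2)
  then show "even_sum (u + v)" by (simp add: uv even_sum_def)
  have "(slope1 ?t1 * ?t1 + slope2 ?t2 * ?t2 + slope3 ?t3 * ?t3) div 2
    = slope1 ?t1 * v1 + slope2 ?t2 * v2 + slope3 ?t3 * v3"
    unfolding relation by simp
  then have "slope2 ?t2 * v2 + slope3 ?t3 * v3
      - (slope1 ?t1 * ?t1 + slope2 ?t2 * ?t2 + slope3 ?t3 * ?t3) div 2 = slope1 ?t1 * (- v1)"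
    by simp
  then show "snd v \<in> fibre (u + v)" using range by (auto simp: uv fibre_def summands_def)
qed

lemma inj_on_sum_and_tail: "inj_on (\<lambda>(u, v). (u + v, snd v)) {(u, v) \<in> Box \<times> Box. F u = F v}"
proof (rule inj_onI)
  fix p p' assume p: "p \<in> {(u, v) \<in> Box \<times> Box. F u = F v}"
    and p': "p' \<in> {(u, v) \<in> Box \<times> Box. F u = F v}"
    and eq: "(\<lambda>(u, v). (u + v, snd v)) p = (\<lambda>(u, v). (u + v, snd v)) p'"
  obtain u1 u2 u3 v1 v2 v3 where p_eq: "p = ((u1, u2, u3), (v1, v2, v3))" by (metis surj_pair)
  obtain u1' u2' u3' v1' v2' v3' where p'_eq: "p' = ((u1', u2', u3'), (v1', v2', v3'))"
    by (metis surj_pair)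
  have same: "u1 + v1 = u1' + v1'" "v2 = v2'" "v3 = v3'" "u2 = u2'" "u3 = u3'"
    using eq by (auto simp: p_eq p'_eq)
  have "u1 + v1 \<in> Sums1" using p by (auto simp: p_eq Box_def Sums1_def)
  moreover have "F (u1, u2, u3) - F (v1, v2, v3) = F (u1', u2', u3') - F (v1', v2', v3')"
    using p p' by (auto simp: p_eq p'_eq)
  then have "(u1 - v1) * slope1 (u1 + v1) = (u1' - v1') * slope1 (u1 + v1)"
    unfolding F_diff same by linarith
  ultimately have "u1 - v1 = u1' - v1'" using slope1_bounds(3) by fastforce
  then show "p = p'" using same by (simp add: p_eq p'_eq)
qed

lemma weight_mult_le:
  assumes "u \<in> Box" "v \<in> Box"
  shows "weight u * weight v \<le> (slope1 (fst (u + v)))^2"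
proof -
  let ?a = "weight u" and ?b = "weight v" and ?c = "slope1 (fst (u + v))"
  have "fst (u + v) \<in> Sums1" using assms by (auto simp: Box_def Sums1_def)
  then have range: "0 \<le> ?c - q * a1" "?c - q * a1 \<le> ?c" using slope1_bounds(4) qa1_pos by auto
  have "?a + ?b = 2 * (?c - q * a1)"
    by (simp add: weight_def slope1_def case_prod_unfold algebra_simps)
  then have "(?a + ?b)^2 = 4 * (?c - q * a1)^2" by (simp only: power_mult_distrib) simp
  moreover have "4 * (?a * ?b) + (?a - ?b)^2 = (?a + ?b)^2"
    by (simp add: power2_eq_square algebra_simps)
  moreover have "(?c - q * a1)^2 \<le> ?c^2" using range by (intro power_mono) auto
  ultimately show ?thesis using zero_le_power2[of "?a - ?b"] by linarith
qed

lemma pair_sum_le: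
  "(\<Sum>(u, v)\<in>{(u, v) \<in> Box \<times> Box. F u = F v}. weight u * weight v)
    \<le> (\<Sum>t\<in>{t \<in> Sums. even_sum t}. (slope1 (fst t))^2 * int (card (fibre t)))"
proof -
  let ?Pairs = "{(u, v) \<in> Box \<times> Box. F u = F v}"
  let ?project = "\<lambda>(u, v). (u + v, snd v) :: (int \<times> int \<times> int) \<times> int \<times> int"
  let ?square = "\<lambda>(t, z :: int \<times> int). (slope1 (fst t))^2"
  have "(\<Sum>(u, v)\<in>?Pairs. weight u * weight v) \<le> (\<Sum>p\<in>?Pairs. ?square (?project p))"
    using weight_mult_le by (intro sum_mono) auto
  also have "\<dots> = sum ?square (?project ` ?Pairs)"
    using inj_on_sum_and_tail by (simp add: sum.reindex)
  also have "\<dots> \<le> sum ?square (Sigma {t \<in> Sums. even_sum t} fibre)"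
  proof (rule sum_mono2)
    show "?project ` ?Pairs \<subseteq> Sigma {t \<in> Sums. even_sum t} fibre"
      using equal_values_imp_fibre by (intro image_subsetI) auto
  qed auto
  also have "\<dots> = (\<Sum>t\<in>{t \<in> Sums. even_sum t}. \<Sum>z\<in>fibre t. (slope1 (fst t))^2)"
    by (rule sum.Sigma[symmetric]) auto
  also have "\<dots> = (\<Sum>t\<in>{t \<in> Sums. even_sum t}. (slope1 (fst t))^2 * int (card (fibre t)))"
    by (simp add: mult.commute)
  finally show ?thesis .
qed

lemma card_fibre_le_if_not_exceptional:
  assumes "t \<in> Sums" "\<not> exceptional t"
  shows "int (card (fibre t)) * slope1 (fst t) \<le> slope_gcd t * window t"
proof -
  obtain t1 t2 t3 where t: "t = (t1, t2, t3)" by (metis surj_pair)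
  have "t1 \<in> Sums1" using assms(1) by (simp add: t Sums_def)
  then have "0 < slope1 t1" "slope1 t1 < (K + 1) * (h + 1)"
    using slope1_bounds[of t1] C_less by auto
  moreover have "\<not> has_short_solution (slope1 t1) (slope2 t2) (slope3 t3) K"
    using assms(2) by (simp add: t exceptional_def)
  ultimately show ?thesis
    unfolding t fibre_def slope_gcd_def window_def summands_eq_atLeastAtMost prod.case fst_conv
    using K_nonneg K_le_h by (intro card_congruence_solutions_le)
qed

lemma card_fibre_le: "int (card (fibre t)) \<le> Y^2"
proof -
  obtain t1 t2 t3 where t: "t = (t1, t2, t3)" by (metis surj_pair)
  have "card (fibre t) \<le> card ({1..Y} \<times> {1..Y})"
    by (rule card_mono) (auto simp: t fibre_def summands_def)
  then have "int (card (fibre t)) \<le> int (card ({1..Y} \<times> {1..Y}))" by (simp only: of_nat_le_iff)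
  then show ?thesis using Y_pos by (simp add: card_cartesian_product power2_eq_square)
qed

lemma card_congruent_summands_le:
  assumes "\<not> (\<exists>i\<in>{1..<T}. c dvd b * i)" "t' \<in> Sums2"
  shows "int (card {(x, y) \<in> summands Y t \<times> summands Y t'. c dvd a * x + b * y - r}) * T \<le> Y * (Y + T)"
proof -
  let ?B = "max 1 (t' - Y)" and ?B' = "min Y (t' - 1)"
  have width: "?B \<le> ?B' + 1" "?B' - ?B \<le> Y" using assms(2) Y_pos by (auto simp: Sums2_def)
  have "int (card {(x, y) \<in> summands Y t \<times> summands Y t'. c dvd a * x + b * y - r}) * T
    \<le> int (card (summands Y t)) * (?B' - ?B + T)"
    unfolding summands_eq_atLeastAtMost[of Y t']
    by (intro card_linear_congruence_rectangle_le assms(1) T_pos width finite_summands)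
  also have "\<dots> \<le> Y * (Y + T)"
    using card_summands_le[of Y t] width Y_pos T_pos by (intro mult_mono) auto
  finally show ?thesis .
qed

lemma card_fibre_le_if_not_degenerate:
  assumes "t \<in> Sums" "\<not> degenerate t"
  shows "int (card (fibre t)) * T \<le> Y * (Y + T)"
proof -
  obtain t1 t2 t3 where t: "t = (t1, t2, t3)" by (metis surj_pair)
  have t23: "t2 \<in> Sums2" "t3 \<in> Sums2" using assms(1) by (simp_all add: t Sums_def)
  let ?r = "(slope1 t1 * t1 + slope2 t2 * t2 + slope3 t3 * t3) div 2"
  consider "\<not> (\<exists>i\<in>{1..<T}. slope1 t1 dvd slope3 t3 * i)" | "\<not> (\<exists>i\<in>{1..<T}. slope1 t1 dvd slope2 t2 * i)"
    using assms(2) by (auto simp: t degenerate_def)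
  then show ?thesis
  proof cases
    case 1
    then show ?thesis unfolding t fibre_def prod.case by (rule card_congruent_summands_le[OF _ t23(2)])
  next
    case 2
    have "fibre t = prod.swap ` {(y, x) \<in> summands Y t3 \<times> summands Y t2.
        slope1 t1 dvd slope3 t3 * y + slope2 t2 * x - ?r}" (is "_ = _ ` ?swapped")
      by (force simp: t fibre_def add.commute image_iff)
    then have "card (fibre t) = card ?swapped" by (simp only: card_image[OF inj_swap])
    then show ?thesis using card_congruent_summands_le[OF 2 t23(1), of t3 "slope3 t3" ?r] by simp
  qed
qed

lemma card_Sums_le: "int (card Sums1) \<le> 2 * X" "int (card (Sums1 \<times> Sums2)) \<le> 4 * X * Y"
proof -
  show Sums1: "int (card Sums1) \<le> 2 * X" using X0_nonneg X0_less by (simp add: Sums1_def)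
  moreover have "int (card Sums2) \<le> 2 * Y" using Y_pos by (simp add: Sums2_def)
  ultimately have "int (card Sums1) * int (card Sums2) \<le> (2 * X) * (2 * Y)"
    using X0_nonneg X0_less by (intro mult_mono) auto
  then show "int (card (Sums1 \<times> Sums2)) \<le> 4 * X * Y" by (simp add: card_cartesian_product)
qed

lemma slope_quotient_le:
  assumes "t1 \<in> Sums1" "slope1 t1 * j = r" "\<bar>r\<bar> \<le> B * Y"
  shows "\<bar>j\<bar> \<le> B"
proof -
  have "Y * \<bar>j\<bar> \<le> slope1 t1 * \<bar>j\<bar>" using slope1_bounds[OF assms(1)] by (intro mult_right_mono) auto
  also have "\<dots> = \<bar>r\<bar>" using assms(2) slope1_bounds[OF assms(1)] by (auto simp: abs_mult)
  finally have "Y * \<bar>j\<bar> \<le> Y * B" using assms(3) by (simp add: mult.commute)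
  then show ?thesis using Y_pos by simp
qed

lemma card_slope_relation_le:
  assumes "(x, y) \<noteq> (0, 0)"
  shows "int (card {(t1, t2, t3) \<in> Sums. slope2 t2 * x + slope3 t3 * y = slope1 t1 * j}) \<le> 4 * X * Y"
    (is "int (card ?S) \<le> _")
proof -
  have "card ?S \<le> card (Sums1 \<times> Sums2)"
  proof (cases "x = 0")
    case False
    have "inj_on (\<lambda>(t1, t2, t3). (t1, t3)) ?S"
    proof (clarsimp simp: inj_on_def)
      fix t1 t2 t3 t2'
      assume "slope2 t2 * x + slope3 t3 * y = slope1 t1 * j"
        "slope2 t2' * x + slope3 t3 * y = slope1 t1 * j"
      then have "slope2 t2 * x = slope2 t2' * x" by linarith
      then show "t2 = t2'" using False slope_inject(1) by simp
    qed
    then show ?thesis by (rule card_inj_on_le) (auto simp: Sums_def)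
  next
    case True
    then have "y \<noteq> 0" using assms by simp
    have "inj_on (\<lambda>(t1, t2, t3). (t1, t2)) ?S"
    proof (clarsimp simp: inj_on_def)
      fix t1 t2 t3 t3'
      assume "slope2 t2 * x + slope3 t3 * y = slope1 t1 * j"
        "slope2 t2 * x + slope3 t3' * y = slope1 t1 * j"
      then have "slope3 t3 * y = slope3 t3' * y" by linarith
      then show "t3 = t3'" using \<open>y \<noteq> 0\<close> slope_inject(2) by simp
    qed
    then show ?thesis by (rule card_inj_on_le) (auto simp: Sums_def)
  qed
  then show ?thesis using card_Sums_le(2) by linarith
qed

lemma exceptional_imp_slope_relation:
  assumes "(t1, t2, t3) \<in> Sums" "exceptional (t1, t2, t3)"
  shows "\<exists>x\<in>{-K..K}. \<exists>y\<in>{-K..K}. \<exists>j\<in>{-(2 * K * J)..2 * K * J}.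
    (x, y) \<noteq> (0, 0) \<and> slope2 t2 * x + slope3 t3 * y = slope1 t1 * j"
proof -
  obtain x y where xy: "(x, y) \<noteq> (0, 0)" "\<bar>x\<bar> \<le> K" "\<bar>y\<bar> \<le> K"
    "slope1 t1 dvd slope2 t2 * x + slope3 t3 * y"
    using assms(2) by (auto simp: exceptional_def has_short_solution_def)
  then obtain j where j: "slope2 t2 * x + slope3 t3 * y = slope1 t1 * j" by blast
  have t: "t1 \<in> Sums1" "t2 \<in> {2..2 * Y}" "t3 \<in> {2..2 * Y}"
    using assms(1) by (auto simp: Sums_def Sums2_def)
  have "\<bar>slope2 t2 * x + slope3 t3 * y\<bar> \<le> \<bar>slope2 t2\<bar> * \<bar>x\<bar> + \<bar>slope3 t3\<bar> * \<bar>y\<bar>"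
    unfolding abs_mult[symmetric] by (rule abs_triangle_ineq)
  also have "\<dots> \<le> (J * Y) * K + (J * Y) * K"
    using J_nonneg Y_pos xy slope2_le[OF t(2)] slope3_le[OF t(3)] by (intro add_mono mult_mono) auto
  finally have "\<bar>slope2 t2 * x + slope3 t3 * y\<bar> \<le> (2 * K * J) * Y" by (simp add: algebra_simps)
  then have "\<bar>j\<bar> \<le> 2 * K * J" using slope_quotient_le[OF t(1)] j by simp
  then show ?thesis using xy j by fastforce
qed

lemma card_exceptional_le:
  "int (card {t \<in> Sums. exceptional t}) \<le> relation_count K J * (4 * X * Y)"
proof -
  let ?I = "{-K..K} \<times> {-K..K} \<times> {-(2 * K * J)..2 * K * J}"
  let ?E = "\<lambda>(x, y, j). {(t1, t2, t3) \<in> Sums.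
    (x, y) \<noteq> (0, 0) \<and> slope2 t2 * x + slope3 t3 * y = slope1 t1 * j}"
  have "{t \<in> Sums. exceptional t} \<subseteq> (\<Union>i\<in>?I. ?E i)"
  proof clarify
    fix t1 t2 t3 assume t: "(t1, t2, t3) \<in> Sums" "exceptional (t1, t2, t3)"
    from exceptional_imp_slope_relation[OF t] show "(t1, t2, t3) \<in> (\<Union>i\<in>?I. ?E i)"
      using t(1) by fastforce
  qed
  moreover have "finite (\<Union>i\<in>?I. ?E i)" by (rule finite_subset[of _ Sums]) auto
  ultimately have "int (card {t \<in> Sums. exceptional t}) \<le> int (card (\<Union>i\<in>?I. ?E i))"
    by (simp only: of_nat_le_iff card_mono)
  also have "\<dots> \<le> int (card ?I) * (4 * X * Y)"
  proof (rule card_UN_le_mult)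
    fix i :: "int \<times> int \<times> int"
    obtain x y j where i: "i = (x, y, j)" by (metis surj_pair)
    show "int (card (?E i)) \<le> 4 * X * Y"
    proof (cases "(x, y) = (0, 0)")
      case True
      then have "?E i = {}" by (auto simp: i)
      then show ?thesis using X0_nonneg X0_less Y_pos by (simp only: card.empty) simp
    next
      case False
      then show ?thesis using card_slope_relation_le[OF False, of j] by (simp add: i)
    qed
  qed auto
  also have "int (card ?I) = relation_count K J"
  proof -
    have "0 \<le> K * J" using K_nonneg J_nonneg by simp
    then show ?thesis
      using K_nonneg by (simp add: card_cartesian_product relation_count_def power2_eq_square
        algebra_simps)
  qed
  finally show ?thesis .
qed

lemma degenerate_imp_slope_relations:
  assumes "(t1, t2, t3) \<in> Sums" "degenerate (t1, t2, t3)"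
  shows "\<exists>i\<in>{1..T}. \<exists>i'\<in>{1..T}. \<exists>j\<in>{-(T * J)..T * J}. \<exists>j'\<in>{-(T * J)..T * J}.
    slope2 t2 * i = slope1 t1 * j \<and> slope3 t3 * i' = slope1 t1 * j'"
proof -
  obtain i i' where i: "i \<in> {1..<T}" "i' \<in> {1..<T}" "slope1 t1 dvd slope2 t2 * i"
    "slope1 t1 dvd slope3 t3 * i'"
    using assms(2) by (auto simp: degenerate_def)
  then obtain j j' where j: "slope2 t2 * i = slope1 t1 * j" "slope3 t3 * i' = slope1 t1 * j'" by blast
  have t: "t1 \<in> Sums1" "t2 \<in> {2..2 * Y}" "t3 \<in> {2..2 * Y}"
    using assms(1) by (auto simp: Sums_def Sums2_def)
  have quotient_le: "\<bar>k\<bar> \<le> T * J" if "\<bar>b\<bar> \<le> J * Y" "n \<in> {1..<T}" "b * n = slope1 t1 * k" for b n k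
  proof -
    have "\<bar>b * n\<bar> = \<bar>b\<bar> * n" unfolding abs_mult using that(2) by simp
    also have "\<dots> \<le> (J * Y) * T" using that J_nonneg Y_pos by (intro mult_mono) auto
    finally have "\<bar>b * n\<bar> \<le> (T * J) * Y" by (simp add: algebra_simps)
    then show ?thesis using slope_quotient_le[OF t(1)] that(3) by simp
  qed
  have "\<bar>j\<bar> \<le> T * J" "\<bar>j'\<bar> \<le> T * J"
    using quotient_le[OF slope2_le[OF t(2)] i(1) j(1)] quotient_le[OF slope3_le[OF t(3)] i(2) j(2)] .
  then show ?thesis using i j by fastforce
qed

lemma card_degenerate_le:
  "int (card {t \<in> Sums. degenerate t}) \<le> degenerate_count T J * (2 * X)"
proof -
  let ?I = "{1..T} \<times> {1..T} \<times> {-(T * J)..T * J} \<times> {-(T * J)..T * J}"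
  let ?D = "\<lambda>(i, i', j, j'). {(t1, t2, t3) \<in> Sums. i \<noteq> 0 \<and> i' \<noteq> 0 \<and>
    slope2 t2 * i = slope1 t1 * j \<and> slope3 t3 * i' = slope1 t1 * j'}"
  have "{t \<in> Sums. degenerate t} \<subseteq> (\<Union>i\<in>?I. ?D i)"
  proof clarify
    fix t1 t2 t3 assume t: "(t1, t2, t3) \<in> Sums" "degenerate (t1, t2, t3)"
    from degenerate_imp_slope_relations[OF t] show "(t1, t2, t3) \<in> (\<Union>i\<in>?I. ?D i)"
      using t(1) by fastforce
  qed
  moreover have "finite (\<Union>i\<in>?I. ?D i)" by (rule finite_subset[of _ Sums]) auto
  ultimately have "int (card {t \<in> Sums. degenerate t}) \<le> int (card (\<Union>i\<in>?I. ?D i))"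
    by (simp only: of_nat_le_iff card_mono)
  also have "\<dots> \<le> int (card ?I) * (2 * X)"
  proof (rule card_UN_le_mult)
    fix i :: "int \<times> int \<times> int \<times> int"
    have "inj_on fst (?D i)"
      unfolding inj_on_def case_prod_unfold using slope_inject
      by (clarsimp simp: prod_eq_iff) (metis mult_right_cancel)
    then have "card (?D i) \<le> card Sums1"
      by (rule card_inj_on_le) (auto simp: Sums_def case_prod_unfold)
    then show "int (card (?D i)) \<le> 2 * X" using card_Sums_le(1) by linarith
  qed auto
  also have "int (card ?I) = degenerate_count T J"
  proof -
    have "0 \<le> T * J" using T_pos J_nonneg by simp
    then show ?thesis
      using T_pos by (simp add: card_cartesian_product degenerate_count_def power2_eq_square
        algebra_simps)
  qed
  finally show ?thesis .
qed

lemma slope_gcd_pos: "t \<in> Sums \<Longrightarrow> slope_gcd t > 0"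
  using slope1_bounds(3) by (force simp: Sums_def slope_gcd_def gcd_pos_int)

lemma card_slopes_divisible_le:
  assumes e: "e > 0"
  shows "int (card {t \<in> Sums. e dvd slope_gcd t}) * e^3 \<le> (2 * X + e) * (2 * Y + e)^2"
proof (cases "{t \<in> Sums. e dvd slope_gcd t} = {}")
  case True
  then show ?thesis using X0_nonneg X0_less Y_pos e by (simp only: card.empty) simp
next
  case False
  then obtain t1 t2 t3 where "e dvd slope1 t1" "e dvd slope2 t2" "e dvd slope3 t3"
    by (auto simp: slope_gcd_def)
  then have "coprime e q" by (rule common_divisor_coprime)
  then have coprime: "coprime e (q * a1)" "coprime e (q * a2)" "coprime e (q * a3)"
    by (rule coprime_leading_coefficient; simp)+
  define divisible1 where "divisible1 = {t \<in> Sums1. e dvd l1 + q * a1 * t}"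
  define divisible2 where "divisible2 = {t \<in> Sums2. e dvd l2 + q * a2 * t}"
  define divisible3 where "divisible3 = {t \<in> Sums2. e dvd l3 + q * a3 * t}"
  have count: "int (card divisible1) * e \<le> 2 * X + e" "int (card divisible2) * e \<le> 2 * Y + e"
    "int (card divisible3) * e \<le> 2 * Y + e"
    using card_progression_multiples_le[OF coprime(1) e, of "2 * X0 + 2" "2 * X" l1]
      card_progression_multiples_le[OF coprime(2) e, of 2 "2 * Y" l2]
      card_progression_multiples_le[OF coprime(3) e, of 2 "2 * Y" l3] X0_nonneg X0_less Y_pos
    by (simp_all add: divisible1_def divisible2_def divisible3_def Sums1_def Sums2_def)
  have "{t \<in> Sums. e dvd slope_gcd t} = divisible1 \<times> divisible2 \<times> divisible3"
    by (auto simp: divisible1_def divisible2_def divisible3_def Sums_def slope_gcd_def slope1_def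
      slope2_def slope3_def)
  then have "int (card {t \<in> Sums. e dvd slope_gcd t}) * e^3
    = (int (card divisible1) * e) * ((int (card divisible2) * e) * (int (card divisible3) * e))"
    by (simp add: card_cartesian_product power3_eq_cube)
  also have "\<dots> \<le> (2 * X + e) * ((2 * Y + e) * (2 * Y + e))"
    using count e X0_nonneg X0_less Y_pos by (intro mult_mono) auto
  finally show ?thesis by (simp add: power2_eq_square)
qed

lemma sum_slope_gcd_level_le:
  assumes "0 < e" "e \<le> nat C"
  shows "(\<Sum>t\<in>{t \<in> {t \<in> Sums. slope_gcd t > 1}. nat (slope_gcd t) = e}. real_of_int (slope_gcd t))
    \<le> 64 * real_of_int X * (real_of_int Y)^2 / (real e)^2 + 4 * (2 * real_of_int X + real_of_int C)"
proof -
  let ?level = "{t \<in> {t \<in> Sums. slope_gcd t > 1}. nat (slope_gcd t) = e}"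
  let ?multiples = "{t \<in> Sums. int e dvd slope_gcd t}"
  have "real_of_int (int (card ?multiples) * int e ^ 3)
    \<le> real_of_int ((2 * X + int e) * (2 * Y + int e)^2)"
    using card_slopes_divisible_le[of "int e"] assms(1) by (simp only: of_int_le_iff of_nat_0_less_iff)
  then have multiples: "real (card ?multiples) * real e ^ 3
    \<le> (2 * real_of_int X + real e) * (2 * real_of_int Y + real e)^2"
    by simp
  have "(\<Sum>t\<in>?level. real_of_int (slope_gcd t)) = (\<Sum>t\<in>?level. real e)" by (intro sum.cong) auto
  also have "\<dots> = real e * real (card ?level)" by simp
  also have "card ?level \<le> card ?multiples" by (intro card_mono) auto
  then have "real e * real (card ?level) \<le> real e * real (card ?multiples)"
    by (simp add: mult_left_mono)
  also have "\<dots> \<le> 64 * real_of_int X * (real_of_int Y)^2 / (real e)^2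
    + 4 * (2 * real_of_int X + real_of_int C)"
    using multiples by (rule cubic_count_le) (use assms Y_pos Y_le_X in auto)
  finally show ?thesis .
qed

lemma sum_slope_gcd_le:
  "(\<Sum>t\<in>{t \<in> Sums. slope_gcd t > 1}. real_of_int (slope_gcd t))
    \<le> 64 * X * Y^2 / P + 4 * C * (2 * X + C)"
proof -
  let ?S = "{t \<in> Sums. slope_gcd t > 1}"
  have "(\<lambda>t. nat (slope_gcd t)) ` ?S \<subseteq> {P<..nat C}"
  proof (rule image_subsetI)
    fix t assume t: "t \<in> ?S"
    obtain t1 t2 t3 where t_eq: "t = (t1, t2, t3)" by (metis surj_pair)
    have dvd: "slope_gcd t dvd slope1 t1" "slope_gcd t dvd slope2 t2" "slope_gcd t dvd slope3 t3"
      by (auto simp: t_eq slope_gcd_def intro: dvd_trans[OF gcd_dvd2])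
    have "slope_gcd t > int P" using common_divisor_large[OF _ dvd] t by auto
    moreover have "slope_gcd t \<le> C"
      using zdvd_imp_le[OF dvd(1)] slope1_bounds[of t1] t by (auto simp: t_eq Sums_def)
    ultimately show "nat (slope_gcd t) \<in> {P<..nat C}" by auto
  qed
  then have "(\<Sum>t\<in>?S. real_of_int (slope_gcd t))
    = (\<Sum>e\<in>{P<..nat C}. \<Sum>t\<in>{t \<in> ?S. nat (slope_gcd t) = e}. real_of_int (slope_gcd t))"
    by (intro sum.group[symmetric]) auto
  also have "\<dots> \<le> (\<Sum>e\<in>{P<..nat C}. 64 * real_of_int X * (real_of_int Y)^2 / (real e)^2
      + 4 * (2 * real_of_int X + real_of_int C))"
    by (intro sum_mono sum_slope_gcd_level_le) auto
  also have "\<dots> = 64 * X * Y^2 * (\<Sum>e\<in>{P<..nat C}. 1 / real e ^ 2)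
      + real (card {P<..nat C}) * (4 * (2 * X + C))"
    by (simp add: sum.distrib sum_distrib_left)
  also have "\<dots> \<le> 64 * X * Y^2 * (1 / P) + C * (4 * (2 * X + C))"
    using sum_inverse_squares_le[of P "nat C"] P_ge_2 X0_nonneg X0_less C_pos
    by (intro add_mono mult_left_mono mult_right_mono) auto
  finally show ?thesis by (simp add: algebra_simps)
qed

lemma parity_bounded_slope1: "parity_bounded Sums1 slope1 (2 * (q * a1 * (X * (X + 1)) + \<bar>l1\<bar> * X))"
  unfolding parity_bounded_def
proof (intro conjI ballI)
  show "0 \<le> slope1 t" if "t \<in> Sums1" for t using slope1_bounds(3)[OF that] by simp
  fix e :: int assume e: "e \<in> {0, 1}"
  let ?A = "{t \<in> {1..2 * X}. t mod 2 = e}"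
  have X: "X \<ge> 0" using X0_nonneg X0_less by simp
  have finite_A: "finite ?A" by (rule finite_subset[of _ "{1..2 * X}"]) auto
  have "(\<Sum>t\<in>{t \<in> Sums1. t mod 2 = e}. slope1 t) \<le> (\<Sum>t\<in>{t \<in> Sums1. t mod 2 = e}. q * a1 * t + \<bar>l1\<bar>)"
    unfolding slope1_def by (intro sum_mono) auto
  also have "\<dots> \<le> (\<Sum>t\<in>?A. q * a1 * t + \<bar>l1\<bar>)"
    using X0_nonneg qa1_pos by (intro sum_mono2 finite_A) (auto simp: Sums1_def)
  also have "\<dots> = q * a1 * (\<Sum>t\<in>?A. t) + int (card ?A) * \<bar>l1\<bar>"
    by (simp add: sum.distrib sum_distrib_left)
  also have "int (card ?A) = X" using card_parity_class[OF e X, of 0] by simp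
  also have "q * a1 * (\<Sum>t\<in>?A. t) \<le> q * a1 * (X * (X + 1))"
    using sum_parity_class_le[OF e X] qa1_pos by (intro mult_left_mono) auto
  finally show "2 * (\<Sum>t\<in>{t \<in> Sums1. t mod 2 = e}. slope1 t) \<le> 2 * (q * a1 * (X * (X + 1)) + \<bar>l1\<bar> * X)"
    by (simp add: mult.commute)
qed simp

lemma parity_bounded_summands:
  "parity_bounded Sums2 (\<lambda>t. int (card (summands Y t)) + 4 * h) (Y^2 + 8 * h * Y)"
  unfolding parity_bounded_def
proof (intro conjI ballI)
  show "0 \<le> int (card (summands Y t)) + 4 * h" for t using K_nonneg K_le_h by simp
  fix e :: int assume e: "e \<in> {0, 1}"
  let ?A = "{t \<in> Sums2. t mod 2 = e}"
  have "card ?A \<le> card {t \<in> {0 + 1..0 + 2 * Y}. t mod 2 = e}"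
    unfolding Sums2_def by (intro card_mono) (auto intro: finite_subset[of _ "{1..2 * Y}"])
  then have "int (card ?A) \<le> Y" using card_parity_class[OF e, of Y 0] Y_pos by simp
  then have "int (card ?A) * (4 * h) \<le> Y * (4 * h)"
    using K_nonneg K_le_h by (intro mult_right_mono) auto
  moreover have "(\<Sum>t\<in>?A. int (card (summands Y t)) + 4 * h)
    = (\<Sum>t\<in>?A. int (card (summands Y t))) + int (card ?A) * (4 * h)"
    by (simp add: sum.distrib)
  moreover have "2 * (\<Sum>t\<in>?A. int (card (summands Y t))) = Y^2"
    unfolding Sums2_def using sum_card_summands_parity_class[OF e even_Y] Y_pos by simp
  ultimately show "2 * (\<Sum>t\<in>?A. int (card (summands Y t)) + 4 * h) \<le> Y^2 + 8 * h * Y"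
    by (simp add: mult_ac)
qed simp

lemma sum_window_le:
  "(\<Sum>t\<in>{t \<in> Sums. even_sum t}. slope1 (fst t) * window t)
    \<le> (q * a1 * (X * (X + 1)) + \<bar>l1\<bar> * X) * (Y^2 + 8 * h * Y)^2"
proof -
  have "(\<Sum>t\<in>{t \<in> Sums. even_sum t}. slope1 (fst t) * window t)
    = (\<Sum>t\<in>Sums. if even_sum t then slope1 (fst t) * window t else 0)"
    by (simp add: sum.inter_filter)
  also have "\<dots> = (\<Sum>(t1, t2, t3)\<in>Sums1 \<times> Sums2 \<times> Sums2. if even (l1 * t1 + l2 * t2 + l3 * t3)
      then slope1 t1 * ((int (card (summands Y t2)) + 4 * h) * (int (card (summands Y t3)) + 4 * h))
        else 0)"
    by (intro sum.cong) (simp_all only: Sums_def even_sum_def window_def split_paired_all prod.case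
      fst_conv)
  finally have "2 * (\<Sum>t\<in>{t \<in> Sums. even_sum t}. slope1 (fst t) * window t)
    \<le> 2 * ((q * a1 * (X * (X + 1)) + \<bar>l1\<bar> * X) * (Y^2 + 8 * h * Y)^2)"
    using sum_even_combinations_le[OF parity_bounded_slope1 parity_bounded_summands
        parity_bounded_summands some_linear_odd]
    unfolding power2_eq_square[of "Y^2 + 8 * h * Y"] by (simp only: mult.assoc)
  then show ?thesis by simp
qed

lemma window_bounds: "0 \<le> window t" "window t \<le> 4 * Y^2"
proof -
  obtain t1 t2 t3 where t: "t = (t1, t2, t3)" by (metis surj_pair)
  have width: "0 \<le> int (card (summands Y s)) + 4 * h" "int (card (summands Y s)) + 4 * h \<le> 2 * Y" for s
    using card_summands_le[of Y s] Y_pos K_nonneg K_le_h h_le by auto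
  then have "window t \<le> (2 * Y) * (2 * Y)"
    unfolding t window_def prod.case using Y_pos by (intro mult_mono) auto
  then show "window t \<le> 4 * Y^2" by (simp add: power2_eq_square)
  show "0 \<le> window t" using width(1) by (simp add: t window_def)
qed

lemma fibre_term_le_if_not_exceptional:
  assumes t: "t \<in> Sums" "\<not> exceptional t"
  shows "(slope1 (fst t))^2 * int (card (fibre t))
    \<le> slope1 (fst t) * window t + (if slope_gcd t > 1 then 4 * C * Y^2 * slope_gcd t else 0)"
proof -
  have slope: "0 < slope1 (fst t)" "slope1 (fst t) \<le> C"
    using t(1) slope1_bounds by (auto simp: Sums_def)
  have "slope1 (fst t) * (int (card (fibre t)) * slope1 (fst t))
    \<le> slope1 (fst t) * (slope_gcd t * window t)"
    using card_fibre_le_if_not_exceptional[OF t] slope by (intro mult_left_mono) auto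
  then have bound: "(slope1 (fst t))^2 * int (card (fibre t)) \<le> slope1 (fst t) * window t * slope_gcd t"
    by (simp add: power2_eq_square mult_ac)
  show ?thesis
  proof (cases "slope_gcd t > 1")
    case True
    have "slope1 (fst t) * window t * slope_gcd t \<le> C * (4 * Y^2) * slope_gcd t"
      using window_bounds[of t] slope True by (intro mult_right_mono mult_mono) auto
    also have "\<dots> = 4 * C * Y^2 * slope_gcd t" by simp
    finally have "slope1 (fst t) * window t * slope_gcd t \<le> 4 * C * Y^2 * slope_gcd t" .
    moreover have "0 \<le> slope1 (fst t) * window t" using window_bounds[of t] slope by simp
    ultimately show ?thesis using bound True by (simp only: if_True)
  next
    case False
    then have "slope_gcd t = 1" using slope_gcd_pos[OF t(1)] by simp
    then show ?thesis using bound by simp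
  qed
qed

lemma fibre_term_le_if_exceptional:
  assumes t: "t \<in> Sums"
  shows "(slope1 (fst t))^2 * card (fibre t)
    \<le> real_of_int (C^2) * (Y * (Y + T) / T + (if degenerate t then real_of_int (Y^2) else 0))"
proof -
  have "0 < slope1 (fst t)" "slope1 (fst t) \<le> C" using t slope1_bounds by (auto simp: Sums_def)
  then have square_le: "(slope1 (fst t))^2 \<le> C^2" by (intro power_mono) auto
  have "real (card (fibre t)) \<le> Y * (Y + T) / T + (if degenerate t then real_of_int (Y^2) else 0)"
  proof (cases "degenerate t")
    case True
    have "real_of_int (int (card (fibre t))) \<le> real_of_int (Y^2)"
      using card_fibre_le by (simp only: of_int_le_iff)
    then show ?thesis using True Y_pos T_pos by (simp add: add_increasing)
  next
    case False
    then have "real_of_int (int (card (fibre t)) * T) \<le> real_of_int (Y * (Y + T))"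
      using card_fibre_le_if_not_degenerate[OF t False] by (simp only: of_int_le_iff)
    then show ?thesis using False T_pos by (simp add: le_divide_eq)
  qed
  moreover have "real_of_int ((slope1 (fst t))^2) \<le> real_of_int (C^2)"
    using square_le by (simp only: of_int_le_iff)
  ultimately show ?thesis unfolding of_int_mult of_int_of_nat_eq by (intro mult_mono) auto
qed

definition moment_bound :: real where
  "moment_bound = (q * a1 * (X * (X + 1)) + \<bar>l1\<bar> * X) * (Y^2 + 8 * h * Y)^2
    + 4 * C * Y^2 * (64 * X * Y^2 / P + 4 * C * (2 * X + C))
    + C^2 * (relation_count K J * (4 * X * Y) * (Y * (Y + T) / T)
      + degenerate_count T J * (2 * X) * Y^2)"

lemma sum_exceptional_le:
  "(\<Sum>t\<in>{t \<in> Sums. exceptional t}. Y * (Y + T) / T + (if degenerate t then real_of_int (Y^2) else 0))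
    \<le> relation_count K J * (4 * X * Y) * (Y * (Y + T) / T) + degenerate_count T J * (2 * X) * Y^2"
proof -
  let ?E = "{t \<in> Sums. exceptional t}" and ?D = "{t \<in> Sums. degenerate t}"
  have "(\<Sum>t\<in>?E. Y * (Y + T) / T + (if degenerate t then real_of_int (Y^2) else 0))
    = card ?E * (Y * (Y + T) / T) + card {t \<in> ?E. degenerate t} * real_of_int (Y^2)"
    by (simp add: sum.distrib flip: sum.inter_filter)
  also have "card {t \<in> ?E. degenerate t} \<le> card ?D" by (intro card_mono) auto
  then have "card ?E * (Y * (Y + T) / T) + card {t \<in> ?E. degenerate t} * real_of_int (Y^2)
    \<le> card ?E * (Y * (Y + T) / T) + card ?D * real_of_int (Y^2)"
    by (intro add_left_mono mult_right_mono) auto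
  also have "\<dots> \<le> real_of_int (relation_count K J * (4 * X * Y)) * (Y * (Y + T) / T)
      + real_of_int (degenerate_count T J * (2 * X)) * real_of_int (Y^2)"
  proof (intro add_mono mult_right_mono)
    have "real_of_int (int (card ?E)) \<le> real_of_int (relation_count K J * (4 * X * Y))"
      using card_exceptional_le by (simp only: of_int_le_iff)
    then show "real (card ?E) \<le> real_of_int (relation_count K J * (4 * X * Y))" by simp
    have "real_of_int (int (card ?D)) \<le> real_of_int (degenerate_count T J * (2 * X))"
      using card_degenerate_le by (simp only: of_int_le_iff)
    then show "real (card ?D) \<le> real_of_int (degenerate_count T J * (2 * X))" by simp
  qed (use Y_pos T_pos in auto)
  finally show ?thesis by simp
qed

lemma fibre_term_le:
  assumes t: "t \<in> Sums"
  shows "real_of_int ((slope1 (fst t))^2 * int (card (fibre t)))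
    \<le> real_of_int (slope1 (fst t) * window t)
      + real_of_int (if slope_gcd t > 1 then 4 * C * Y^2 * slope_gcd t else 0)
      + (if exceptional t
        then real_of_int (C^2) * (Y * (Y + T) / T + (if degenerate t then real_of_int (Y^2) else 0))
          else 0)"
proof (cases "exceptional t")
  case True
  have "0 < slope1 (fst t)" using t slope1_bounds by (auto simp: Sums_def)
  then have "0 \<le> slope1 (fst t) * window t"
    "0 \<le> (if slope_gcd t > 1 then 4 * C * Y^2 * slope_gcd t else 0)"
    using window_bounds C_pos by auto
  then have "0 \<le> real_of_int (slope1 (fst t) * window t)"
    "0 \<le> real_of_int (if slope_gcd t > 1 then 4 * C * Y^2 * slope_gcd t else 0)"
    by (simp_all only: of_int_0_le_iff)
  then show ?thesis using fibre_term_le_if_exceptional[OF t] True by (simp only: of_int_mult) simp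
next
  case False
  then show ?thesis
    using fibre_term_le_if_not_exceptional[OF t] by (simp flip: of_int_add of_int_mult)
qed

lemma pair_sum_le_moment_bound:
  "(\<Sum>(u, v)\<in>{(u, v) \<in> Box \<times> Box. F u = F v}. weight u * weight v) \<le> moment_bound"
proof -
  let ?E = "{t \<in> Sums. even_sum t}"
  let ?gcd_term = "\<lambda>t. if slope_gcd t > 1 then 4 * C * Y^2 * slope_gcd t else 0"
  let ?fibre_bound = "\<lambda>t. Y * (Y + T) / T + (if degenerate t then real_of_int (Y^2) else 0)"
  let ?exceptional_term = "\<lambda>t. if exceptional t then real_of_int (C^2) * ?fibre_bound t else 0"
  have "real_of_int (\<Sum>(u, v)\<in>{(u, v) \<in> Box \<times> Box. F u = F v}. weight u * weight v)
    \<le> real_of_int (\<Sum>t\<in>?E. (slope1 (fst t))^2 * int (card (fibre t)))"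
    using pair_sum_le by (simp only: of_int_le_iff)
  also have "\<dots> \<le> (\<Sum>t\<in>?E. real_of_int (slope1 (fst t) * window t) + real_of_int (?gcd_term t)
      + ?exceptional_term t)"
    unfolding of_int_sum using fibre_term_le by (intro sum_mono) blast
  also have "\<dots> = real_of_int (\<Sum>t\<in>?E. slope1 (fst t) * window t)
      + (\<Sum>t\<in>?E. real_of_int (?gcd_term t)) + (\<Sum>t\<in>?E. ?exceptional_term t)"
    by (simp only: sum.distrib of_int_sum)
  also have "real_of_int (\<Sum>t\<in>?E. slope1 (fst t) * window t)
    \<le> real_of_int ((q * a1 * (X * (X + 1)) + \<bar>l1\<bar> * X) * (Y^2 + 8 * h * Y)^2)"
    using sum_window_le by (simp only: of_int_le_iff)
  also have "(\<Sum>t\<in>?E. real_of_int (?gcd_term t)) \<le> (\<Sum>t\<in>Sums. real_of_int (?gcd_term t))"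
    using C_pos by (intro sum_mono2) auto
  also have "\<dots> = 4 * C * Y^2 * (\<Sum>t\<in>{t \<in> Sums. slope_gcd t > 1}. real_of_int (slope_gcd t))"
    by (simp add: sum_distrib_left sum.inter_filter if_distrib cong: if_cong)
  also have "\<dots> \<le> 4 * C * Y^2 * (64 * X * Y^2 / P + 4 * C * (2 * X + C))"
    using sum_slope_gcd_le C_pos by (intro mult_left_mono) auto
  also have "(\<Sum>t\<in>?E. ?exceptional_term t) \<le> (\<Sum>t\<in>Sums. ?exceptional_term t)"
    using Y_pos T_pos by (intro sum_mono2) auto
  also have "\<dots> = (\<Sum>t\<in>{t \<in> Sums. exceptional t}. real_of_int (C^2) * ?fibre_bound t)"
    by (rule sum.inter_filter[symmetric]) simp
  also have "\<dots> = real_of_int (C^2) * (\<Sum>t\<in>{t \<in> Sums. exceptional t}. ?fibre_bound t)"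
    by (rule sum_distrib_left[symmetric])
  also have "\<dots> \<le> real_of_int (C^2) * (relation_count K J * (4 * X * Y) * (Y * (Y + T) / T)
      + degenerate_count T J * (2 * X) * Y^2)"
    using sum_exceptional_le by (intro mult_left_mono) auto
  finally show ?thesis unfolding moment_bound_def by simp
qed

lemma sum_weight: "(\<Sum>u\<in>Box. weight u) = (l1 * (X - X0) + q * a1 * (X^2 - X0^2)) * Y^2"
proof -
  have "(\<Sum>u\<in>{X0 + 1..Z}. l1 + q * a1 * (2 * u - 1)) = l1 * (Z - X0) + q * a1 * (Z^2 - X0^2)"
    if "X0 \<le> Z" for Z
    using that
  proof (induction Z rule: int_ge_induct)
    case (step i)
    have "{X0 + 1..i + 1} = insert (i + 1) {X0 + 1..i}" using step by auto
    then show ?case using step by (simp add: algebra_simps power2_eq_square)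
  qed auto
  moreover have "(\<Sum>u\<in>Box. weight u) = (\<Sum>u\<in>{X0 + 1..X}. \<Sum>z\<in>{1..Y} \<times> {1..Y}. l1 + q * a1 * (2 * u - 1))"
    unfolding Box_def weight_def by (simp only: sum.cartesian_product' prod.case)
  moreover have "\<dots> = (\<Sum>u\<in>{X0 + 1..X}. (l1 + q * a1 * (2 * u - 1)) * Y^2)"
    using Y_pos by (simp add: card_cartesian_product power2_eq_square mult_ac)
  moreover have "\<dots> = (\<Sum>u\<in>{X0 + 1..X}. l1 + q * a1 * (2 * u - 1)) * Y^2"
    by (rule sum_distrib_right[symmetric])
  ultimately show ?thesis using X0_less by simp
qed

lemma card_values_lower:
  "((l1 * (X - X0) + q * a1 * (X^2 - X0^2)) * Y^2)^2 \<le> card (F ` Box) * moment_bound"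
proof -
  have "(\<Sum>u\<in>Box. real_of_int (weight u))^2 \<le> card (F ` Box) *
      (\<Sum>(u, v)\<in>{(u, v) \<in> Box \<times> Box. F u = F v}. real_of_int (weight u) * real_of_int (weight v))"
    by (rule weighted_second_moment) simp
  also have "\<dots> \<le> card (F ` Box) * moment_bound"
    using pair_sum_le_moment_bound
    by (intro mult_left_mono) (simp_all add: case_prod_unfold)
  finally show ?thesis unfolding sum_weight[symmetric] by simp
qed

end

section \<open>Lower density\<close>

definition lower_density_ge :: "int set \<Rightarrow> real \<Rightarrow> bool" where
  "lower_density_ge S \<delta> \<longleftrightarrow>
     (\<forall>c<\<delta>. \<forall>\<^sub>F n in sequentially. c * real n \<le> real (card (S \<inter> {1..int n})))"

lemma lower_density_geI:
  assumes "\<And>c. 0 < c \<Longrightarrow> c < \<delta> \<Longrightarrow> \<forall>\<^sub>F n in sequentially. c * real n \<le> real (card (S \<inter> {1..int n}))"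
  shows "lower_density_ge S \<delta>"
  unfolding lower_density_ge_def
proof (intro allI impI)
  fix c assume "c < \<delta>"
  show "\<forall>\<^sub>F n in sequentially. c * real n \<le> real (card (S \<inter> {1..int n}))"
  proof (cases "c > 0")
    case False
    then have "c * real n \<le> real (card (S \<inter> {1..int n}))" for n
      by (intro order_trans[OF mult_nonpos_nonneg of_nat_0_le_iff]) auto
    then show ?thesis by simp
  qed (use assms \<open>c < \<delta>\<close> in blast)
qed

lemma lower_density_ge_mono:
  assumes "lower_density_ge S \<delta>" "\<And>n. n \<in> S \<Longrightarrow> 0 < n \<Longrightarrow> n \<in> T"
  shows "lower_density_ge T \<delta>"
  unfolding lower_density_ge_def
proof (intro allI impI)
  fix c assume "c < \<delta>"
  then have "\<forall>\<^sub>F n in sequentially. c * real n \<le> real (card (S \<inter> {1..int n}))"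
    using assms(1) by (simp add: lower_density_ge_def)
  then show "\<forall>\<^sub>F n in sequentially. c * real n \<le> real (card (T \<inter> {1..int n}))"
  proof eventually_elim
    case (elim n)
    have "card (S \<inter> {1..int n}) \<le> card (T \<inter> {1..int n})" using assms(2) by (intro card_mono) auto
    then show ?case using elim by linarith
  qed
qed

lemma lower_density_ge_disjoint_UN:
  assumes I: "finite I" "disjoint_family_on A I" and A: "\<And>i. i \<in> I \<Longrightarrow> lower_density_ge (A i) \<delta>"
  shows "lower_density_ge (\<Union>i\<in>I. A i) (real (card I) * \<delta>)"
proof (rule lower_density_geI)
  fix c assume c: "0 < c" "c < real (card I) * \<delta>"
  then have "card I > 0" by (cases "card I = 0") auto
  then have "c / real (card I) < \<delta>" using c by (simp add: divide_less_eq mult.commute)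
  then have "\<forall>i\<in>I. \<forall>\<^sub>F n in sequentially. c / real (card I) * real n \<le> real (card (A i \<inter> {1..int n}))"
    using A unfolding lower_density_ge_def by blast
  with I(1) have "\<forall>\<^sub>F n in sequentially. \<forall>i\<in>I. c / real (card I) * real n
    \<le> real (card (A i \<inter> {1..int n}))"
    by (rule eventually_ball_finite)
  then show "\<forall>\<^sub>F n in sequentially. c * real n \<le> real (card ((\<Union>i\<in>I. A i) \<inter> {1..int n}))"
  proof eventually_elim
    case (elim n)
    have "card ((\<Union>i\<in>I. A i) \<inter> {1..int n}) = card (\<Union>i\<in>I. A i \<inter> {1..int n})" by simp
    also have "\<dots> = (\<Sum>i\<in>I. card (A i \<inter> {1..int n}))"
      using I by (intro card_UN_disjoint) (auto simp: disjoint_family_on_def)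
    finally have "real (card ((\<Union>i\<in>I. A i) \<inter> {1..int n}))
      = (\<Sum>i\<in>I. real (card (A i \<inter> {1..int n})))" by simp
    moreover have "(\<Sum>i\<in>I. c / real (card I) * real n) \<le> (\<Sum>i\<in>I. real (card (A i \<inter> {1..int n})))"
      using elim by (intro sum_mono) auto
    ultimately show ?case using \<open>card I > 0\<close> by simp
  qed
qed

lemma card_affine_image_ge:
  fixes M \<rho> :: int and n :: nat
  assumes M: "M > 0" and n: "\<bar>\<rho>\<bar> < int n"
  shows "real (card (S \<inter> {1..int (nat \<lfloor>(real n - \<rho>) / M\<rfloor>)})) - \<bar>real_of_int \<rho>\<bar>
    \<le> real (card ((\<lambda>k. \<rho> + M * k) ` S \<inter> {1..int n}))"
proof -
  let ?\<nu> = "nat \<lfloor>(real n - \<rho>) / M\<rfloor>"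
  let ?S = "(S \<inter> {1..int ?\<nu>}) - {1..\<bar>\<rho>\<bar>}" and ?V = "(\<lambda>k. \<rho> + M * k) ` S \<inter> {1..int n}"
  have "(\<lambda>k. \<rho> + M * k) ` ?S \<subseteq> ?V"
  proof (rule image_subsetI)
    fix k assume k: "k \<in> ?S"
    then have "1 \<le> k" "\<bar>\<rho>\<bar> < k" by auto
    moreover have "k \<le> int ?\<nu>" using k by simp
    ultimately have "k \<le> \<lfloor>(real n - \<rho>) / M\<rfloor>" by linarith
    then have "real_of_int k \<le> (real n - \<rho>) / M" by (simp only: le_floor_iff)
    then have "real_of_int (\<rho> + M * k) \<le> real_of_int (int n)"
      using M by (simp add: le_divide_eq mult.commute)
    then have "\<rho> + M * k \<le> int n" by (simp only: of_int_le_iff)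
    moreover have "1 * k \<le> M * k" using \<open>1 \<le> k\<close> M by (intro mult_right_mono) auto
    then have "1 \<le> \<rho> + M * k" using \<open>\<bar>\<rho>\<bar> < k\<close> by linarith
    ultimately show "\<rho> + M * k \<in> ?V" using k by auto
  qed
  then have "card ((\<lambda>k. \<rho> + M * k) ` ?S) \<le> card ?V" by (intro card_mono) auto
  moreover have "card ((\<lambda>k. \<rho> + M * k) ` ?S) = card ?S"
    using M by (intro card_image) (auto simp: inj_on_def)
  moreover have "card (S \<inter> {1..int ?\<nu>}) - card {1..\<bar>\<rho>\<bar>} \<le> card ?S"
    by (rule diff_card_le_card_Diff) simp
  ultimately show ?thesis by simp
qed

lemma lower_density_ge_affine:
  fixes M \<rho> :: int
  assumes M: "M > 0" and S: "lower_density_ge S \<delta>"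
  shows "lower_density_ge ((\<lambda>k. \<rho> + M * k) ` S) (\<delta> / M)"
proof (rule lower_density_geI)
  fix c assume c: "0 < c" "c < \<delta> / M"
  then have "c * M < \<delta>" using M by (simp add: less_divide_eq)
  then obtain c' where c': "c * M < c'" "c' < \<delta>" using dense by blast
  define \<nu> where "\<nu> n = nat \<lfloor>(real n - \<rho>) / M\<rfloor>" for n
  have M_pos: "real_of_int M > 0" using M by simp
  have "filterlim \<nu> at_top sequentially" unfolding \<nu>_def using M_pos by real_asymp
  moreover have "\<forall>\<^sub>F n in sequentially. c' * real n \<le> real (card (S \<inter> {1..int n}))"
    using S c'(2) by (simp add: lower_density_ge_def)
  ultimately have count: "\<forall>\<^sub>F n in sequentially. c' * real (\<nu> n) \<le> real (card (S \<inter> {1..int (\<nu> n)}))"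
    by (rule eventually_compose_filterlim[rotated])
  have "(\<lambda>n. real (\<nu> n) / real n) \<longlonglongrightarrow> 1 / M"
    unfolding \<nu>_def using M_pos by real_asymp (simp add: inverse_eq_divide)
  then have "(\<lambda>n. c' * (real (\<nu> n) / real n) - \<bar>real_of_int \<rho>\<bar> / real n) \<longlonglongrightarrow> c' * (1 / M) - 0"
    by (intro tendsto_diff tendsto_mult_left lim_const_over_n)
  moreover have "c < c' * (1 / M) - 0" using c' M by (simp add: less_divide_eq)
  ultimately have "\<forall>\<^sub>F n in sequentially. c < c' * (real (\<nu> n) / real n) - \<bar>real_of_int \<rho>\<bar> / real n"
    by (rule order_tendstoD(1))
  with count show "\<forall>\<^sub>F n in sequentially. c * real n \<le> real (card ((\<lambda>k. \<rho> + M * k) ` S \<inter> {1..int n}))"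
    using eventually_gt_at_top[of "nat \<bar>\<rho>\<bar>"]
  proof eventually_elim
    case (elim n)
    have "c * real n \<le> c' * real (\<nu> n) - \<bar>real_of_int \<rho>\<bar>"
      using elim(2,3) by (simp add: field_simps)
    also have "\<dots> \<le> real (card (S \<inter> {1..int (\<nu> n)})) - \<bar>real_of_int \<rho>\<bar>" using elim(1) by simp
    also have "\<dots> \<le> real (card ((\<lambda>k. \<rho> + M * k) ` S \<inter> {1..int n}))"
      unfolding \<nu>_def using M elim(3) by (intro card_affine_image_ge) auto
    finally show ?case .
  qed
qed

lemma card_residue_class_le:
  fixes M \<rho> :: int
  assumes "M > 0"
  shows "real (card {v \<in> {1..int n}. v mod M = \<rho>}) \<le> real n / M + 1"
proof -
  have "int (card {v \<in> {1..int n}. v mod M = \<rho>}) * M \<le> int n - 1 + M"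
  proof (rule card_separated_le)
    fix x y assume xy: "x \<in> {v \<in> {1..int n}. v mod M = \<rho>}" "y \<in> {v \<in> {1..int n}. v mod M = \<rho>}" "x < y"
    then have "M dvd y - x" by (simp flip: mod_eq_dvd_iff)
    then show "x + M \<le> y" using xy(3) zdvd_imp_le[of M "y - x"] by simp
  qed (use assms in auto)
  then have "real_of_int (int (card {v \<in> {1..int n}. v mod M = \<rho>}) * M) \<le> real_of_int (int n + M)"
    by (simp only: of_int_le_iff)
  then show ?thesis using assms by (simp add: field_simps)
qed

lemma eventually_card_le_residues:
  fixes M :: int and D R :: "int set"
  assumes M: "M > 0" and R: "finite R" "\<And>v. v \<in> D \<Longrightarrow> v mod M \<in> R" and \<epsilon>: "\<epsilon> > 0"
  shows "\<forall>\<^sub>F n in sequentially. real (card (D \<inter> {1..int n})) / real n \<le> real (card R) / M + \<epsilon>"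
proof -
  have "(\<lambda>n. real (card R) / real n) \<longlonglongrightarrow> 0" by (rule lim_const_over_n)
  then have "\<forall>\<^sub>F n in sequentially. real (card R) / real n < \<epsilon>" using \<epsilon> by (rule order_tendstoD(2))
  then show ?thesis using eventually_gt_at_top[of 0]
  proof eventually_elim
    case (elim n)
    have "D \<inter> {1..int n} \<subseteq> (\<Union>\<rho>\<in>R. {v \<in> {1..int n}. v mod M = \<rho>})" using R(2) by auto
    then have "card (D \<inter> {1..int n}) \<le> card (\<Union>\<rho>\<in>R. {v \<in> {1..int n}. v mod M = \<rho>})"
      by (rule card_mono[rotated]) (rule finite_subset[of _ "{1..int n}"], auto)
    also have "\<dots> \<le> (\<Sum>\<rho>\<in>R. card {v \<in> {1..int n}. v mod M = \<rho>})" by (rule card_UN_le[OF R(1)])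
    finally have "real (card (D \<inter> {1..int n})) \<le> (\<Sum>\<rho>\<in>R. real (card {v \<in> {1..int n}. v mod M = \<rho>}))"
      by (simp flip: of_nat_sum)
    also have "\<dots> \<le> real (card R) * (real n / M + 1)"
      using card_residue_class_le[OF M] by (intro sum_bounded_above) auto
    finally have "real (card (D \<inter> {1..int n})) / real n \<le> real (card R) * (real n / M + 1) / real n"
      by (rule divide_right_mono) simp
    also have "\<dots> = real (card R) / M + real (card R) / real n" using elim(2) by (simp add: field_simps)
    finally show ?case using elim(1) by linarith
  qed
qed

lemma convergent_if_eventually_near:
  fixes s :: "nat \<Rightarrow> real"
  assumes "\<And>\<epsilon>. \<epsilon> > 0 \<Longrightarrow> \<exists>a. \<forall>\<^sub>F n in sequentially. \<bar>s n - a\<bar> \<le> \<epsilon>"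
  shows "convergent s"
  unfolding Cauchy_convergent_iff[symmetric]
proof (rule CauchyI)
  fix e :: real assume e: "e > 0"
  then obtain a where "\<forall>\<^sub>F n in sequentially. \<bar>s n - a\<bar> \<le> e / 3" using assms[of "e / 3"] by auto
  then obtain M where M: "\<And>n. n \<ge> M \<Longrightarrow> \<bar>s n - a\<bar> \<le> e / 3" unfolding eventually_sequentially by blast
  have "norm (s m - s n) < e" if "m \<ge> M" "n \<ge> M" for m n
    using M[OF that(1)] M[OF that(2)] e by (simp add: abs_if split: if_splits)
  then show "\<exists>M. \<forall>m\<ge>M. \<forall>n\<ge>M. norm (s m - s n) < e" by blast
qed

section \<open>Almost all positive integers are values\<close>

lemma eventually_le_if_quadratic:
  fixes f :: "nat \<Rightarrow> real" and \<rho> w c :: real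
  assumes w: "w > 0" and c: "c < \<rho> / w"
    and quadratic: "\<forall>\<^sub>F n in sequentially. \<forall>N. w * (real n)^2 \<le> real N \<longrightarrow> \<rho> * (real n)^2 \<le> f N"
  shows "\<forall>\<^sub>F N in sequentially. c * real N \<le> f N"
proof -
  define \<nu> where "\<nu> N = nat \<lfloor>sqrt (real N / w)\<rfloor>" for N
  have "filterlim \<nu> at_top sequentially" unfolding \<nu>_def using w by real_asymp
  then have "\<forall>\<^sub>F N in sequentially. \<forall>M. w * (real (\<nu> N))^2 \<le> real M \<longrightarrow> \<rho> * (real (\<nu> N))^2 \<le> f M"
    using quadratic by (rule eventually_compose_filterlim[rotated])
  moreover have "(\<lambda>N. (real (\<nu> N))^2 / real N) \<longlonglongrightarrow> 1 / w"
    unfolding \<nu>_def using w by real_asymp (simp add: powr_half_sqrt inverse_eq_divide)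
  then have "(\<lambda>N. \<rho> * ((real (\<nu> N))^2 / real N)) \<longlonglongrightarrow> \<rho> * (1 / w)" by (rule tendsto_mult_left)
  then have "(\<lambda>N. \<rho> * (real (\<nu> N))^2 / real N) \<longlonglongrightarrow> \<rho> / w" by simp
  then have "\<forall>\<^sub>F N in sequentially. c < \<rho> * (real (\<nu> N))^2 / real N" using c by (rule order_tendstoD)
  ultimately show ?thesis using eventually_gt_at_top[of 0]
  proof eventually_elim
    case (elim N)
    have "real (\<nu> N) \<le> sqrt (real N / w)" using w by (simp add: \<nu>_def)
    then have "(real (\<nu> N))^2 \<le> (sqrt (real N / w))^2" by (rule power_mono) simp
    also have "\<dots> = real N / w" using w by simp
    finally have "w * (real (\<nu> N))^2 \<le> real N" using w by (simp add: field_simps)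
    then have "\<rho> * (real (\<nu> N))^2 \<le> f N" using elim(1) by blast
    then show ?case using elim(2,3) by (simp add: field_simps)
  qed
qed

lemma scaled_moment_identity:
  fixes s h y A l p k t d :: real
  assumes "s > 0" "y > 0" "A > 0" "t > 0" and y: "y = s * h" and t: "t = 36 * A * k * s^2"
  shows "(A * (s * y * (s * y + 1)) + l * (s * y)) * (y^2 + 8 * h * y)^2
      + 4 * (3 * A * (s * y)) * y^2 *
        (64 * (s * y) * y^2 / p + 4 * (3 * A * (s * y)) * (2 * (s * y) + 3 * A * (s * y)))
      + (3 * A * (s * y))^2 * (k * (4 * (s * y) * y) * (y * (y + t) / t) + d * (2 * (s * y)) * y^2)
    = A * (s * y)^2 * y^4 * ((1 + 8 / s)^2 + 768 / p + 1 / s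
      + ((1 + l / A) * (1 + 8 / s)^2 / s + 144 * A * (2 + 3 * A) * s + t / s + 18 * A * d * s) / y)"
proof -
  have h: "h = y / s" using y assms(1) by simp
  have "(A * (s * y * (s * y + 1)) + l * (s * y)) * (y^2 + 8 * h * y)^2
    = A * (s * y)^2 * y^4 * ((1 + 8 / s)^2 + (1 + l / A) * (1 + 8 / s)^2 / s / y)"
    unfolding h using assms(1-3) by (simp add: field_simps power2_eq_square power4_eq_xxxx)
  moreover have "4 * (3 * A * (s * y)) * y^2
      * (64 * (s * y) * y^2 / p + 4 * (3 * A * (s * y)) * (2 * (s * y) + 3 * A * (s * y)))
    = A * (s * y)^2 * y^4 * (768 / p + 144 * A * (2 + 3 * A) * s / y)"
    using assms(1-3) by (simp add: field_simps power2_eq_square power4_eq_xxxx)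
  moreover have "(3 * A * (s * y))^2 *
    (k * (4 * (s * y) * y) * (y * (y + t) / t) + d * (2 * (s * y)) * y^2)
    = A * (s * y)^2 * y^4 * (1 / s + t / s / y + 18 * A * d * s / y)"
  proof -
    define i where "i = 1 / t"
    have "t * i = 1" "y * (y + t) / t = y^2 * i + y"
      using assms(4) by (simp_all add: i_def field_simps power2_eq_square)
    moreover have "A * (s * y)^2 * y^4 * (1 / s + t / s / y + 18 * A * d * s / y)
      = A * s * y^6 + A * s * t * y^5 + 18 * A^2 * d * s^3 * y^5"
      using assms(1-3) by (simp add: field_simps power2_eq_square eval_nat_numeral)
    moreover have "(3 * A * (s * y))^2 *
      (k * (4 * (s * y) * y) * (y^2 * i + y) + d * (2 * (s * y)) * y^2)
      = A * s * y^6 + A * s * t * y^5 + 18 * A^2 * d * s^3 * y^5"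
      using \<open>t * i = 1\<close> t by algebra
    ultimately show ?thesis by simp
  qed
  ultimately show ?thesis by (simp add: distrib_left add_divide_distrib)
qed

lemma scaled_mean_identity:
  fixes r y A l \<kappa> :: real
  assumes "r > 0" "y > 0" "A > 0"
  shows "(l * (r * y - \<kappa> * y) + A * ((r * y)^2 - (\<kappa> * y)^2)) * y^2
    = A * (r * y)^2 * y^2 * (1 - (\<kappa> / r)^2 + l * (r - \<kappa>) / (A * r^2) / y)"
  using assms by (simp add: field_simps power2_eq_square)

context quadratic_progression
begin

definition cutoff :: int where "cutoff = \<bar>a2\<bar> + \<bar>a3\<bar> + 1"

lemma cutoff_pos: "cutoff > 0" by (simp add: cutoff_def)

definition slope_bound :: int where "slope_bound = \<bar>l2\<bar> + \<bar>l3\<bar> + 2 * q * (\<bar>a2\<bar> + \<bar>a3\<bar>)"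

definition vector_bound :: "int \<Rightarrow> int" where "vector_bound s = 3 * (q * a1) * s^2"

definition spacing :: "int \<Rightarrow> int" where
  "spacing s = 36 * (q * a1) * relation_count (vector_bound s) slope_bound * s^2"

lemma F_remainder_bound:
  assumes "u2 \<in> {1..Y}" "u3 \<in> {1..Y}"
  shows "\<bar>F (u1, u2, u3) - u1 * (q * a1 * u1 + l1)\<bar> \<le> (\<bar>l2\<bar> + \<bar>l3\<bar>) * Y + q * (cutoff - 1) * Y^2"
proof -
  have linear: "\<bar>l * v\<bar> \<le> \<bar>l\<bar> * Y" and square: "\<bar>l * v^2\<bar> \<le> \<bar>l\<bar> * Y^2" if "v \<in> {1..Y}" for l v
    unfolding abs_mult using that by (auto intro!: mult_left_mono power_mono)
  have "\<bar>a2 * u2^2 + a3 * u3^2\<bar> \<le> (cutoff - 1) * Y^2"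
    using square[OF assms(1), of a2] square[OF assms(2), of a3]
    by (simp add: cutoff_def distrib_right)
  then have "\<bar>q * (a2 * u2^2 + a3 * u3^2)\<bar> \<le> q * ((cutoff - 1) * Y^2)"
    unfolding abs_mult using q_pos by (simp add: mult_left_mono)
  moreover have "\<bar>l2 * u2\<bar> \<le> \<bar>l2\<bar> * Y" "\<bar>l3 * u3\<bar> \<le> \<bar>l3\<bar> * Y" using linear assms by auto
  moreover have "F (u1, u2, u3) - u1 * (q * a1 * u1 + l1)
    = l2 * u2 + l3 * u3 + q * (a2 * u2^2 + a3 * u3^2)"
    by (simp add: F_def algebra_simps power2_eq_square)
  ultimately show ?thesis by (simp add: distrib_right mult.assoc)
qed

lemma F_pos:
  assumes Y: "\<bar>l1\<bar> + \<bar>l2\<bar> + \<bar>l3\<bar> < Y" and u: "cutoff * Y < u1" "u2 \<in> {1..Y}" "u3 \<in> {1..Y}"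
  shows "F (u1, u2, u3) > 0"
proof -
  have Y_pos: "Y > 0" using Y by simp
  have cutoff: "1 \<le> cutoff" by (simp add: cutoff_def)
  have q: "1 \<le> q" "q * 1 \<le> q * a1" using q_pos a1_pos by (simp, intro mult_left_mono) auto
  have "1 * Y \<le> cutoff * Y" using cutoff Y_pos by (intro mult_right_mono) auto
  then have u1: "Y \<le> u1" "0 \<le> cutoff * Y" using u(1) Y_pos by linarith+
  have "q * (cutoff * Y) \<le> q * a1 * u1" using q u(1) u1 by (intro mult_mono) auto
  moreover have "1 * Y \<le> q * (cutoff * Y)"
    using q cutoff Y_pos mult_mono[of 1 q Y "cutoff * Y"] u1(2) \<open>1 * Y \<le> cutoff * Y\<close> by linarith
  ultimately have "Y * (q * (cutoff * Y) - \<bar>l1\<bar>) \<le> u1 * (q * a1 * u1 + l1)"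
    using u1 Y Y_pos by (intro mult_mono) linarith+
  moreover have "Y * (\<bar>l1\<bar> + \<bar>l2\<bar> + \<bar>l3\<bar>) < Y * Y" using Y Y_pos by (intro mult_strict_left_mono)
  moreover have "1 * (Y * Y) \<le> q * (Y * Y)" using q by (intro mult_right_mono) auto
  moreover have "Y * (q * (cutoff * Y) - \<bar>l1\<bar>) - ((\<bar>l2\<bar> + \<bar>l3\<bar>) * Y + q * (cutoff - 1) * Y^2)
    = q * (Y * Y) - Y * (\<bar>l1\<bar> + \<bar>l2\<bar> + \<bar>l3\<bar>)"
    by (simp add: power2_eq_square algebra_simps)
  ultimately show ?thesis using F_remainder_bound[OF u(2,3), of u1] by linarith
qed

lemma F_le:
  assumes "u1 \<in> {0..X}" "u2 \<in> {1..Y}" "u3 \<in> {1..Y}"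
  shows "F (u1, u2, u3) \<le> q * a1 * X^2 + \<bar>l1\<bar> * X + (\<bar>l2\<bar> + \<bar>l3\<bar>) * Y + q * (cutoff - 1) * Y^2"
proof -
  have "q * a1 * u1^2 \<le> q * a1 * X^2" using assms(1) qa1_pos by (intro mult_left_mono power_mono) auto
  moreover have "l1 * u1 \<le> \<bar>l1\<bar> * X" using assms(1) by (intro mult_mono) auto
  moreover have "u1 * (q * a1 * u1 + l1) = q * a1 * u1^2 + l1 * u1"
    by (simp add: power2_eq_square algebra_simps)
  ultimately show ?thesis using F_remainder_bound[OF assms(2,3), of u1] by linarith
qed

lemma slope_le:
  assumes "t \<in> {2..2 * Y}" "\<bar>l\<bar> + 2 * q * \<bar>a\<bar> \<le> B"
  shows "\<bar>l + q * a * t\<bar> \<le> B * Y"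
proof -
  have "\<bar>q * a * t\<bar> = q * \<bar>a\<bar> * t" using q_pos assms(1) by (simp add: abs_mult)
  also have "\<dots> \<le> q * \<bar>a\<bar> * (2 * Y)" using q_pos assms(1) by (intro mult_left_mono) auto
  moreover have "\<bar>l\<bar> * 1 \<le> \<bar>l\<bar> * Y" using assms(1) by (intro mult_left_mono) auto
  ultimately have "\<bar>l + q * a * t\<bar> \<le> (\<bar>l\<bar> + 2 * q * \<bar>a\<bar>) * Y"
    using abs_triangle_ineq[of l "q * a * t"] by (simp add: algebra_simps)
  also have "\<dots> \<le> B * Y" using assms by (intro mult_right_mono) auto
  finally show ?thesis .
qed

lemma second_moment_scaled:
  assumes s: "4 \<le> s" "cutoff < s" and h: "even h" "q * a1 + vector_bound s + \<bar>l1\<bar> + 1 \<le> h"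
  shows "second_moment l1 l2 l3 a1 a2 a3 q P (cutoff * (s * h)) (s * (s * h)) (s * h) h
    (vector_bound s) (spacing s) slope_bound (3 * (q * a1) * (s * (s * h)))"
proof unfold_locales
  let ?A = "q * a1" and ?Y = "s * h"
  have K: "0 \<le> vector_bound s" using qa1_pos by (simp add: vector_bound_def)
  have h_bounds: "?A \<le> h" "\<bar>l1\<bar> < h" "vector_bound s \<le> h" "0 < h" using h(2) K qa1_pos by auto
  have "4 * h \<le> ?Y" using s h_bounds by (intro mult_right_mono) auto
  moreover have "1 * ?Y \<le> cutoff * ?Y"
    using s h_bounds by (intro mult_right_mono) (auto simp: cutoff_def)
  moreover have "1 * (cutoff * ?Y) \<le> ?A * (cutoff * ?Y)"
    using qa1_pos s h_bounds by (intro mult_right_mono) (auto simp: cutoff_def)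
  moreover have "cutoff * ?Y < s * ?Y" using s h_bounds by (intro mult_strict_right_mono) auto
  moreover from this have "?A * (cutoff * ?Y) < ?A * (s * ?Y)"
    using qa1_pos by (intro mult_strict_left_mono)
  ultimately have order: "4 * h \<le> ?Y" "?Y \<le> cutoff * ?Y" "cutoff * ?Y < s * ?Y"
    "cutoff * ?Y \<le> ?A * (cutoff * ?Y)" "?A * (cutoff * ?Y) \<le> ?A * (s * ?Y)" by auto
  show "4 * h \<le> ?Y" "cutoff * ?Y < s * ?Y" "0 \<le> cutoff * ?Y" "0 < ?Y" "?Y \<le> s * ?Y" "q * a1 \<le> ?Y"
    using order h_bounds by linarith+
  show "0 \<le> vector_bound s" "vector_bound s \<le> h" using K h_bounds by auto
  show "even ?Y" using h(1) by simp
  have slope1: "slope1 (2 * x) = l1 + 2 * (?A * x)" for x by (simp add: slope1_def)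
  show "?Y \<le> slope1 (2 * (cutoff * ?Y))" "slope1 (2 * (s * ?Y)) \<le> 3 * ?A * (s * ?Y)"
    using order h_bounds unfolding slope1 by linarith+
  show "0 \<le> slope_bound" using q_pos by (simp add: slope_bound_def)
  show "\<bar>slope2 t\<bar> \<le> slope_bound * ?Y" "\<bar>slope3 t\<bar> \<le> slope_bound * ?Y" if "t \<in> {2..2 * ?Y}" for t
    unfolding slope2_def slope3_def
    by (rule slope_le[OF that]; use q_pos in \<open>simp add: slope_bound_def distrib_left\<close>)+
  have "3 * ?A * (s * ?Y) = vector_bound s * h" by (simp add: vector_bound_def power2_eq_square)
  also have "\<dots> < (vector_bound s + 1) * (h + 1)" using K h_bounds by (simp add: algebra_simps)
  finally show "3 * ?A * (s * ?Y) < (vector_bound s + 1) * (h + 1)" .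
  have "0 < relation_count (vector_bound s) slope_bound"
    using K \<open>0 \<le> slope_bound\<close> by (simp add: relation_count_def add_nonneg_pos)
  then show "0 < spacing s" using qa1_pos s by (simp add: spacing_def)
qed

definition loss :: "real \<Rightarrow> real" where "loss r = (1 + 8 / r)^2 + 768 / P + 1 / r"
definition gain :: "real \<Rightarrow> real" where "gain r = (1 - (cutoff / r)^2)^2 / loss r"
definition spread :: "real \<Rightarrow> real" where "spread r = 1 + cutoff / r^2"

definition scaled_box :: "int \<Rightarrow> int \<Rightarrow> (int \<times> int \<times> int) set" where
  "scaled_box s h = {cutoff * (s * h) + 1..s * (s * h)} \<times> {1..s * h} \<times> {1..s * h}"

definition mean_error :: "real \<Rightarrow> real" where
  "mean_error r = real_of_int l1 * (r - real_of_int cutoff) / (real_of_int (q * a1) * r^2)"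

definition moment_error :: "int \<Rightarrow> real" where
  "moment_error s = (let A = real_of_int (q * a1); r = real_of_int s in
     (1 + \<bar>real_of_int l1\<bar> / A) * (1 + 8 / r)^2 / r + 144 * A * (2 + 3 * A) * r + spacing s / r
     + 18 * A * degenerate_count (spacing s) slope_bound * r)"

lemma moment_bound_scaled:
  fixes s h :: int and y :: real
  defines "y \<equiv> real_of_int s * h"
  assumes s: "4 \<le> s" "cutoff < s" and h: "even h" "q * a1 + vector_bound s + \<bar>l1\<bar> + 1 \<le> h"
  shows "second_moment.moment_bound l1 a1 q P (s * (s * h)) (s * h) h
      (vector_bound s) (spacing s) slope_bound (3 * (q * a1) * (s * (s * h)))
    = real_of_int (q * a1) * (s * y)^2 * y^4 * (loss s + moment_error s / y)"
proof -
  interpret second_moment l1 l2 l3 a1 a2 a3 q P "cutoff * (s * h)" "s * (s * h)" "s * h" h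
    "vector_bound s" "spacing s" slope_bound "3 * (q * a1) * (s * (s * h))"
    using second_moment_scaled[OF s h] .
  define A where "A = real_of_int (q * a1)"
  define k where "k = real_of_int (relation_count (vector_bound s) slope_bound)"
  have fold: "real_of_int q * real_of_int a1 = A" "real_of_int s * real_of_int h = y"
    by (simp_all add: A_def y_def)
  have "y = real_of_int (s * h)" by (simp add: y_def)
  then have pos: "0 < real_of_int s" "0 < y" "0 < A" "0 < real_of_int (spacing s)"
    using s Y_pos qa1_pos T_pos by (simp_all only: A_def of_int_0_less_iff)
  have spacing: "real_of_int (spacing s) = 36 * A * k * (real_of_int s)^2"
    by (simp add: spacing_def A_def k_def)
  show ?thesis
    using scaled_moment_identity[OF pos fold(2)[symmetric] spacing]
    unfolding moment_bound_def loss_def moment_error_def Let_def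
    by (simp only: of_int_add of_int_mult of_int_power of_int_numeral of_int_1 of_int_abs
        fold k_def[symmetric])
qed

lemma card_scaled_values_lower:
  fixes s h :: int and y :: real
  defines "y \<equiv> real_of_int s * h"
  assumes s: "4 \<le> s" "cutoff < s" and h: "even h" "q * a1 + vector_bound s + \<bar>l1\<bar> + 1 \<le> h"
  shows "real_of_int (q * a1) * (s * y)^2 * (1 - (cutoff / s)^2 + mean_error s / y)^2
      \<le> card (F ` scaled_box s h) * (loss s + moment_error s / y)"
proof -
  interpret second_moment l1 l2 l3 a1 a2 a3 q P "cutoff * (s * h)" "s * (s * h)" "s * h" h
    "vector_bound s" "spacing s" slope_bound "3 * (q * a1) * (s * (s * h))"
    using second_moment_scaled[OF s h] .
  define A where "A = real_of_int (q * a1)"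
  let ?M = "1 - (cutoff / s)^2 + mean_error s / y" and ?L = "loss s + moment_error s / y"
  have fold: "real_of_int q * real_of_int a1 = A" "real_of_int s * real_of_int h = y"
    by (simp_all add: A_def y_def)
  have "y = real_of_int (s * h)" by (simp add: y_def)
  then have pos: "0 < real_of_int s" "0 < y" "0 < A"
    using s Y_pos qa1_pos by (simp_all only: A_def of_int_0_less_iff)
  have "real_of_int ((l1 * (s * (s * h) - cutoff * (s * h))
      + q * a1 * ((s * (s * h))^2 - (cutoff * (s * h))^2)) * (s * h)^2)
    = A * (s * y)^2 * y^2 * ?M"
    using scaled_mean_identity[OF pos] unfolding mean_error_def
    by (simp only: of_int_add of_int_diff of_int_mult of_int_power fold)
  then have "(A * (s * y)^2 * y^2 * ?M)^2 \<le> card (F ` Box) * (A * (s * y)^2 * y^4 * ?L)"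
    using card_values_lower moment_bound_scaled[OF s h]
    by (simp only: of_int_power[of _ 2] A_def y_def)
  then have "(A * (s * y)^2 * y^4) * (A * (s * y)^2 * ?M^2)
    \<le> (A * (s * y)^2 * y^4) * (card (F ` Box) * ?L)"
    by (simp only: power2_eq_square power4_eq_xxxx mult_ac)
  then have "A * (s * y)^2 * ?M^2 \<le> card (F ` Box) * ?L" using pos by simp
  then show ?thesis unfolding A_def Box_def scaled_box_def .
qed

lemma eventually_card_scaled_values_ge:
  fixes s :: int and r \<rho> :: real
  defines "r \<equiv> real_of_int s"
  assumes s: "4 \<le> s" "cutoff < s" and \<rho>: "\<rho> < gain r"
  shows "\<forall>\<^sub>F n in sequentially.
    \<rho> * (real_of_int (q * a1) * (r * (r * (2 * real n)))^2) \<le> card (F ` scaled_box s (2 * int n))"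
proof -
  define D E where "D = mean_error r" and "E = moment_error s"
  have r: "r > 0" using s(1) by (simp add: r_def)
  then have loss_pos: "loss r > 0" by (simp add: loss_def add_nonneg_pos)
  have lim: "(\<lambda>n. x + y / (r * (2 * real n))) \<longlonglongrightarrow> x" for x y :: real
    using r by real_asymp
  have "(\<lambda>n. (1 - (cutoff / r)^2 + D / (r * (2 * real n)))^2 - \<rho> * (loss r + E / (r * (2 * real n))))
    \<longlonglongrightarrow> (1 - (cutoff / r)^2)^2 - \<rho> * loss r"
    by (intro tendsto_intros lim)
  moreover have "(1 - (cutoff / r)^2)^2 - \<rho> * loss r > 0"
    using \<rho> loss_pos by (simp add: gain_def less_divide_eq)
  ultimately have excess: "\<forall>\<^sub>F n in sequentially.
      0 < (1 - (cutoff / r)^2 + D / (r * (2 * real n)))^2 - \<rho> * (loss r + E / (r * (2 * real n)))"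
    by (rule order_tendstoD(1))
  have "\<forall>\<^sub>F n in sequentially. 0 < loss r + E / (r * (2 * real n))"
    using lim loss_pos by (rule order_tendstoD(1))
  with excess show ?thesis using eventually_ge_at_top[of "nat (q * a1 + vector_bound s + \<bar>l1\<bar> + 1)"]
  proof eventually_elim
    case (elim n)
    let ?L = "loss r + E / (r * (2 * real n))" and ?M = "1 - (cutoff / r)^2 + D / (r * (2 * real n))"
      and ?Q = "real_of_int (q * a1) * (r * (r * (2 * real n)))^2"
    have "q * a1 + vector_bound s + \<bar>l1\<bar> + 1 \<le> 2 * int n" using elim(3) by linarith
    then have "?Q * ?M^2 \<le> card (F ` scaled_box s (2 * int n)) * ?L"
      using card_scaled_values_lower[OF s, of "2 * int n"] by (simp add: r_def D_def E_def)
    moreover have "?Q * (\<rho> * ?L) \<le> ?Q * ?M^2"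
      using elim(1) qa1_pos by (intro mult_left_mono) (simp_all del: of_int_mult)
    ultimately have "(\<rho> * ?Q) * ?L \<le> card (F ` scaled_box s (2 * int n)) * ?L"
      by (simp only: mult_ac)
    then show ?case using elim(2) by (rule mult_right_le_imp_le)
  qed
qed

lemma scaled_box_value_bounds:
  assumes Y: "\<bar>l1\<bar> + \<bar>l2\<bar> + \<bar>l3\<bar> < s * h" and u: "u \<in> scaled_box s h"
  shows "0 < F u" "F u \<le> q * a1 * (s * (s * h))^2 + \<bar>l1\<bar> * (s * (s * h)) + (\<bar>l2\<bar> + \<bar>l3\<bar>) * (s * h)
    + q * a1 * cutoff * (s * h)^2"
proof -
  obtain u1 u2 u3 where u_eq: "u = (u1, u2, u3)" by (metis surj_pair)
  have mem: "cutoff * (s * h) < u1" "u1 \<le> s * (s * h)" "u2 \<in> {1..s * h}" "u3 \<in> {1..s * h}"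
    using u by (auto simp: u_eq scaled_box_def)
  then show "0 < F u" unfolding u_eq by (intro F_pos[OF Y])
  have "0 < s * h" using Y by simp
  then have "0 \<le> cutoff * (s * h)" using cutoff_pos by simp
  then have "F u \<le> q * a1 * (s * (s * h))^2 + \<bar>l1\<bar> * (s * (s * h)) + (\<bar>l2\<bar> + \<bar>l3\<bar>) * (s * h)
      + q * (cutoff - 1) * (s * h)^2"
    unfolding u_eq using mem by (intro F_le) auto
  moreover have "q * 1 \<le> q * a1" using q_pos a1_pos by (intro mult_left_mono) auto
  then have "q * (cutoff - 1) * (s * h)^2 \<le> q * a1 * cutoff * (s * h)^2"
    using q_pos cutoff_pos by (intro mult_right_mono mult_mono) auto
  ultimately show "F u \<le> q * a1 * (s * (s * h))^2 + \<bar>l1\<bar> * (s * (s * h)) + (\<bar>l2\<bar> + \<bar>l3\<bar>) * (s * h)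
    + q * a1 * cutoff * (s * h)^2" by linarith
qed

lemma eventually_scaled_values_bounded:
  fixes s :: int and r w :: real
  defines "r \<equiv> real_of_int s"
  assumes s: "4 \<le> s" and w: "spread r < w"
  shows "\<forall>\<^sub>F n in sequentially. \<forall>N. w * (real_of_int (q * a1) * (r * (r * (2 * real n)))^2) \<le> real N \<longrightarrow>
    F ` scaled_box s (2 * int n) \<subseteq> {1..int N}"
proof -
  define A where "A = real_of_int (q * a1)"
  define G where "G = (\<bar>real_of_int l1\<bar> * r + \<bar>real_of_int l2\<bar> + \<bar>real_of_int l3\<bar>) / (A * r^2)"
  have A: "A > 0" using qa1_pos by (simp only: A_def of_int_0_less_iff)
  have r: "r > 0" using s by (simp add: r_def)
  have "(\<lambda>n. spread r + G / (r * (2 * real n))) \<longlonglongrightarrow> spread r" using r by real_asymp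
  then have "\<forall>\<^sub>F n in sequentially. spread r + G / (r * (2 * real n)) < w"
    using w by (rule order_tendstoD(2))
  then show ?thesis using eventually_ge_at_top[of "nat (\<bar>l1\<bar> + \<bar>l2\<bar> + \<bar>l3\<bar> + 1)"]
  proof eventually_elim
    case (elim n)
    define y where "y = r * (2 * real n)"
    have "1 * (2 * int n) \<le> s * (2 * int n)" using s by (intro mult_right_mono) auto
    then have Y: "\<bar>l1\<bar> + \<bar>l2\<bar> + \<bar>l3\<bar> < s * (2 * int n)" using elim(2) by linarith
    have y: "y > 0" using elim(2) r by (simp add: y_def)
    show ?case
    proof (intro allI impI image_subsetI)
      fix N u
      assume N: "w * (real_of_int (q * a1) * (r * (r * (2 * real n)))^2) \<le> real N"
        and u: "u \<in> scaled_box s (2 * int n)"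
      have "real_of_int (F u) \<le> A * (r * y)^2 + \<bar>real_of_int l1\<bar> * (r * y)
          + (\<bar>real_of_int l2\<bar> + \<bar>real_of_int l3\<bar>) * y + A * cutoff * y^2"
        using scaled_box_value_bounds(2)[OF Y u, THEN of_int_le_iff[where 'a = real, THEN iffD2]]
        by (simp add: A_def y_def r_def)
      also have "\<dots> = (spread r + G / y) * (A * (r * y)^2)"
        using A r y by (simp add: G_def spread_def field_simps power2_eq_square)
      also have "\<dots> \<le> w * (A * (r * y)^2)" using elim(1) A by (intro mult_right_mono) (auto simp: y_def)
      also have "\<dots> \<le> real N" using N by (simp only: A_def y_def)
      finally show "F u \<in> {1..int N}" using scaled_box_value_bounds(1)[OF Y u] by simp
    qed
  qed
qed

lemma eventually_card_values_ge:
  fixes s :: int and \<rho> w c :: real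
  assumes s: "4 \<le> s" "cutoff < s" and \<rho>: "\<rho> < gain s" and w: "spread s < w" and c: "c < \<rho> / w"
  shows "\<forall>\<^sub>F N in sequentially. c * real N \<le> card (range F \<inter> {1..int N})"
proof -
  define B where "B = real_of_int (q * a1) * (real_of_int s * (real_of_int s * 2))^2"
  have "B > 0" using qa1_pos s(1) by (simp add: B_def del: of_int_mult)
  have "0 \<le> cutoff / (real_of_int s)^2" using cutoff_pos by simp
  then have "w > 0" using w by (simp add: spread_def)
  have square: "real_of_int (q * a1) * (real_of_int s * (real_of_int s * (2 * real n)))^2
    = B * (real n)^2" for n
    by (simp add: B_def power_mult_distrib)
  have "\<forall>\<^sub>F n in sequentially. \<forall>N. (w * B) * (real n)^2 \<le> real N \<longrightarrow>
      (\<rho> * B) * (real n)^2 \<le> card (range F \<inter> {1..int N})"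
    using eventually_card_scaled_values_ge[OF s \<rho>] eventually_scaled_values_bounded[OF s(1) w]
    unfolding square
  proof eventually_elim
    case (elim n)
    show ?case
    proof (intro allI impI)
      fix N assume "(w * B) * (real n)^2 \<le> real N"
      then have "F ` scaled_box s (2 * int n) \<subseteq> {1..int N}" using elim(2) by (simp add: mult.assoc)
      then have "card (F ` scaled_box s (2 * int n)) \<le> card (range F \<inter> {1..int N})"
        by (intro card_mono) auto
      then show "(\<rho> * B) * (real n)^2 \<le> card (range F \<inter> {1..int N})"
        using elim(1) unfolding mult.assoc by linarith
    qed
  qed
  moreover have "w * B > 0" "c < (\<rho> * B) / (w * B)" using \<open>B > 0\<close> \<open>w > 0\<close> c by simp_all
  ultimately show ?thesis by (rule eventually_le_if_quadratic[rotated 2])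
qed

theorem lower_density_values: "lower_density_ge (range F) (1 / (1 + 768 / P))"
proof (rule lower_density_geI)
  fix c :: real assume c: "0 < c" "c < 1 / (1 + 768 / P)"
  have "(\<lambda>s. cutoff / (real s)^2) \<longlonglongrightarrow> 0" by real_asymp
  then have "(\<lambda>s. gain (real s) - c * spread (real s))
    \<longlonglongrightarrow> (1 - 0^2)^2 / ((1 + 0)^2 + 768 / P + 0) - c * (1 + 0)"
    unfolding gain_def loss_def spread_def
    by (intro tendsto_intros lim_const_over_n) (auto simp: add_nonneg_eq_0_iff)
  then have "\<forall>\<^sub>F s in sequentially. 0 < gain (real s) - c * spread (real s)"
    by (rule order_tendstoD(1)) (use c in simp)
  then have "\<forall>\<^sub>F s in sequentially. 0 < gain (real s) - c * spread (real s) \<and> 4 \<le> s \<and> nat cutoff < s"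
    by (intro eventually_conj eventually_ge_at_top eventually_gt_at_top)
  then obtain s where "0 < gain (real s) - c * spread (real s) \<and> 4 \<le> s \<and> nat cutoff < s"
    using eventually_happens'[OF sequentially_bot] by blast
  then have s: "c * spread (real s) < gain (real s)" "4 \<le> int s" "cutoff < int s" by auto
  obtain \<rho> where \<rho>: "c * spread (real s) < \<rho>" "\<rho> < gain (real s)" using dense[OF s(1)] by blast
  then have "spread (real s) < \<rho> / c" using c by (simp add: less_divide_eq mult.commute)
  then obtain w where w: "spread (real s) < w" "w < \<rho> / c" using dense by blast
  have "0 \<le> cutoff / (real s)^2" using cutoff_pos by simp
  then have "0 < w" using w(1) by (simp add: spread_def)
  then have "c < \<rho> / w" using w c by (simp add: field_simps)
  then show "\<forall>\<^sub>F N in sequentially. c * real N \<le> card (range F \<inter> {1..int N})"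
    using eventually_card_values_ge[of "int s" \<rho> w c] s \<rho> w by simp
qed

end

section \<open>Legendre descent and a missed residue class\<close>

definition isotropic :: "int \<Rightarrow> int \<Rightarrow> int \<Rightarrow> bool" where
  "isotropic a b c \<longleftrightarrow> (\<exists>x y z. (x, y, z) \<noteq> (0, 0, 0) \<and> a * x^2 + b * y^2 + c * z^2 = 0)"

definition anisotropic_mod :: "int \<Rightarrow> nat \<Rightarrow> int \<Rightarrow> int \<Rightarrow> int \<Rightarrow> bool" where
  "anisotropic_mod p k a b c \<longleftrightarrow>
     (\<forall>x y z. p ^ k dvd a * x^2 + b * y^2 + c * z^2 \<longrightarrow> p dvd x \<and> p dvd y \<and> p dvd z)"

definition everywhere_isotropic :: "int \<Rightarrow> int \<Rightarrow> int \<Rightarrow> bool" where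
  "everywhere_isotropic a b c \<longleftrightarrow> (\<forall>p k. prime p \<longrightarrow> \<not> anisotropic_mod p k a b c)"

lemma anisotropic_mod_rotate: "anisotropic_mod p k a b c \<Longrightarrow> anisotropic_mod p k b c a"
  unfolding anisotropic_mod_def by (metis add.commute add.left_commute)

lemma anisotropic_mod_power_dvd:
  assumes p: "p > 0" and an: "anisotropic_mod p k a b c"
    and dvd: "p ^ (k + 2 * i) dvd a * x^2 + b * y^2 + c * z^2"
  shows "p ^ Suc i dvd x \<and> p ^ Suc i dvd y \<and> p ^ Suc i dvd z"
  using dvd
proof (induction i arbitrary: x y z)
  case 0
  then show ?case using an by (simp add: anisotropic_mod_def)
next
  case (Suc i)
  have "p ^ k dvd a * x^2 + b * y^2 + c * z^2"
    using Suc.prems by (rule dvd_trans[OF le_imp_power_dvd, rotated]) simp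
  then obtain x' y' z' where v: "x = p * x'" "y = p * y'" "z = p * z'"
    using an unfolding anisotropic_mod_def by blast
  have "a * x^2 + b * y^2 + c * z^2 = p^2 * (a * x'^2 + b * y'^2 + c * z'^2)"
    by (simp add: v power_mult_distrib algebra_simps)
  moreover have "p ^ (k + 2 * Suc i) = p^2 * p ^ (k + 2 * i)" by (simp flip: power_add)
  ultimately have "p^2 * p ^ (k + 2 * i) dvd p^2 * (a * x'^2 + b * y'^2 + c * z'^2)"
    using Suc.prems by (simp only:)
  then have "p ^ (k + 2 * i) dvd a * x'^2 + b * y'^2 + c * z'^2" using p by simp
  from Suc.IH[OF this] show ?case by (simp add: v)
qed

lemma power_Suc_multiplicity_not_dvd:
  fixes p m :: int
  assumes "prime p" "m \<noteq> 0"
  shows "\<not> p ^ Suc (multiplicity p m) dvd m"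
  using assms by (subst power_dvd_iff_le_multiplicity) (auto simp: not_prime_unit)

text \<open>
  The map \<open>(X, Y, Z)\<close> multiplies the values of the form and adds at most the factor \<open>m\<close> to common
  divisors of the coordinates; for \<open>d = 0\<close> the last clause says that only \<open>0\<close> is mapped to \<open>0\<close>.
\<close>

definition carried_into :: "int \<Rightarrow> int \<Rightarrow> int \<Rightarrow> int \<Rightarrow> int \<Rightarrow> int \<Rightarrow> bool" where
  "carried_into a b c a' b' c' \<longleftrightarrow> (\<exists>m X Y Z. m \<noteq> 0 \<and>
     (\<forall>x y z. a * x^2 + b * y^2 + c * z^2 dvd a' * X x y z ^ 2 + b' * Y x y z ^ 2 + c' * Z x y z ^ 2) \<and>
     (\<forall>x y z d. d dvd X x y z \<and> d dvd Y x y z \<and> d dvd Z x y z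
       \<longrightarrow> d dvd m * x \<and> d dvd m * y \<and> d dvd m * z))"

lemma carried_intoI:
  fixes m :: int and X Y Z :: "int \<Rightarrow> int \<Rightarrow> int \<Rightarrow> int"
  assumes "m \<noteq> 0"
    and "\<And>x y z. a * x^2 + b * y^2 + c * z^2 dvd a' * X x y z ^ 2 + b' * Y x y z ^ 2 + c' * Z x y z ^ 2"
    and "\<And>x y z d. d dvd X x y z \<Longrightarrow> d dvd Y x y z \<Longrightarrow> d dvd Z x y z
      \<Longrightarrow> d dvd m * x \<and> d dvd m * y \<and> d dvd m * z"
  shows "carried_into a b c a' b' c'"
  unfolding carried_into_def
  by (rule exI[of _ m], rule exI[of _ X], rule exI[of _ Y], rule exI[of _ Z]) (use assms in blast)

lemma carried_intoE:
  assumes "carried_into a b c a' b' c'"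
  obtains m X Y Z where "m \<noteq> 0"
    "\<And>x y z. a * x^2 + b * y^2 + c * z^2 dvd a' * X x y z ^ 2 + b' * Y x y z ^ 2 + c' * Z x y z ^ 2"
    "\<And>x y z d. d dvd X x y z \<Longrightarrow> d dvd Y x y z \<Longrightarrow> d dvd Z x y z \<Longrightarrow> d dvd m * x \<and> d dvd m * y \<and> d dvd m * z"
proof -
  from assms obtain m X Y Z where "m \<noteq> 0 \<and>
     (\<forall>x y z. a * x^2 + b * y^2 + c * z^2 dvd a' * X x y z ^ 2 + b' * Y x y z ^ 2 + c' * Z x y z ^ 2) \<and>
     (\<forall>x y z d. d dvd X x y z \<and> d dvd Y x y z \<and> d dvd Z x y z
       \<longrightarrow> d dvd m * x \<and> d dvd m * y \<and> d dvd m * z)"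
    unfolding carried_into_def by (elim exE) (rule that)
  then show thesis by (intro that[of m X Y Z]) simp_all
qed

lemma isotropic_if_carried_into:
  assumes "carried_into a b c a' b' c'" "isotropic a b c"
  shows "isotropic a' b' c'"
  using assms(1)
proof (rule carried_intoE)
  fix m X Y Z assume m: "m \<noteq> 0"
    and image: "\<And>x y z. a * x^2 + b * y^2 + c * z^2
      dvd a' * X x y z ^ 2 + b' * Y x y z ^ 2 + c' * Z x y z ^ 2"
    and divisors: "\<And>x y z d. d dvd X x y z \<Longrightarrow> d dvd Y x y z \<Longrightarrow> d dvd Z x y z
      \<Longrightarrow> d dvd m * x \<and> d dvd m * y \<and> d dvd m * z"
  obtain x y z where v: "(x, y, z) \<noteq> (0, 0, 0)" "a * x^2 + b * y^2 + c * z^2 = 0"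
    using assms(2) unfolding isotropic_def by blast
  have "a' * X x y z ^ 2 + b' * Y x y z ^ 2 + c' * Z x y z ^ 2 = 0"
    using image[of x y z] unfolding v(2) by simp
  moreover have "(X x y z, Y x y z, Z x y z) \<noteq> (0, 0, 0)" using divisors[of 0 x y z] v(1) m by auto
  ultimately show ?thesis unfolding isotropic_def by blast
qed

lemma everywhere_isotropic_if_carried_into:
  assumes "carried_into a b c a' b' c'" "everywhere_isotropic a b c"
  shows "everywhere_isotropic a' b' c'"
  using assms(1)
proof (rule carried_intoE)
  fix m X Y Z assume m: "m \<noteq> 0"
    and image: "\<And>x y z. a * x^2 + b * y^2 + c * z^2
      dvd a' * X x y z ^ 2 + b' * Y x y z ^ 2 + c' * Z x y z ^ 2"
    and divisors: "\<And>x y z d. d dvd X x y z \<Longrightarrow> d dvd Y x y z \<Longrightarrow> d dvd Z x y z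
      \<Longrightarrow> d dvd m * x \<and> d dvd m * y \<and> d dvd m * z"
  have False if p: "prime p" and an: "anisotropic_mod p k a' b' c'" for p k
  proof -
    define i where "i = multiplicity p m"
    obtain x y z where v: "p ^ (k + 2 * i) dvd a * x^2 + b * y^2 + c * z^2"
      and primitive: "\<not> (p dvd x \<and> p dvd y \<and> p dvd z)"
      using assms(2) p unfolding everywhere_isotropic_def anisotropic_mod_def by blast
    have "p ^ Suc i dvd X x y z \<and> p ^ Suc i dvd Y x y z \<and> p ^ Suc i dvd Z x y z"
      using prime_gt_0_int[OF p] an dvd_trans[OF v image] by (rule anisotropic_mod_power_dvd)
    then have "p ^ Suc i dvd m * x" "p ^ Suc i dvd m * y" "p ^ Suc i dvd m * z"
      using divisors by blast+
    moreover have "p ^ Suc i dvd m" if "p ^ Suc i dvd m * w" "\<not> p dvd w" for w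
    proof -
      have "coprime (p ^ Suc i) w"
        using prime_imp_coprime[OF p that(2)] by simp
      then show ?thesis using that(1) by (simp only: coprime_dvd_mult_left_iff)
    qed
    ultimately have "p ^ Suc i dvd m" using primitive by blast
    then show False using power_Suc_multiplicity_not_dvd[OF p m] by (simp add: i_def)
  qed
  then show ?thesis unfolding everywhere_isotropic_def by blast
qed

text \<open>The form \<open>z\<^sup>2 - a x\<^sup>2 - b y\<^sup>2\<close> attached to the symbol \<open>(a, b)\<close>.\<close>

definition conic_equivalent :: "int \<Rightarrow> int \<Rightarrow> int \<Rightarrow> int \<Rightarrow> bool" where
  "conic_equivalent a b a' b' \<longleftrightarrow>
     carried_into (- a) (- b) 1 (- a') (- b') 1 \<and> carried_into (- a') (- b') 1 (- a) (- b) 1"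

lemma conic_equivalent_iff:
  assumes "conic_equivalent a b a' b'"
  shows "isotropic (- a) (- b) 1 \<longleftrightarrow> isotropic (- a') (- b') 1"
    "everywhere_isotropic (- a) (- b) 1 \<longleftrightarrow> everywhere_isotropic (- a') (- b') 1"
  using assms isotropic_if_carried_into everywhere_isotropic_if_carried_into
  unfolding conic_equivalent_def by blast+

lemma conic_equivalent_swap: "conic_equivalent a b b a"
proof -
  have "carried_into (- a) (- b) 1 (- b) (- a) 1" for a b
    by (rule carried_intoI[where m = 1 and X = "\<lambda>x y z. y" and Y = "\<lambda>x y z. x" and Z = "\<lambda>x y z. z"])
      (simp_all add: algebra_simps)
  then show ?thesis by (simp only: conic_equivalent_def simp_thms)
qed

lemma conic_equivalent_square_factor:
  assumes "r \<noteq> 0"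
  shows "conic_equivalent a (r^2 * b) a b"
  unfolding conic_equivalent_def
proof
  show "carried_into (- a) (- (r^2 * b)) 1 (- a) (- b) 1"
    by (rule carried_intoI[where m = r and X = "\<lambda>x y z. x" and Y = "\<lambda>x y z. r * y" and Z = "\<lambda>x y z. z"])
      (use assms in \<open>simp_all add: power_mult_distrib mult_ac\<close>)
  have "- a * (r * x)^2 + - (r^2 * b) * y^2 + 1 * (r * z)^2
    = (- a * x^2 + - b * y^2 + 1 * z^2) * r^2" for x y z
    by (simp add: power_mult_distrib algebra_simps)
  then show "carried_into (- a) (- b) 1 (- a) (- (r^2 * b)) 1"
    by (intro carried_intoI[where m = r and X = "\<lambda>x y z. r * x" and Y = "\<lambda>x y z. y"
      and Z = "\<lambda>x y z. r * z"])
      (use assms in simp_all)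
qed

text \<open>If \<open>t\<^sup>2 - a = b b'\<close>, then \<open>b b'\<close> is a norm from \<open>\<rat>(\<surd>a)\<close>, so \<open>b\<close> and \<open>b'\<close> are interchangeable.\<close>

lemma conic_equivalent_norm:
  assumes "t^2 - a = b * b'" "b \<noteq> 0" "b' \<noteq> 0"
  shows "conic_equivalent a b a b'"
proof -
  have "carried_into (- a) (- b) 1 (- a) (- b') 1"
    if t: "t^2 - a = b * b'" "b \<noteq> 0" "b' \<noteq> 0" for b b'
  proof (rule carried_intoI)
    show "b * b' \<noteq> 0" using that by simp
    fix x y z :: int
    have "- a * (t * x + z)^2 + - b' * (b * y)^2 + 1 * (t * z + a * x)^2
      = (- a * x^2 + - b * y^2 + 1 * z^2) * (b * b')"
      using t(1) by algebra
    then show "- a * x^2 + - b * y^2 + 1 * z^2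
      dvd - a * (t * x + z)^2 + - b' * (b * y)^2 + 1 * (t * z + a * x)^2"
      by simp
    fix d assume d: "d dvd t * x + z" "d dvd b * y" "d dvd t * z + a * x"
    have "b * b' * x = t * (t * x + z) - (t * z + a * x)"
      "b * b' * z = t * (t * z + a * x) - a * (t * x + z)"
      unfolding t(1)[symmetric] by (simp_all add: power2_eq_square algebra_simps)
    moreover have "b * b' * y = b' * (b * y)" by simp
    ultimately show "d dvd b * b' * x \<and> d dvd b * b' * y \<and> d dvd b * b' * z"
      using d by (simp only: dvd_diff dvd_mult)
  qed
  from this[OF assms] this[of b' b] show ?thesis
    using assms by (simp add: conic_equivalent_def mult.commute)
qed

lemma square_residue_at_prime:
  fixes p a b :: int
  assumes p: "prime p" and iso: "\<not> anisotropic_mod p 2 (- a) (- b) 1" and b: "p dvd b" "\<not> p^2 dvd b"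
  shows "\<exists>t. [t^2 = a] (mod p)"
proof -
  obtain x y z where v: "p^2 dvd - a * x^2 + - b * y^2 + 1 * z^2" "\<not> (p dvd x \<and> p dvd y \<and> p dvd z)"
    using iso unfolding anisotropic_mod_def by blast
  obtain b' where b': "b = p * b'" "\<not> p dvd b'" using b by (auto simp: power2_eq_square)
  have "p dvd p^2" by simp
  then have "p dvd - a * x^2 + - b * y^2 + 1 * z^2" using v(1) by (rule dvd_trans)
  then have "p dvd (- a * x^2 + - b * y^2 + 1 * z^2) + b * y^2" by (rule dvd_add) (use b(1) in simp)
  then have zx: "p dvd z^2 - a * x^2" by simp
  have "\<not> p dvd x"
  proof
    assume x: "p dvd x"
    then have "p dvd (z^2 - a * x^2) + a * x^2"
      using zx by (intro dvd_add) (auto simp: power2_eq_square)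
    then have z: "p dvd z" using p by (simp add: prime_dvd_power_iff)
    have "p^2 dvd z^2" "p^2 dvd a * x^2" using x z by (auto intro: dvd_mult)
    then have "p^2 dvd z^2 - a * x^2 - (- a * x^2 + - b * y^2 + 1 * z^2)" using v(1) by (intro dvd_diff)
    then have "p * p dvd p * (b' * y^2)" by (simp add: b'(1) power2_eq_square mult.assoc)
    then have "p dvd b' * y^2" using p by simp
    then have "p dvd y" using p b'(2) by (simp add: prime_dvd_mult_iff prime_dvd_power_iff)
    then show False using v(2) x z by simp
  qed
  then have "coprime x p" using p by (metis coprime_commute prime_imp_coprime)
  then obtain u where u: "[x * u = 1] (mod p)" using cong_solve_coprime_int by blast
  have "[(z * u)^2 = a * (x * u)^2] (mod p)"
    using cong_scalar_right[of "z^2" "a * x^2" p "u^2"] zx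
    by (simp add: cong_iff_dvd_diff power_mult_distrib mult.assoc)
  also have "[a * (x * u)^2 = a * 1^2] (mod p)" by (intro cong_scalar_left cong_pow u)
  finally show ?thesis by (auto intro: exI[of _ "z * u"])
qed

lemma square_residue_squarefree:
  fixes a b :: int
  assumes "squarefree b" "b \<noteq> 0" "\<And>p. prime p \<Longrightarrow> p dvd b \<Longrightarrow> \<exists>t. [t^2 = a] (mod p)"
  shows "\<exists>t. [t^2 = a] (mod b)"
  using assms
proof (induction b rule: prime_divisors_induct)
  case (unit b)
  then show ?case by (meson cong_iff_dvd_diff unit_imp_dvd)
next
  case (factor p b)
  obtain s where s: "[s^2 = a] (mod p)" using factor.prems(3)[OF factor.hyps(1)] by auto
  obtain t where t: "[t^2 = a] (mod b)"
    using factor.IH factor.prems squarefree_multD(2)[OF factor.prems(1)] by auto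
  have "\<not> p dvd b"
  proof
    assume "p dvd b"
    then have "p^2 dvd p * b" by (simp add: power2_eq_square)
    then show False using squarefreeD[OF factor.prems(1)] factor.hyps by (metis not_prime_unit)
  qed
  then have coprime: "coprime p b" using factor.hyps by (simp add: prime_imp_coprime)
  then obtain r where "[r = s] (mod p)" "[r = t] (mod b)" using binary_chinese_remainder_int by blast
  then have "[r^2 = a] (mod p)" "[r^2 = a] (mod b)" using s t by (metis cong_pow cong_trans)+
  then have "[r^2 = a] (mod p * b)" using coprime by (rule coprime_cong_mult)
  then show ?case by blast
qed simp

lemma absolutely_least_residue:
  fixes b t :: int
  assumes "b \<noteq> 0"
  shows "\<exists>t'. [t' = t] (mod b) \<and> 2 * \<bar>t'\<bar> \<le> \<bar>b\<bar>"
proof -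
  define r where "r = t mod \<bar>b\<bar>"
  have r: "0 \<le> r" "r < \<bar>b\<bar>" using assms by (auto simp: r_def)
  have "\<bar>b\<bar> dvd r - t" unfolding r_def by (metis dvd_minus_mod dvd_diff_commute)
  then have "b dvd r - t" "b dvd (r - t) - \<bar>b\<bar>" by (simp_all add: dvd_diff)
  moreover have "(r - t) - \<bar>b\<bar> = (r - \<bar>b\<bar>) - t" by simp
  ultimately have "[r = t] (mod b)" "[r - \<bar>b\<bar> = t] (mod b)" by (simp_all only: cong_iff_dvd_diff)
  then show ?thesis using r by (cases "2 * r \<le> \<bar>b\<bar>") (auto intro: exI[of _ r] exI[of _ "r - \<bar>b\<bar>"])
qed

lemma four_dvd_three_squares:
  fixes x y z :: int
  assumes "4 dvd x^2 + y^2 + z^2"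
  shows "even x \<and> even y \<and> even z"
proof -
  have "\<exists>k. w^2 = 4 * k + of_bool (odd w)" for w :: int
  proof (cases "even w")
    case True
    then show ?thesis by (auto simp: power_mult_distrib elim: evenE)
  next
    case False
    then obtain u where "w = 2 * u + 1" by (rule oddE)
    then have "w^2 = 4 * (u^2 + u) + of_bool (odd w)" by (simp add: power2_eq_square algebra_simps)
    then show ?thesis ..
  qed
  then obtain k :: "int \<Rightarrow> int" where "\<And>w. w^2 = 4 * k w + of_bool (odd w)" by metis
  then have "4 dvd 4 * (k x + k y + k z) + (of_bool (odd x) + of_bool (odd y) + of_bool (odd z))"
    using assms by (simp add: algebra_simps)
  then have "4 dvd of_bool (odd x) + of_bool (odd y) + (of_bool (odd z) :: int)"
    by (simp only: dvd_add_right_iff dvd_triv_left)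
  then show ?thesis by (auto simp: of_bool_def split: if_splits)
qed

lemma isotropic_units:
  assumes "\<bar>a\<bar> = 1" "\<bar>b\<bar> = 1" and iso: "everywhere_isotropic (- a) (- b) 1"
  shows "isotropic (- a) (- b) 1"
proof -
  consider "a = 1" | "b = 1" | "a = - 1" "b = - 1" using assms(1,2) by linarith
  then show ?thesis
  proof cases
    case 1
    then show ?thesis unfolding isotropic_def by (intro exI[of _ 1] exI[of _ 0] exI[of _ 1]) simp
  next
    case 2
    then show ?thesis unfolding isotropic_def by (intro exI[of _ 0] exI[of _ 1] exI[of _ 1]) simp
  next
    case 3
    have "anisotropic_mod 2 2 1 1 1" using four_dvd_three_squares by (simp add: anisotropic_mod_def)
    moreover have "prime (2 :: int)" by simp
    ultimately show ?thesis using iso 3 by (auto simp: everywhere_isotropic_def)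
  qed
qed

lemma square_residue_if_everywhere_isotropic:
  assumes "squarefree b" "b \<noteq> 0" "everywhere_isotropic (- a) (- b) 1"
  shows "\<exists>t. [t^2 = a] (mod b)"
proof (rule square_residue_squarefree[OF assms(1,2)])
  fix p assume p: "prime p" "p dvd b"
  have "\<not> p^2 dvd b" using squarefreeD[OF assms(1)] p(1) by (metis not_prime_unit)
  then show "\<exists>t. [t^2 = a] (mod p)"
    using assms(3) square_residue_at_prime[of p a b] p by (simp add: everywhere_isotropic_def)
qed

lemma conic_equivalent_smaller:
  assumes "a \<noteq> 0" "b \<noteq> 0" "\<bar>a\<bar> \<le> \<bar>b\<bar>" "2 \<le> \<bar>b\<bar>"
    and iso: "everywhere_isotropic (- a) (- b) 1" and not_iso: "\<not> isotropic (- a) (- b) 1"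
  shows "\<exists>b'. b' \<noteq> 0 \<and> \<bar>b'\<bar> < \<bar>b\<bar> \<and> conic_equivalent a b a b'"
proof (cases "squarefree b")
  case False
  then obtain r b' where r: "b = r^2 * b'" "\<not> is_unit r" by (auto simp: squarefree_def)
  have "r \<noteq> 0" "b' \<noteq> 0" using assms(2) r(1) by auto
  then have "2 \<le> \<bar>r\<bar>" using r(2) by (auto simp: zdvd1_eq)
  then have "2^2 \<le> \<bar>r\<bar>^2" by (intro power_mono) auto
  then have "4 * \<bar>b'\<bar> \<le> \<bar>b\<bar>" by (simp add: r(1) abs_mult mult_right_mono)
  then have "\<bar>b'\<bar> < \<bar>b\<bar>" using \<open>b' \<noteq> 0\<close> by linarith
  then show ?thesis
    using conic_equivalent_square_factor[OF \<open>r \<noteq> 0\<close>] \<open>b' \<noteq> 0\<close> r(1) by blast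
next
  case True
  then obtain t0 where "[t0^2 = a] (mod b)"
    using square_residue_if_everywhere_isotropic assms(2) iso by blast
  moreover obtain t where t: "[t = t0] (mod b)" "2 * \<bar>t\<bar> \<le> \<bar>b\<bar>"
    using absolutely_least_residue[OF assms(2)] by blast
  ultimately have "[t^2 = a] (mod b)" by (metis cong_pow cong_trans)
  then obtain b' where b': "t^2 - a = b * b'" by (auto simp: cong_iff_dvd_diff)
  have "b' \<noteq> 0"
  proof
    assume "b' = 0"
    then have "- a * 1^2 + - b * 0^2 + 1 * t^2 = 0" using b' by simp
    moreover have "(1, 0, t) \<noteq> (0 :: int, 0 :: int, 0 :: int)" by simp
    ultimately show False using not_iso unfolding isotropic_def by blast
  qed
  have "4 * (\<bar>b\<bar> * \<bar>b'\<bar>) = 4 * \<bar>t^2 - a\<bar>" by (simp add: b' abs_mult)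
  also have "\<dots> \<le> (2 * \<bar>t\<bar>)^2 + 4 * \<bar>a\<bar>"
    using abs_triangle_ineq4[of "t^2" a] by (simp add: power_mult_distrib)
  also have "\<dots> \<le> \<bar>b\<bar>^2 + 4 * \<bar>b\<bar>" using t(2) assms(3) by (intro add_mono power_mono) auto
  finally have "\<bar>b\<bar> * (4 * \<bar>b'\<bar>) \<le> \<bar>b\<bar> * (\<bar>b\<bar> + 4)" by (simp add: power2_eq_square algebra_simps)
  then have "4 * \<bar>b'\<bar> \<le> \<bar>b\<bar> + 4" using assms(2) by simp
  then have "\<bar>b'\<bar> < \<bar>b\<bar>" using assms(4) by linarith
  then show ?thesis using conic_equivalent_norm[OF b' assms(2) \<open>b' \<noteq> 0\<close>] \<open>b' \<noteq> 0\<close> by blast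
qed

lemma anisotropic_conic_descent:
  assumes "a \<noteq> 0" "b \<noteq> 0" "everywhere_isotropic (- a) (- b) 1" "\<not> isotropic (- a) (- b) 1"
  shows "\<exists>a' b'. a' \<noteq> 0 \<and> b' \<noteq> 0 \<and> \<bar>a'\<bar> + \<bar>b'\<bar> < \<bar>a\<bar> + \<bar>b\<bar>
    \<and> everywhere_isotropic (- a') (- b') 1 \<and> \<not> isotropic (- a') (- b') 1"
proof -
  have descend: "\<exists>b'. b' \<noteq> 0 \<and> \<bar>b'\<bar> < \<bar>b\<bar>
      \<and> everywhere_isotropic (- a) (- b') 1 \<and> \<not> isotropic (- a) (- b') 1"
    if "\<bar>a\<bar> \<le> \<bar>b\<bar>" "a \<noteq> 0" "b \<noteq> 0" "everywhere_isotropic (- a) (- b) 1" "\<not> isotropic (- a) (- b) 1"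
    for a b
  proof -
    have "\<not> (\<bar>a\<bar> = 1 \<and> \<bar>b\<bar> = 1)" using isotropic_units that(4,5) by blast
    then have "2 \<le> \<bar>b\<bar>" using that(1-3) by linarith
    then show ?thesis
      using conic_equivalent_smaller[OF that(2,3,1) _ that(4,5)] conic_equivalent_iff that(4,5) by metis
  qed
  consider "\<bar>a\<bar> \<le> \<bar>b\<bar>" | "\<bar>b\<bar> \<le> \<bar>a\<bar>" by linarith
  then show ?thesis
  proof cases
    case 1
    obtain b' where "b' \<noteq> 0" "\<bar>b'\<bar> < \<bar>b\<bar>" "everywhere_isotropic (- a) (- b') 1"
      "\<not> isotropic (- a) (- b') 1"
      using descend[OF 1 assms] by blast
    then show ?thesis using assms(1) by (intro exI[of _ a] exI[of _ b']) simp
  next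
    case 2
    have "everywhere_isotropic (- b) (- a) 1" "\<not> isotropic (- b) (- a) 1"
      using assms(3,4) conic_equivalent_iff[OF conic_equivalent_swap[of a b]] by simp_all
    then obtain a' where "a' \<noteq> 0" "\<bar>a'\<bar> < \<bar>a\<bar>" "everywhere_isotropic (- b) (- a') 1"
      "\<not> isotropic (- b) (- a') 1"
      using descend[OF 2 assms(2,1)] by blast
    then show ?thesis using assms(2) by (intro exI[of _ b] exI[of _ a']) simp
  qed
qed

theorem legendre_descent:
  assumes "a \<noteq> 0" "b \<noteq> 0" "everywhere_isotropic (- a) (- b) 1"
  shows "isotropic (- a) (- b) 1"
  using assms
proof (induction "nat (\<bar>a\<bar> + \<bar>b\<bar>)" arbitrary: a b rule: less_induct)
  case less
  show ?case
  proof (rule ccontr)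
    assume not_iso: "\<not> isotropic (- a) (- b) 1"
    obtain a' b' where smaller: "a' \<noteq> 0" "b' \<noteq> 0" "\<bar>a'\<bar> + \<bar>b'\<bar> < \<bar>a\<bar> + \<bar>b\<bar>"
        "everywhere_isotropic (- a') (- b') 1" "\<not> isotropic (- a') (- b') 1"
      using anisotropic_conic_descent[OF less.prems not_iso] by blast
    then have "isotropic (- a') (- b') 1" by (intro less.hyps) auto
    then show False using smaller(5) by contradiction
  qed
qed

corollary anisotropic_mod_some_prime_power:
  assumes nz: "a \<noteq> 0" "b \<noteq> 0" "c \<noteq> 0" and an: "\<not> isotropic a b c"
  obtains p k where "prime p" "anisotropic_mod p k a b c"
proof (rule ccontr)
  assume "\<not> thesis"
  then have "everywhere_isotropic a b c" using that unfolding everywhere_isotropic_def by blast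
  moreover have "carried_into a b c (a * b) (a * c) 1"
  proof (rule carried_intoI[OF nz(1)])
    fix x y z
    have "a * b * y^2 + a * c * z^2 + 1 * (a * x)^2 = (a * x^2 + b * y^2 + c * z^2) * a"
      by (simp add: power2_eq_square algebra_simps)
    then show "a * x^2 + b * y^2 + c * z^2 dvd a * b * y^2 + a * c * z^2 + 1 * (a * x)^2" by simp
  qed simp
  ultimately have "everywhere_isotropic (a * b) (a * c) 1"
    by (rule everywhere_isotropic_if_carried_into[rotated])
  then have "isotropic (a * b) (a * c) 1" using legendre_descent[of "- (a * b)" "- (a * c)"] nz by simp
  moreover have "carried_into (a * b) (a * c) 1 a b c"
  proof (rule carried_intoI[OF nz(1)])
    fix x y z
    have "a * z^2 + b * (a * x)^2 + c * (a * y)^2 = (a * b * x^2 + a * c * y^2 + 1 * z^2) * a"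
      by (simp add: power2_eq_square algebra_simps)
    then show "a * b * x^2 + a * c * y^2 + 1 * z^2 dvd a * z^2 + b * (a * x)^2 + c * (a * y)^2" by simp
  qed simp
  ultimately show False using an isotropic_if_carried_into by blast
qed

text \<open>
  A form that takes the value \<open>- a b c w\<^sup>2\<close> is isotropic; the following identity exhibits the
  isotropic vector, and holds modulo a high power of \<open>p\<close> if the value is only approximated.
\<close>

lemma isotropic_vector_identity:
  fixes a b c w x y z :: int
  shows "a * (b * y^2 + c * z^2)^2 + b * (a * (c * w * z - x * y))^2 + c * (a * (x * z + b * w * y))^2
    = a * (b * y^2 + c * z^2) * (a * x^2 + b * y^2 + c * z^2 + a * b * c * w^2)"
  by algebra

lemma power_dvd_binary_part:
  assumes p: "p > 0" and an: "anisotropic_mod p k a b c"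
    and dvd: "p ^ (k + 2 * i) dvd a * x^2 + b * y^2 + c * z^2 + a * b * c * w^2"
  shows "p ^ Suc i dvd b * y^2 + c * z^2"
proof -
  have "p ^ (k + 2 * i) dvd a * (b * y^2 + c * z^2)^2
    + b * (a * (c * w * z - x * y))^2 + c * (a * (x * z + b * w * y))^2"
    unfolding isotropic_vector_identity using dvd by (rule dvd_mult)
  from anisotropic_mod_power_dvd[OF p an this] show ?thesis by blast
qed

lemma residue_class_missed:
  fixes p a b c w :: int
  assumes p: "prime p" and nz: "a * b * c * w \<noteq> 0" and an: "anisotropic_mod p k a b c"
  obtains K where "\<And>x y z n. a * x^2 + b * y^2 + c * z^2 = w^2 * n \<Longrightarrow> \<not> p ^ K dvd n + a * b * c"
proof
  define m where "m = 2 * w^2 * (a * b * c)"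
  define i where "i = multiplicity p m"
  fix x y z n assume n: "a * x^2 + b * y^2 + c * z^2 = w^2 * n"
  show "\<not> p ^ (k + 2 * i + 1) dvd n + a * b * c"
  proof
    assume dvd: "p ^ (k + 2 * i + 1) dvd n + a * b * c"
    have p_pos: "p > 0" using p prime_gt_0_int by blast
    have "a * x^2 + b * y^2 + c * z^2 + a * b * c * w^2 = w^2 * (n + a * b * c)"
      unfolding n by (simp add: algebra_simps)
    moreover have "p ^ (k + 2 * i) dvd n + a * b * c"
      using dvd by (meson dvd_trans le_imp_power_dvd le_add1)
    ultimately have close: "p ^ (k + 2 * i) dvd a * x^2 + b * y^2 + c * z^2 + a * b * c * w^2" by simp
    have yz: "p ^ Suc i dvd b * y^2 + c * z^2"
      by (rule power_dvd_binary_part[OF p_pos an close])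
    have zx: "p ^ Suc i dvd c * z^2 + a * x^2"
      by (rule power_dvd_binary_part[OF p_pos anisotropic_mod_rotate[OF an], of i y z x w])
        (use close in \<open>simp add: ac_simps\<close>)
    have xy: "p ^ Suc i dvd a * x^2 + b * y^2"
      by (rule power_dvd_binary_part[OF p_pos _, of k c a b i z x y w])
        (use close an in \<open>simp_all add: ac_simps anisotropic_mod_rotate\<close>)
    have "p ^ Suc i dvd (b * y^2 + c * z^2) + (c * z^2 + a * x^2) + (a * x^2 + b * y^2)"
      by (rule dvd_add[OF dvd_add[OF yz zx] xy])
    also have "\<dots> = 2 * w^2 * n" using n by simp
    finally have "p ^ Suc i dvd 2 * w^2 * n" .
    moreover have "p ^ Suc i dvd 2 * w^2 * (n + a * b * c)"
      by (rule dvd_mult[OF dvd_trans[OF le_imp_power_dvd dvd]]) simp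
    ultimately have "p ^ Suc i dvd 2 * w^2 * (n + a * b * c) - 2 * w^2 * n" by (intro dvd_diff)
    then have "p ^ Suc i dvd m" by (simp add: m_def algebra_simps)
    moreover have "m \<noteq> 0" using nz by (simp add: m_def)
    ultimately show False using power_Suc_multiplicity_not_dvd[OF p] by (simp add: i_def)
  qed
qed

section \<open>Orthogonal frames\<close>

definition qform :: "ternary_form \<Rightarrow> int \<times> int \<times> int \<Rightarrow> int" where
  "qform f = (\<lambda>(x, y, z). form_eval f x y z)"

definition polar :: "ternary_form \<Rightarrow> int \<times> int \<times> int \<Rightarrow> int \<times> int \<times> int \<Rightarrow> int" where
  "polar f v w = qform f (v + w) - qform f v - qform f w"

definition scale :: "int \<Rightarrow> int \<times> int \<times> int \<Rightarrow> int \<times> int \<times> int" where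
  "scale k = (\<lambda>(x, y, z). (k * x, k * y, k * z))"

lemma qform_scale: "qform f (scale k v) = k^2 * qform f v"
  by (cases v) (simp add: qform_def scale_def form_eval_def algebra_simps power2_eq_square)

lemma polar_commute: "polar f v w = polar f w v"
  by (simp add: polar_def add.commute)

lemma polar_add_right: "polar f u (v + w) = polar f u v + polar f u w"
  by (cases u; cases v; cases w)
    (simp add: polar_def qform_def form_eval_def algebra_simps power2_eq_square)

lemma polar_scale_right: "polar f v (scale k w) = k * polar f v w"
  by (cases v; cases w)
    (simp add: polar_def qform_def scale_def form_eval_def algebra_simps power2_eq_square)

lemma polar_add_left: "polar f (u + v) w = polar f u w + polar f v w"
  by (metis polar_add_right polar_commute)

lemma polar_scale_left: "polar f (scale k v) w = k * polar f v w"
  by (metis polar_scale_right polar_commute)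

lemma polar_self: "polar f v v = 2 * qform f v"
  by (cases v) (simp add: polar_def qform_def form_eval_def algebra_simps power2_eq_square)

lemma qform_add: "qform f (v + w) = qform f v + qform f w + polar f v w"
  by (simp add: polar_def)

lemma nonzero_values_eq_range: "nonzero_values f = range (qform f) - {0}"
  by (simp add: nonzero_values_def qform_def image_def)

lemma anisotropic_qform:
  assumes "anisotropic f" "qform f v = 0"
  shows "v = 0"
proof -
  obtain x y z where v: "v = (x, y, z)" by (metis surj_pair)
  have "form_eval f (rat_of_int x) (rat_of_int y) (rat_of_int z) = of_int (form_eval f x y z)"
    by (simp add: form_eval_def)
  also have "\<dots> = 0" using assms(2) by (simp add: v qform_def)
  finally have "rat_of_int x = 0 \<and> rat_of_int y = 0 \<and> rat_of_int z = 0"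
    using assms(1)[unfolded anisotropic_def] by blast
  then show ?thesis by (simp add: v zero_prod_def)
qed

definition combination ::
  "int \<times> int \<times> int \<Rightarrow> int \<times> int \<times> int \<Rightarrow> int \<times> int \<times> int \<Rightarrow> int \<times> int \<times> int \<Rightarrow> int \<times> int \<times> int" where
  "combination e1 e2 e3 = (\<lambda>(w1, w2, w3). scale w1 e1 + scale w2 e2 + scale w3 e3)"

definition orthogonal_frame ::
  "ternary_form \<Rightarrow> int \<Rightarrow> int \<times> int \<times> int \<Rightarrow> int \<times> int \<times> int \<Rightarrow> int \<times> int \<times> int \<Rightarrow> bool" where
  "orthogonal_frame f N e1 e2 e3 \<longleftrightarrow> polar f e1 e2 = 0 \<and> polar f e2 e3 = 0 \<and> polar f e3 e1 = 0 \<and>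
     (\<forall>v. scale N v \<in> range (combination e1 e2 e3))"

lemma orthogonal_frame_rotate:
  assumes "orthogonal_frame f N e1 e2 e3"
  shows "orthogonal_frame f N e2 e3 e1"
proof -
  have "combination e1 e2 e3 (w1, w2, w3) = combination e2 e3 e1 (w2, w3, w1)" for w1 w2 w3
    by (simp add: combination_def ac_simps)
  then have "range (combination e1 e2 e3) \<subseteq> range (combination e2 e3 e1)"
    by (auto simp: image_subset_iff)
  then show ?thesis using assms unfolding orthogonal_frame_def by blast
qed

lemma polar_combination:
  "polar f v (combination e1 e2 e3 (w1, w2, w3))
    = w1 * polar f v e1 + w2 * polar f v e2 + w3 * polar f v e3"
  by (simp add: combination_def polar_add_right polar_scale_right)

lemma qform_combination:
  assumes "orthogonal_frame f N e1 e2 e3"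
  shows "qform f (combination e1 e2 e3 (w1, w2, w3))
    = w1^2 * qform f e1 + w2^2 * qform f e2 + w3^2 * qform f e3"
proof -
  have "polar f e1 e2 = 0" "polar f e2 e3 = 0" "polar f e1 e3 = 0"
    using assms by (simp_all add: orthogonal_frame_def polar_commute[of f e1 e3])
  then show ?thesis
    by (simp add: combination_def qform_add qform_scale polar_add_left polar_scale_left
      polar_scale_right)
qed

lemma polar_multiple_eq:
  assumes "scale N v = combination e1 e2 e3 (u1, u2, u3)"
  shows "2 * N * qform f v = u1 * polar f v e1 + u2 * polar f v e2 + u3 * polar f v e3"
  using polar_scale_right[of f v N v] by (simp add: assms polar_combination polar_self)

lemma orthogonal_frame_values:
  assumes "orthogonal_frame f N e1 e2 e3"
  shows "\<exists>u1 u2 u3. u1^2 * qform f e1 + u2^2 * qform f e2 + u3^2 * qform f e3 = N^2 * qform f v"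
proof -
  obtain u1 u2 u3 where "scale N v = combination e1 e2 e3 (u1, u2, u3)"
    using assms unfolding orthogonal_frame_def by (metis rangeE surj_pair)
  then show ?thesis using qform_combination[OF assms] qform_scale by metis
qed

lemma orthogonal_frame_anisotropic:
  assumes an: "anisotropic f" and frame: "orthogonal_frame f N e1 e2 e3"
    and nonzero: "qform f e1 \<noteq> 0" "qform f e2 \<noteq> 0" "qform f e3 \<noteq> 0"
  shows "\<not> isotropic (qform f e1) (qform f e2) (qform f e3)"
proof
  assume "isotropic (qform f e1) (qform f e2) (qform f e3)"
  then obtain w1 w2 w3 where w: "(w1, w2, w3) \<noteq> (0, 0, 0)"
    "qform f e1 * w1^2 + qform f e2 * w2^2 + qform f e3 * w3^2 = 0"
    unfolding isotropic_def by blast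
  then have "qform f (combination e1 e2 e3 (w1, w2, w3)) = 0"
    unfolding qform_combination[OF frame] by (simp add: mult.commute)
  then have "combination e1 e2 e3 (w1, w2, w3) = 0" by (rule anisotropic_qform[OF an])
  moreover have "polar f e 0 = 0" for e
    using polar_scale_right[of f e 0 0] by (simp add: scale_def zero_prod_def)
  ultimately have vanish: "w1 * polar f e e1 + w2 * polar f e e2 + w3 * polar f e e3 = 0" for e
    by (metis polar_combination)
  have "polar f e1 e2 = 0" "polar f e2 e3 = 0" "polar f e3 e1 = 0"
    using frame by (simp_all add: orthogonal_frame_def)
  then have "w1 = 0" "w2 = 0" "w3 = 0"
    using vanish[of e1] vanish[of e2] vanish[of e3] nonzero
    by (simp_all add: polar_self polar_commute[of f e1 e3] polar_commute[of f e2 e1]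
      polar_commute[of f e3 e2])
  then show False using w(1) by simp
qed

text \<open>The vectors come from completing the square twice, with the denominators cleared.\<close>

lemma orthogonal_frame_exists:
  assumes an: "anisotropic f"
  obtains N e1 e2 e3 where "N \<noteq> 0" "orthogonal_frame f N e1 e2 e3"
    "qform f e1 \<noteq> 0" "qform f e2 \<noteq> 0" "qform f e3 \<noteq> 0"
proof -
  obtain A B C D E G where f: "f = Ternary_Form A B C D E G" by (cases f)
  define d p r where "d = 4 * A * B - D^2" and "p = D * G - 2 * B * E" and "r = D * E - 2 * A * G"
  define e1 e2 e3 where "e1 = (1 :: int, 0 :: int, 0 :: int)" and "e2 = (- D, 2 * A, 0 :: int)"
    and "e3 = (p, r, d)"
  have nonzero: "qform f e \<noteq> 0" if "e \<noteq> (0, 0, 0)" for e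
    using anisotropic_qform[OF an, of e] that by (auto simp: zero_prod_def)
  have "A \<noteq> 0" using nonzero[of e1] by (simp add: e1_def f qform_def form_eval_def)
  moreover have "qform f e2 = A * d"
    by (simp add: e2_def f d_def qform_def form_eval_def power2_eq_square algebra_simps)
  ultimately have "d \<noteq> 0" using nonzero[of e2] by (auto simp: e2_def)
  show ?thesis
  proof
    show "2 * A * d \<noteq> 0" using \<open>A \<noteq> 0\<close> \<open>d \<noteq> 0\<close> by simp
    show "qform f e1 \<noteq> 0" "qform f e2 \<noteq> 0" "qform f e3 \<noteq> 0"
      using \<open>A \<noteq> 0\<close> \<open>d \<noteq> 0\<close> by (auto intro!: nonzero simp: e1_def e2_def e3_def)
    have "scale (2 * A * d) v \<in> range (combination e1 e2 e3)" for v
    proof -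
      obtain x y z where v: "v = (x, y, z)" by (metis surj_pair)
      have "scale (2 * A * d) v = combination e1 e2 e3
          (2 * A * d * x + D * (d * y - r * z) - p * (2 * A * z), d * y - r * z, 2 * A * z)"
        by (simp add: v scale_def combination_def e1_def e2_def e3_def algebra_simps)
      then show ?thesis by simp
    qed
    moreover have "polar f e1 e2 = 0" "polar f e2 e3 = 0" "polar f e3 e1 = 0"
      by (simp_all add: polar_def qform_def form_eval_def f e1_def e2_def e3_def p_def r_def d_def
          power2_eq_square algebra_simps)
    ultimately show "orthogonal_frame f (2 * A * d) e1 e2 e3" by (simp add: orthogonal_frame_def)
  qed
qed

section \<open>Density of the values of an anisotropic form\<close>

lemma primitive_quadratic_progression:
  fixes b1 b2 b3 a1 a2 a3 M :: int and k P :: nat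
  defines "M \<equiv> fact P ^ (2 * k + 1)"
  assumes coefficients: "a1 > 0" "a2 \<noteq> 0" "a3 \<noteq> 0" and P: "P \<ge> 2" "\<bar>a1 * a2 * a3\<bar> \<le> int P"
    and shallow: "gcd M (gcd b1 (gcd b2 b3)) dvd fact P ^ k"
  obtains d q l1 l2 l3 where "M = d^2 * q" "b1 = d * l1" "b2 = d * l2" "b3 = d * l3"
    "quadratic_progression l1 l2 l3 a1 a2 a3 q P"
proof -
  let ?B = "fact P :: int"
  have M: "M > 0" by (simp add: M_def)
  define d where "d = gcd M (gcd b1 (gcd b2 b3))"
  have d_pos: "d > 0" using M by (simp add: d_def gcd_pos_int)
  obtain e where e: "?B ^ k = d * e" using shallow unfolding d_def by blast
  define q where "q = ?B * e^2"
  have "M = ?B * (?B ^ k)^2" unfolding M_def by (simp add: power_even_eq)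
  then have M_eq: "M = d^2 * q" by (simp add: e q_def power_mult_distrib)
  have "d dvd b1" "d dvd b2" "d dvd b3"
    unfolding d_def by (auto intro: dvd_trans[OF gcd_dvd2])
  then obtain l1 l2 l3 where l: "b1 = d * l1" "b2 = d * l2" "b3 = d * l3" by blast
  have "quadratic_progression l1 l2 l3 a1 a2 a3 q P"
  proof
    show "q > 0" using M M_eq d_pos by (simp add: zero_less_mult_iff)
    show "?B dvd q" by (simp add: q_def)
    have "a1 * a2 * a3 \<noteq> 0" using coefficients by simp
    then have "\<bar>a1 * a2 * a3\<bar> dvd ?B" by (intro int_dvd_fact P(2)) linarith
    then show "a1 * a2 * a3 dvd q" by (simp add: q_def)
    show "coprime q (gcd l1 (gcd l2 l3))"
    proof (rule coprimeI)
      fix g assume g: "g dvd q" "g dvd gcd l1 (gcd l2 l3)"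
      then have "g * d dvd M" by (auto simp: M_eq power2_eq_square mult_ac)
      moreover have "g * d dvd b1" "g * d dvd b2" "g * d dvd b3" using g(2) by (auto simp: l mult_ac)
      ultimately have "g * d dvd 1 * d" by (simp add: d_def)
      then show "is_unit g" using d_pos by (metis dvd_times_right_cancel_iff less_irrefl)
    qed
  qed (use coefficients P in auto)
  with M_eq l show ?thesis by (rule that)
qed

lemma quadratic_progression_in_class:
  fixes f :: ternary_form and k P :: nat and M :: int
  defines "M \<equiv> fact P ^ (2 * k + 1)"
  assumes frame: "orthogonal_frame f N e1 e2 e3"
    and coefficients: "qform f e1 > 0" "qform f e2 \<noteq> 0" "qform f e3 \<noteq> 0"
    and P: "P \<ge> 2" "\<bar>qform f e1 * qform f e2 * qform f e3\<bar> \<le> int P"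
    and shallow: "gcd M (2 * N * qform f v) dvd fact P ^ k"
  obtains l1 l2 l3 q where
    "quadratic_progression l1 l2 l3 (qform f e1) (qform f e2) (qform f e3) q P"
    "\<And>w. qform f v + M * quadratic_progression.F l1 l2 l3 (qform f e1) (qform f e2) (qform f e3) q w
      \<in> range (qform f)"
proof -
  let ?b1 = "polar f v e1" and ?b2 = "polar f v e2" and ?b3 = "polar f v e3"
  obtain u1 u2 u3 where "scale N v = combination e1 e2 e3 (u1, u2, u3)"
    using frame unfolding orthogonal_frame_def by (metis rangeE surj_pair)
  note polar_sum = polar_multiple_eq[OF this]
  let ?d = "gcd M (gcd ?b1 (gcd ?b2 ?b3))"
  have "?d dvd M" "?d dvd ?b1" "?d dvd ?b2" "?d dvd ?b3"
    by (auto intro: dvd_trans[OF gcd_dvd2])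
  then have "?d dvd gcd M (2 * N * qform f v)" unfolding polar_sum by simp
  then have "?d dvd fact P ^ k" using shallow by (rule dvd_trans)
  then obtain d q l1 l2 l3 where M_eq: "M = d^2 * q"
    and l: "?b1 = d * l1" "?b2 = d * l2" "?b3 = d * l3"
    and progression: "quadratic_progression l1 l2 l3 (qform f e1) (qform f e2) (qform f e3) q P"
    using primitive_quadratic_progression[OF coefficients P] unfolding M_def by metis
  have "qform f v + M * quadratic_progression.F l1 l2 l3 (qform f e1) (qform f e2) (qform f e3) q w
    \<in> range (qform f)" for w
  proof -
    obtain w1 w2 w3 where w: "w = (w1, w2, w3)" by (metis surj_pair)
    let ?c = "combination e1 e2 e3 (d * q * w1, d * q * w2, d * q * w3)"
    have "qform f (v + ?c) = qform f v
      + M * quadratic_progression.F l1 l2 l3 (qform f e1) (qform f e2) (qform f e3) q w"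
      unfolding qform_add qform_combination[OF frame] polar_combination w
        quadratic_progression.F_def[OF progression] M_eq l
      by (simp add: power2_eq_square algebra_simps)
    then show ?thesis by (metis rangeI)
  qed
  with progression show ?thesis by (rule that)
qed

lemma lower_density_values_in_class:
  fixes f :: ternary_form and k P :: nat and M :: int
  defines "M \<equiv> fact P ^ (2 * k + 1)"
  assumes frame: "orthogonal_frame f N e1 e2 e3"
    and coefficients: "qform f e1 > 0" "qform f e2 \<noteq> 0" "qform f e3 \<noteq> 0"
    and P: "P \<ge> 2" "\<bar>qform f e1 * qform f e2 * qform f e3\<bar> \<le> int P"
    and shallow: "gcd M (2 * N * qform f v) dvd fact P ^ k"
  shows "lower_density_ge {u \<in> nonzero_values f. u mod M = qform f v mod M} (1 / (1 + 768 / P) / M)"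
proof -
  obtain l1 l2 l3 q where
    progression: "quadratic_progression l1 l2 l3 (qform f e1) (qform f e2) (qform f e3) q P"
    and represented: "\<And>w. qform f v
      + M * quadratic_progression.F l1 l2 l3 (qform f e1) (qform f e2) (qform f e3) q w
      \<in> range (qform f)"
    using quadratic_progression_in_class[OF frame coefficients P] shallow unfolding M_def by metis
  interpret quadratic_progression l1 l2 l3 "qform f e1" "qform f e2" "qform f e3" q P
    by (rule progression)
  have "M > 0" by (simp add: M_def)
  from lower_density_ge_affine[OF this lower_density_values] show ?thesis
    by (rule lower_density_ge_mono) (use represented in \<open>auto simp: nonzero_values_eq_range\<close>)
qed

lemma lower_density_values_in_shallow_classes:
  fixes f :: ternary_form and k P :: nat and M :: int
  defines "M \<equiv> fact P ^ (2 * k + 1)"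
  assumes frame: "orthogonal_frame f N e1 e2 e3"
    and coefficients: "qform f e1 > 0" "qform f e2 \<noteq> 0" "qform f e3 \<noteq> 0"
    and P: "P \<ge> 2" "\<bar>qform f e1 * qform f e2 * qform f e3\<bar> \<le> int P"
  shows "lower_density_ge (nonzero_values f)
    (real (card {\<rho> \<in> range (\<lambda>v. qform f v mod M). gcd M (2 * N * \<rho>) dvd fact P ^ k})
      * (1 / (1 + 768 / P) / M))"
    (is "lower_density_ge _ (real (card ?G) * _)")
proof -
  have "M > 0" by (simp add: M_def)
  then have "finite ?G" by (intro finite_subset[of ?G "{0..<M}"]) auto
  have "lower_density_ge {u \<in> nonzero_values f. u mod M = \<rho>} (1 / (1 + 768 / P) / M)"
    if \<rho>: "\<rho> \<in> ?G" for \<rho>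
  proof -
    obtain v where v: "\<rho> = qform f v mod M" "gcd M (2 * N * \<rho>) dvd fact P ^ k" using \<rho> by blast
    have "[2 * N * \<rho> = 2 * N * qform f v] (mod M)" unfolding v(1) by (intro cong_scalar_left) simp
    then have "gcd M (2 * N * \<rho>) = gcd M (2 * N * qform f v)" by (metis cong_gcd_eq gcd.commute)
    then show ?thesis
      using lower_density_values_in_class[OF frame coefficients P, of k v] v by (simp add: M_def)
  qed
  then have "lower_density_ge (\<Union>\<rho>\<in>?G. {u \<in> nonzero_values f. u mod M = \<rho>})
      (card ?G * (1 / (1 + 768 / P) / M))"
    using \<open>finite ?G\<close> by (intro lower_density_ge_disjoint_UN) (auto simp: disjoint_family_on_def)
  then show ?thesis by (rule lower_density_ge_mono) auto
qed

lemma prime_power_dvd_if_gcd_not_dvd: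
  fixes B x :: int
  assumes B: "B \<noteq> 0" and not_dvd: "\<not> gcd (B ^ j) x dvd B ^ k"
  shows "\<exists>p. prime p \<and> p dvd B \<and> p ^ Suc k dvd x"
proof -
  let ?g = "gcd (B ^ j) x"
  have "?g \<noteq> 0" using B by simp
  then obtain p where p: "prime p" "multiplicity p (B ^ k) < multiplicity p ?g"
    using not_dvd multiplicity_le_imp_dvd[of ?g "B ^ k"] by (meson not_le)
  then have "p dvd ?g" by (metis not_dvd_imp_multiplicity_0 not_less_zero)
  then have "p dvd B" using p(1) prime_dvd_power by (meson dvd_trans gcd_dvd1)
  then have "p ^ k dvd B ^ k" by (rule dvd_power_same)
  then have "k \<le> multiplicity p (B ^ k)"
    using B p(1) by (intro multiplicity_geI) (auto simp: not_prime_unit)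
  then have "p ^ Suc k dvd ?g" using p(2) by (intro multiplicity_dvd') simp
  then show ?thesis using p(1) \<open>p dvd B\<close> dvd_trans[OF _ gcd_dvd2] by blast
qed

lemma card_annihilated_residues_le:
  fixes m c M e :: int
  assumes "0 < e" "e * \<bar>c\<bar> \<le> m" "c \<noteq> 0" "0 \<le> M"
  shows "int (card {\<rho> \<in> {0..<M}. m dvd c * \<rho>}) * e \<le> M - 1 + e"
proof -
  have "int (card {\<rho> \<in> {0..<M}. m dvd c * \<rho>}) * e \<le> (M - 1) - 0 + e"
  proof (rule card_separated_le)
    fix x y assume xy: "x \<in> {\<rho> \<in> {0..<M}. m dvd c * \<rho>}" "y \<in> {\<rho> \<in> {0..<M}. m dvd c * \<rho>}" "x < y"
    then have "m dvd c * y - c * x" by (blast intro: dvd_diff)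
    then have "m dvd \<bar>c * (y - x)\<bar>" by (simp add: algebra_simps)
    then have "m \<le> \<bar>c * (y - x)\<bar>" using xy(3) assms(3) by (intro zdvd_imp_le) auto
    then have "e * \<bar>c\<bar> \<le> (y - x) * \<bar>c\<bar>" using assms(2) xy(3) by (simp add: abs_mult mult.commute)
    then show "x + e \<le> y" using assms(3) by simp
  qed (use assms in auto)
  then show ?thesis by simp
qed

lemma deep_classes_subset:
  fixes c M :: int and j k P :: nat
  shows "{\<rho> \<in> {0..<M}. \<not> gcd (fact P ^ j) (c * \<rho>) dvd fact P ^ k}
    \<subseteq> (\<Union>p\<in>{p \<in> {1..int P}. prime p}. {\<rho> \<in> {0..<M}. p ^ Suc k dvd c * \<rho>})"
proof
  fix \<rho> assume \<rho>: "\<rho> \<in> {\<rho> \<in> {0..<M}. \<not> gcd (fact P ^ j) (c * \<rho>) dvd fact P ^ k}"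
  then obtain p where p: "prime p" "p dvd fact P" "p ^ Suc k dvd c * \<rho>"
    using prime_power_dvd_if_gcd_not_dvd[of "fact P" j "c * \<rho>" k] by auto
  have "int (nat p) dvd int (fact P)" using p(2) prime_gt_0_int[OF p(1)] by simp
  then have "nat p \<le> P"
    using p(1) by (simp only: of_nat_dvd_iff prime_dvd_fact_iff prime_nat_iff_prime)
  then have "p \<in> {p \<in> {1..int P}. prime p}" using p(1) prime_gt_0_int[OF p(1)] by auto
  then show "\<rho> \<in> (\<Union>p\<in>{p \<in> {1..int P}. prime p}. {\<rho> \<in> {0..<M}. p ^ Suc k dvd c * \<rho>})"
    using p(3) \<rho> by blast
qed

lemma card_deep_classes_le:
  fixes N e M :: int and k P :: nat
  defines "M \<equiv> fact P ^ (2 * k + 1)"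
  assumes N: "N \<noteq> 0" and P: "P \<ge> 2" and e: "0 < e" "e * \<bar>N\<bar> \<le> 2 ^ k"
  shows "int (card {\<rho> \<in> {0..<M}. \<not> gcd M (2 * N * \<rho>) dvd fact P ^ k}) * e \<le> 2 * int P * M"
    (is "int (card ?deep) * e \<le> _")
proof -
  let ?I = "{p \<in> {1..int P}. prime p}" and ?A = "\<lambda>p. {\<rho> \<in> {0..<M}. p ^ Suc k dvd 2 * N * \<rho>}"
  have fact: "(2 :: int) \<le> fact P" using int_dvd_fact[of 2 P] P by (intro zdvd_imp_le) auto
  have "e * 1 \<le> e * \<bar>N\<bar>" using N e(1) by (intro mult_left_mono) auto
  also have "\<dots> \<le> fact P ^ k" using e(2) power_mono[OF fact, of k] by simp
  also have "\<dots> \<le> M" unfolding M_def using fact by (intro power_increasing) auto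
  finally have e_le: "e \<le> M" by simp
  have "finite ?I" by (rule finite_subset[of _ "{1..int P}"]) auto
  moreover have "int (card (?A p)) \<le> 2 * M div e" if "p \<in> ?I" for p
  proof -
    have "(2 :: int) ^ Suc k \<le> p ^ Suc k" using that prime_ge_2_int by (intro power_mono) auto
    then have "e * \<bar>2 * N\<bar> \<le> p ^ Suc k" using e(2) by (simp add: abs_mult)
    then have "int (card (?A p)) * e \<le> M - 1 + e"
      using e(1) N e_le by (intro card_annihilated_residues_le) auto
    then have "int (card (?A p)) * e div e \<le> 2 * M div e" using e_le e(1) by (intro zdiv_mono1) auto
    then show ?thesis using e(1) by simp
  qed
  ultimately have union: "int (card (\<Union>p\<in>?I. ?A p)) \<le> int (card ?I) * (2 * M div e)"
    by (rule card_UN_le_mult)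
  have "finite (\<Union>p\<in>?I. ?A p)" by (rule finite_subset[of _ "{0..<M}"]) auto
  then have "card ?deep \<le> card (\<Union>p\<in>?I. ?A p)"
    unfolding M_def by (rule card_mono) (rule deep_classes_subset)
  then have "int (card ?deep) \<le> int (card ?I) * (2 * M div e)" using union by linarith
  also have "card ?I \<le> card {1..int P}" by (intro card_mono) auto
  then have "int (card ?I) * (2 * M div e) \<le> int P * (2 * M div e)"
    using e_le e(1) by (intro mult_right_mono) (auto simp: pos_imp_zdiv_nonneg_iff)
  finally have "int (card ?deep) * e \<le> int P * (2 * M div e) * e"
    using e(1) by (intro mult_right_mono) auto
  also have "\<dots> \<le> int P * (2 * M)"
    using e(1) by (simp add: mult.assoc mult_left_mono flip: minus_mod_eq_div_mult)
  finally show ?thesis by (simp add: mult_ac)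
qed

lemma deep_classes_rare:
  fixes N :: int and P :: nat and \<epsilon> :: real
  assumes "N \<noteq> 0" "P \<ge> 2" "\<epsilon> > 0"
  obtains k :: nat where
    "card {\<rho> \<in> {0..<fact P ^ (2 * k + 1)}. \<not> gcd (fact P ^ (2 * k + 1)) (2 * N * \<rho>) dvd fact P ^ k}
      \<le> \<epsilon> * real_of_int (fact P ^ (2 * k + 1))"
proof
  define e where "e = \<lceil>2 * real P / \<epsilon>\<rceil>"
  define k where "k = nat (e * \<bar>N\<bar>)"
  let ?M = "fact P ^ (2 * k + 1) :: int"
  let ?deep = "{\<rho> \<in> {0..<?M}. \<not> gcd ?M (2 * N * \<rho>) dvd fact P ^ k}"
  have "0 < 2 * real P / \<epsilon>" using assms by simp
  then have e: "0 < e" "2 * real P \<le> \<epsilon> * e"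
    unfolding e_def using assms(3) by (simp, metis divide_le_eq le_of_int_ceiling mult.commute)
  have "e * \<bar>N\<bar> \<le> 2 ^ k" using of_nat_less_two_power[of k, where 'a = int] e(1) by (simp add: k_def)
  from card_deep_classes_le[OF assms(1,2) e(1) this]
  have "real_of_int (int (card ?deep) * e) \<le> real_of_int (2 * int P * ?M)" by (simp only: of_int_le_iff)
  also have "\<dots> \<le> (\<epsilon> * ?M) * e"
    using mult_right_mono[OF e(2), of "real_of_int ?M"] by (simp add: mult_ac)
  finally show "card ?deep \<le> \<epsilon> * real_of_int ?M" using e(1) by simp
qed

lemma card_le_card_filter_plus_card:
  assumes "finite A" "B \<subseteq> A"
  shows "card B \<le> card {x \<in> B. Q x} + card {x \<in> A. \<not> Q x}"
proof -
  have "card B \<le> card ({x \<in> B. Q x} \<union> {x \<in> A. \<not> Q x})"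
    using assms by (intro card_mono) (auto dest: finite_subset)
  also have "\<dots> \<le> card {x \<in> B. Q x} + card {x \<in> A. \<not> Q x}" by (rule card_Un_le)
  finally show ?thesis .
qed

lemma values_dense_in_residues:
  assumes frame: "orthogonal_frame f N e1 e2 e3" and N: "N \<noteq> 0"
    and coefficients: "qform f e1 > 0" "qform f e2 \<noteq> 0" "qform f e3 \<noteq> 0" and \<epsilon>: "\<epsilon> > 0"
  obtains M :: int and \<delta> where "M > 0" "card (range (\<lambda>v. qform f v mod M)) / M - 2 * \<epsilon> \<le> \<delta>"
    "lower_density_ge (nonzero_values f) \<delta>"
proof -
  define P where "P = nat \<bar>qform f e1 * qform f e2 * qform f e3\<bar> + nat \<lceil>768 / \<epsilon>\<rceil> + 2"
  have P: "P \<ge> 2" "\<bar>qform f e1 * qform f e2 * qform f e3\<bar> \<le> int P" "768 / \<epsilon> < real P"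
    unfolding P_def using \<epsilon> by (simp, simp, linarith)
  define \<theta> where "\<theta> = 1 / (1 + 768 / real P)"
  have "1 - x \<le> 1 / (1 + x)" if "x \<ge> 0" for x :: real
    using that by (simp add: le_divide_eq algebra_simps)
  then have "1 - 768 / real P \<le> \<theta>" unfolding \<theta>_def by simp
  moreover have "768 / real P < \<epsilon>" using P \<epsilon> by (simp add: field_simps)
  ultimately have \<theta>: "1 - \<epsilon> < \<theta>" by linarith
  obtain k where deep: "card {\<rho> \<in> {0..<fact P ^ (2 * k + 1)}.
      \<not> gcd (fact P ^ (2 * k + 1)) (2 * N * \<rho>) dvd fact P ^ k} \<le> \<epsilon> * real_of_int (fact P ^ (2 * k + 1))"
    using deep_classes_rare[OF N P(1) \<epsilon>] .
  define M :: int where "M = fact P ^ (2 * k + 1)"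
  let ?R = "range (\<lambda>v. qform f v mod M)"
  define g where "g = card {\<rho> \<in> ?R. gcd M (2 * N * \<rho>) dvd fact P ^ k} / M"
  have M: "M > 0" by (simp add: M_def)
  then have R: "?R \<subseteq> {0..<M}" by auto
  have "card ?R \<le> card {\<rho> \<in> ?R. gcd M (2 * N * \<rho>) dvd fact P ^ k}
      + card {\<rho> \<in> {0..<M}. \<not> gcd M (2 * N * \<rho>) dvd fact P ^ k}"
    using R by (intro card_le_card_filter_plus_card) auto
  moreover have "card {\<rho> \<in> {0..<M}. \<not> gcd M (2 * N * \<rho>) dvd fact P ^ k} \<le> \<epsilon> * real_of_int M"
    unfolding M_def by (rule deep)
  ultimately have R_le: "card ?R / M \<le> g + \<epsilon>" using M by (simp add: g_def field_simps)
  have "card {\<rho> \<in> ?R. gcd M (2 * N * \<rho>) dvd fact P ^ k} \<le> card {0..<M}"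
    using R by (intro card_mono) auto
  then have "0 \<le> g" "g \<le> 1" using M by (simp_all add: g_def divide_le_eq)
  then have "(1 - \<theta>) * g \<le> \<epsilon> * 1" using \<theta> \<epsilon> by (intro mult_mono) auto
  moreover have "\<theta> * g = g - (1 - \<theta>) * g" by (simp add: algebra_simps)
  ultimately have "card ?R / M - 2 * \<epsilon> \<le> \<theta> * g" using R_le by linarith
  moreover have "lower_density_ge (nonzero_values f) (\<theta> * g)"
    using lower_density_values_in_shallow_classes[OF frame coefficients P(1,2), of k]
    by (simp add: M_def \<theta>_def g_def)
  ultimately show ?thesis by (rule that[OF M])
qed

lemma values_density_near:
  assumes frame: "orthogonal_frame f N e1 e2 e3" and N: "N \<noteq> 0"
    and coefficients: "qform f e1 > 0" "qform f e2 \<noteq> 0" "qform f e3 \<noteq> 0" and \<epsilon>: "\<epsilon> > 0"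
  shows "\<exists>a. \<forall>\<^sub>F n in sequentially. \<bar>real (card (nonzero_values f \<inter> {1..int n})) / real n - a\<bar> \<le> \<epsilon>"
proof -
  have "\<epsilon> / 3 > 0" using \<epsilon> by simp
  then obtain M \<delta> where M: "M > 0" and \<delta>: "lower_density_ge (nonzero_values f) \<delta>"
    "card (range (\<lambda>v. qform f v mod M)) / M - 2 * (\<epsilon> / 3) \<le> \<delta>"
    using values_dense_in_residues[OF frame N coefficients] by metis
  define a where "a = card (range (\<lambda>v. qform f v mod M)) / M"
  have "finite (range (\<lambda>v. qform f v mod M))" by (rule finite_subset[of _ "{0..<M}"]) (use M in auto)
  then have upper: "\<forall>\<^sub>F n in sequentially. card (nonzero_values f \<inter> {1..int n}) / real n \<le> a + \<epsilon>"
    unfolding a_def using M \<epsilon>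
    by (intro eventually_card_le_residues) (auto simp: nonzero_values_eq_range)
  have "a - \<epsilon> < \<delta>" using \<delta>(2) \<epsilon> unfolding a_def by linarith
  then have "\<forall>\<^sub>F n in sequentially. (a - \<epsilon>) * real n \<le> card (nonzero_values f \<inter> {1..int n})"
    using \<delta>(1) by (simp add: lower_density_ge_def)
  with upper have "\<forall>\<^sub>F n in sequentially. \<bar>card (nonzero_values f \<inter> {1..int n}) / real n - a\<bar> \<le> \<epsilon>"
    using eventually_gt_at_top[of 0]
  proof eventually_elim
    case (elim n)
    then have "a - \<epsilon> \<le> card (nonzero_values f \<inter> {1..int n}) / real n" by (simp add: le_divide_eq)
    then show ?case using elim(1) by linarith
  qed
  then show ?thesis ..
qed

lemma positive_values_convergent:
  assumes frame: "orthogonal_frame f N e1 e2 e3" and N: "N \<noteq> 0"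
    and coefficients: "qform f e1 \<noteq> 0" "qform f e2 \<noteq> 0" "qform f e3 \<noteq> 0"
  shows "convergent (\<lambda>n. real (card (nonzero_values f \<inter> {1..int n})) / real n)"
proof -
  consider "qform f e1 > 0" | "qform f e2 > 0" | "qform f e3 > 0"
    | "qform f e1 \<le> 0" "qform f e2 \<le> 0" "qform f e3 \<le> 0" by linarith
  then show ?thesis
  proof cases
    case 1
    show ?thesis
      by (intro convergent_if_eventually_near values_density_near[OF frame N 1 coefficients(2,3)])
  next
    case 2
    note frame' = orthogonal_frame_rotate[OF frame]
    show ?thesis
      by (intro convergent_if_eventually_near values_density_near[OF frame' N 2 coefficients(3,1)])
  next
    case 3
    note frame' = orthogonal_frame_rotate[OF orthogonal_frame_rotate[OF frame]]
    show ?thesis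
      by (intro convergent_if_eventually_near values_density_near[OF frame' N 3 coefficients(1,2)])
  next
    case 4
    have "qform f v \<le> 0" for v
    proof -
      obtain u1 u2 u3 where "u1^2 * qform f e1 + u2^2 * qform f e2 + u3^2 * qform f e3
        = N^2 * qform f v"
        using orthogonal_frame_values[OF frame] by blast
      moreover have "u1^2 * qform f e1 \<le> 0" "u2^2 * qform f e2 \<le> 0" "u3^2 * qform f e3 \<le> 0"
        using 4 by (simp_all add: mult_nonneg_nonpos)
      ultimately have "N^2 * qform f v \<le> 0" by linarith
      then show ?thesis using N by (simp add: mult_le_0_iff)
    qed
    then have "u \<le> 0" if "u \<in> nonzero_values f" for u using that by (auto simp: nonzero_values_eq_range)
    then have "nonzero_values f \<inter> {1..int n} = {}" for n by fastforce
    then show ?thesis by (simp add: convergent_const)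
  qed
qed

lemma limit_less_one_if_class_missed:
  fixes q r :: int
  assumes lim: "(\<lambda>n. real (card (S \<inter> {1..int n})) / real n) \<longlonglongrightarrow> L" and q: "q > 0"
    and missed: "\<And>v. v \<in> S \<Longrightarrow> \<not> q dvd v - r"
  shows "L < 1"
proof -
  let ?R = "{0..<q} - {r mod q}" and ?\<epsilon> = "1 / (2 * real_of_int q)"
  have "v mod q \<in> ?R" if "v \<in> S" for v
    using missed[OF that] q by (simp add: mod_eq_dvd_iff)
  then have "\<forall>\<^sub>F n in sequentially. card (S \<inter> {1..int n}) / real n \<le> card ?R / q + ?\<epsilon>"
    using q by (intro eventually_card_le_residues) auto
  then have "L \<le> card ?R / q + ?\<epsilon>" by (rule tendsto_upperbound[OF lim]) simp
  also have "card ?R = nat (q - 1)" using q by (simp add: card_Diff_singleton_if)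
  also have "nat (q - 1) / q + ?\<epsilon> < 1" using q by (simp add: field_simps)
  finally show ?thesis .
qed

theorem positive_values_density_less_one:
  assumes an: "anisotropic f"
  shows "\<exists>L<1. (\<lambda>n. real (card (nonzero_values f \<inter> {1..int n})) / real n) \<longlonglongrightarrow> L"
proof -
  obtain N e1 e2 e3 where N: "N \<noteq> 0" and frame: "orthogonal_frame f N e1 e2 e3"
    and coefficients: "qform f e1 \<noteq> 0" "qform f e2 \<noteq> 0" "qform f e3 \<noteq> 0"
    using orthogonal_frame_exists[OF an] .
  obtain L where L: "(\<lambda>n. real (card (nonzero_values f \<inter> {1..int n})) / real n) \<longlonglongrightarrow> L"
    using positive_values_convergent[OF frame N coefficients] unfolding convergent_def by blast
  obtain p k where p: "prime p" "anisotropic_mod p k (qform f e1) (qform f e2) (qform f e3)"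
    using anisotropic_mod_some_prime_power[OF coefficients
        orthogonal_frame_anisotropic[OF an frame coefficients]] .
  let ?abc = "qform f e1 * qform f e2 * qform f e3"
  have "?abc * N \<noteq> 0" using coefficients N by simp
  then obtain K where K: "\<And>x y z n. qform f e1 * x^2 + qform f e2 * y^2 + qform f e3 * z^2 = N^2 * n
      \<Longrightarrow> \<not> p ^ K dvd n + ?abc"
    using residue_class_missed[OF p(1) _ p(2)] by metis
  have "\<not> p ^ K dvd v - (- ?abc)" if "v \<in> nonzero_values f" for v
    using that orthogonal_frame_values[OF frame] K
    by (auto simp: nonzero_values_eq_range mult.commute) (metis mult.commute)
  then have "L < 1"
    using prime_gt_0_int[OF p(1)]
    by (intro limit_less_one_if_class_missed[OF L, where q = "p ^ K" and r = "- ?abc"]) simp_all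
  then show ?thesis using L by blast
qed

definition negated_form :: "ternary_form \<Rightarrow> ternary_form" where
  "negated_form f = Ternary_Form (- c11 f) (- c22 f) (- c33 f) (- c12 f) (- c13 f) (- c23 f)"

lemma form_eval_negated_form: "form_eval (negated_form f) x y z = - form_eval f x y z"
  by (simp add: form_eval_def negated_form_def algebra_simps)

lemma anisotropic_negated_form: "anisotropic f \<Longrightarrow> anisotropic (negated_form f)"
  unfolding anisotropic_def form_eval_negated_form neg_equal_0_iff_equal .

lemma card_negative_values:
  "card (nonzero_values f \<inter> {- int n..-1}) = card (nonzero_values (negated_form f) \<inter> {1..int n})"
proof -
  have "qform (negated_form f) v = - qform f v" for v
    by (simp add: qform_def case_prod_unfold form_eval_negated_form)
  then have "nonzero_values (negated_form f) \<inter> {1..int n} = uminus ` (nonzero_values f \<inter> {- int n..-1})"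
    by (force simp: nonzero_values_eq_range image_iff)
  then show ?thesis by (simp add: card_image)
qed

lemma density_less_one_if_sides:
  assumes zero: "0 \<notin> S"
    and pos: "(\<lambda>n. real (card (S \<inter> {1..int n})) / real n) \<longlonglongrightarrow> L" "L < 1"
    and neg: "(\<lambda>n. real (card (S \<inter> {- int n..-1})) / real n) \<longlonglongrightarrow> L'" "L' < 1"
  shows "has_density S \<and> density S < 1"
proof -
  have "card (S \<inter> {- int n..int n}) = card (S \<inter> {1..int n}) + card (S \<inter> {- int n..-1})" for n
  proof -
    have "1 \<le> x \<or> x \<le> - 1" if "x \<in> S" for x using that zero by (cases "x = 0") auto
    then have "S \<inter> {- int n..int n} = (S \<inter> {1..int n}) \<union> (S \<inter> {- int n..-1})" by fastforce
    then show ?thesis by (simp only:) (rule card_Un_disjoint; auto)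
  qed
  then have "density_seq S = (if positive_set S then (\<lambda>n. real (card (S \<inter> {1..int n})) / real n)
    else if negative_set S then (\<lambda>n. real (card (S \<inter> {- int n..-1})) / real n)
    else (\<lambda>n. (real (card (S \<inter> {1..int n})) / real n + real (card (S \<inter> {- int n..-1})) / real n) / 2))"
    by (auto simp: density_seq_def add_divide_distrib)
  moreover have "(\<lambda>n. (real (card (S \<inter> {1..int n})) / real n
      + real (card (S \<inter> {- int n..-1})) / real n) / 2)
    \<longlonglongrightarrow> (L + L') / 2"
    by (intro tendsto_intros pos neg) simp
  ultimately obtain l where "l < 1" "density_seq S \<longlonglongrightarrow> l"
    using pos neg that[of "(L + L') / 2"] by (cases "positive_set S"; cases "negative_set S") auto
  then show ?thesis unfolding has_density_def density_def by (auto simp: convergentI limI)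
qed

theorem theorem1p8:
  fixes f :: ternary_form
  assumes "nondegenerate f"
    and "anisotropic f"
  shows "has_density (nonzero_values f) \<and> form_density f < 1"
proof -
  obtain L where "(\<lambda>n. real (card (nonzero_values f \<inter> {1..int n})) / real n) \<longlonglongrightarrow> L" "L < 1"
    using positive_values_density_less_one[OF assms(2)] by blast
  moreover obtain L' where "(\<lambda>n. real (card (nonzero_values f \<inter> {- int n..-1})) / real n) \<longlonglongrightarrow> L'" "L' < 1"
    using positive_values_density_less_one[OF anisotropic_negated_form[OF assms(2)]]
    unfolding card_negative_values by blast
  moreover have "0 \<notin> nonzero_values f" by (simp add: nonzero_values_def)
  ultimately show ?thesis unfolding form_density_def by (intro density_less_one_if_sides)
qed

end
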